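(* Let $\Gamma\subset\mathrm{PSL}_2(\mathbb R)$ be a Fuchsian group of the first kind with at least one cusp and $V$ a quasi-vertex operator algebra. Put $$\Lambda:=\frac{12}{2\pi i}\frac{\partial}{\partial E_2^\Gamma}+L(1):\ Q(V,\Gamma)\to Q(V,\Gamma).$$ Then for every $f\in Q_k(V,\Gamma)$, $$f\Vert_k\gamma(\tau)=\exp\big(X(\gamma,\tau)\Lambda\big)f(\tau),\qquad\gamma\in\Gamma,$$ and consequently $M(V,\Gamma)=\ker\Lambda$.
   Context: QVOA: a quasi-vertex operator algebra is a $\mathbb Z$-graded vertex algebra $V=\bigoplus_n V_n$ (vertex operators $Y$, vacuum $\mathbf 1$) with $\dim V_n<\infty$ and $V_n=0$ for $n\ll0$, together with operators $L(-1),L(0),L(1)$ satisfying $[L(m),L(n)]=(m-n)L(m+n)$, where $L(-1)$ is the canonical derivation, $L(0)$ acts on $V_n$ as $n$ and $[L(1),Y(u,z)]=Y((L(1)+2zL(0)+z^2L(-1))u,z)$. $F_NV=\bigoplus_{n\le N}V_n$; $V^{(2)}$ is $V$ with doubled grading $V^{(2)}_{2n}=V_n$. Elements of $\Gamma$ are lifted to $\mathrm{SL}_2(\mathbb R)$ (full preimage). For $\gamma=\begin{pmatrix}a&b\\c&d\end{pmatrix}$: $j(\gamma,\tau)=c\tau+d$, $X(\gamma,\tau)=c/j(\gamma,\tau)$, $f|_k\gamma(\tau)=j(\gamma,\tau)^{-k}f(\gamma\tau)$, $K(\gamma,\tau)=e^{-c\,j(\gamma,\tau)L(1)}j(\gamma,\tau)^{-2L(0)}$,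 $f\Vert_k\gamma(\tau)=j(\gamma,\tau)^{-k}K(\gamma,\tau)^{-1}f(\gamma\tau)$. At a cusp $s=\sigma\infty$ ($\sigma\in\mathrm{SL}_2(\mathbb R)$) of width $\lambda$, $q_\lambda=e^{2\pi i\tau/\lambda}$. $Q_k(\Gamma)$: holomorphic $f:\mathbb H\to\mathbb C$ for which there are $s\ge0$ and holomorphic $Q_0(f),\dots,Q_s(f)$ with $f|_k\gamma(\tau)=\sum_{m=0}^sX(\gamma,\tau)^mQ_m(f)(\tau)$ for all $\gamma\in\Gamma$, holomorphic at the cusps: for every $\sigma\in\mathrm{SL}_2(\mathbb R)$ with $\sigma\infty$ a cusp and every $m$, $Q_m(f)|_{k-2m}\sigma$ is bounded as $\mathrm{Im}\,\tau\to\infty$, uniformly for $\mathrm{Re}\,\tau$ in compact sets. $M_k(\Gamma)$ is the subspace with $f|_k\gamma=f$ for all $\gamma\in\Gamma$. $Q(\Gamma)=\bigoplus_{k\ge0}Q_k(\Gamma)$, $M(\Gamma)=\bigoplus_kM_k(\Gamma)$. $Q_k(V,\Gamma)$ is defined in the same way for holomorphic $f:\mathbb H\to F_NV$ (some $N$), $Q_m(f):\mathbb H\to F_NV$, with $\Vert_k$ in place of $|_k$; $Q(V,\Gamma)=\bigoplus_{k\ge0}Q_k(V,\Gamma)$. $M_k(V,\Gamma)$: holomorphic $f:\mathbb H\to F_NV$ (some $N$) with $f\Vert_k\gamma=f$ for all $\gamma\in\Gamma$, such that $f\Vert_k\sigma\in F_NV[[q_\lambda]]$ at every cusp, and at every elliptic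 point $\tau_i$ with stabilizer generator $\gamma_i$ the vector $f(\tau_i)$ is fixed by $j(\gamma_i,\tau_i)^kK(\gamma_i,\tau_i)$. $M(V,\Gamma)=\bigoplus_kM_k(V,\Gamma)$. $E_2^\Gamma\in Q_2(\Gamma)$ is a fixed element with $E_2^\Gamma|_2\gamma=E_2^\Gamma+\frac{12}{2\pi i}X(\gamma,\tau)$ for all $\gamma\in\Gamma$; it exists since $\Gamma$ has a cusp, and $Q(\Gamma)=M(\Gamma)[E_2^\Gamma]$ is a free polynomial ring. Via the isomorphism $Q(\Gamma)\otimes V^{(2)}\cong Q(V,\Gamma)$, $f\otimes v\mapsto fv$, the operator $\partial/\partial E_2^\Gamma$ acts on the factor $Q(\Gamma)$ as formal differentiation in $E_2^\Gamma$ and $L(1)$ acts on the factor $V$.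
   Formalization: Q(V,Γ) and M(V,Γ) are sums over all integers k, not k≥0: if V has negative degrees, Λ (of weight -2) does not preserve the sum over k≥0 (e.g. E_2·v, v in V_{-1}). The equality M(V,Γ)=ker Λ is also stated for k≥0; for V in degrees ≥0 both agree. *)

theory Defs
  imports "HOL-Analysis.Analysis" "HOL-Library.Groups_Big_Fun"
begin

section \<open>Quasi-vertex operator algebras\<close>

text \<open>
  The underlying complex vector space is a whole type \<open>'v\<close> with its own addition and the scalar
  multiplication \<open>vscale\<close>. \<open>vmode V u n v\<close> is the mode product \<open>u\<^sub>n v\<close>, where
  \<open>Y(u,z) = \<Sum>\<^sub>n u\<^sub>n z\<^sup>-\<^sup>n\<^sup>-\<^sup>1\<close>. Only \<open>vL V (-1)\<close>, \<open>vL V 0\<close> and \<open>vL V 1\<close> are meaningful.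
\<close>

record 'v qvoa_data =
  vscale :: "complex \<Rightarrow> 'v \<Rightarrow> 'v"
  vgrade :: "int \<Rightarrow> 'v set"
  vmode :: "'v \<Rightarrow> int \<Rightarrow> 'v \<Rightarrow> 'v"
  vvac :: "'v"
  vL :: "int \<Rightarrow> 'v \<Rightarrow> 'v"

abbreviation vlinear_op :: "('v::ab_group_add) qvoa_data \<Rightarrow> ('v \<Rightarrow> 'v) \<Rightarrow> bool" where
  "vlinear_op V \<equiv> Vector_Spaces.linear (vscale V) (vscale V)"

abbreviation vfunctional :: "('v::ab_group_add) qvoa_data \<Rightarrow> ('v \<Rightarrow> complex) \<Rightarrow> bool" where
  "vfunctional V \<equiv> Vector_Spaces.linear (vscale V) (*)"

definition homogeneous_decomp :: "('v::ab_group_add) qvoa_data \<Rightarrow> 'v \<Rightarrow> (int \<Rightarrow> 'v) \<Rightarrow> bool" where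
  "homogeneous_decomp V v x \<longleftrightarrow>
     finite {n. x n \<noteq> 0} \<and> (\<forall>n. x n \<in> vgrade V n) \<and> v = Sum_any x"

text \<open>
  \<open>borcherds\<close> is the Jacobi identity in terms of modes; by \<open>truncation\<close> all sums in it are finite.
  \<open>L1_bracket\<close> is the coefficient of \<open>z\<^sup>-\<^sup>n\<^sup>-\<^sup>1\<close> in
  \<open>[L(1), Y(u,z)] = Y((L(1) + 2 z L(0) + z\<^sup>2 L(-1)) u, z)\<close>.
\<close>

locale quasi_voa =
  fixes V :: "('v::ab_group_add) qvoa_data"
  assumes vector_space_V: "vector_space (vscale V)"
    and mode_linear_left: "\<And>n v. vlinear_op V (\<lambda>u. vmode V u n v)"
    and mode_linear_right: "\<And>u n. vlinear_op V (vmode V u n)"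
    and truncation: "\<And>u v. \<exists>N. \<forall>n\<ge>N. vmode V u n v = 0"
    and vacuum: "\<And>n v. vmode V (vvac V) n v = (if n = -1 then v else 0)"
    and creation: "\<And>u. vmode V u (-1) (vvac V) = u"
    and creation_regular: "\<And>u n. n \<ge> 0 \<Longrightarrow> vmode V u n (vvac V) = 0"
    and borcherds: "\<And>u v w l m n.
      Sum_any (\<lambda>i::nat. vscale V (of_int m gchoose i)
        (vmode V (vmode V u (l + int i) v) (m + n - int i) w)) =
      Sum_any (\<lambda>i::nat. vscale V ((-1) ^ i * (of_int l gchoose i))
        (vmode V u (m + l - int i) (vmode V v (n + int i) w)
         - vscale V ((-1) powi l) (vmode V v (n + l - int i) (vmode V u (m + int i) w))))"
    and grade_subspace: "\<And>n. module.subspace (vscale V) (vgrade V n)"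
    and grade_direct_sum: "\<And>v. \<exists>!x. homogeneous_decomp V v x"
    and grade_finite_dim: "\<And>n. \<exists>B. finite B \<and> vgrade V n \<subseteq> module.span (vscale V) B"
    and grade_bounded_below: "\<exists>N. \<forall>n<N. vgrade V n = {0}"
    and vacuum_grade: "vvac V \<in> vgrade V 0"
    and mode_grade: "\<And>k l n u v. u \<in> vgrade V k \<Longrightarrow> v \<in> vgrade V l \<Longrightarrow>
      vmode V u n v \<in> vgrade V (k + l - n - 1)"
    and L_linear: "\<And>m. m \<in> {-1, 0, 1} \<Longrightarrow> vlinear_op V (vL V m)"
    and L_bracket: "\<And>m n v. m \<in> {-1, 0, 1} \<Longrightarrow> n \<in> {-1, 0, 1} \<Longrightarrow>
      vL V m (vL V n v) - vL V n (vL V m v) = vscale V (of_int (m - n)) (vL V (m + n) v)"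
    and L_minus_1: "\<And>v. vL V (-1) v = vmode V v (-2) (vvac V)"
    and L_0: "\<And>n v. v \<in> vgrade V n \<Longrightarrow> vL V 0 v = vscale V (of_int n) v"
    and L1_bracket: "\<And>u n v.
      vL V 1 (vmode V u n v) - vmode V u n (vL V 1 v) =
        vmode V (vL V 1 u) n v + vscale V 2 (vmode V (vL V 0 u) (n + 1) v)
        + vmode V (vL V (-1) u) (n + 2) v"

definition vcomp :: "('v::ab_group_add) qvoa_data \<Rightarrow> 'v \<Rightarrow> int \<Rightarrow> 'v" where
  "vcomp V v = (THE x. homogeneous_decomp V v x)"

definition vfilt :: "('v::ab_group_add) qvoa_data \<Rightarrow> int \<Rightarrow> 'v set" where
  "vfilt V N = module.span (vscale V) (\<Union>n\<in>{..N}. vgrade V n)"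

text \<open>\<open>exp_op V t A = e\<^sup>t\<^sup>A\<close> for locally nilpotent \<open>A\<close>; \<open>L0_power V e z = z\<^bsup>e L(0)\<^esup>\<close>.\<close>

definition exp_op :: "('v::ab_group_add) qvoa_data \<Rightarrow> complex \<Rightarrow> ('v \<Rightarrow> 'v) \<Rightarrow> 'v \<Rightarrow> 'v" where
  "exp_op V t A v = Sum_any (\<lambda>m::nat. vscale V (t ^ m / fact m) ((A ^^ m) v))"

definition L0_power :: "('v::ab_group_add) qvoa_data \<Rightarrow> int \<Rightarrow> complex \<Rightarrow> 'v \<Rightarrow> 'v" where
  "L0_power V e z v = Sum_any (\<lambda>n::int. vscale V (z powi (e * n)) (vcomp V v n))"


section \<open>Fuchsian groups of the first kind, cusps, elliptic points\<close>

definition uhp :: "complex set" where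
  "uhp = {\<tau>. Im \<tau> > 0}"

definition SL2R :: "(real^2^2) set" where
  "SL2R = {\<gamma>. det \<gamma> = 1}"

definition jfac :: "real^2^2 \<Rightarrow> complex \<Rightarrow> complex" where
  "jfac \<gamma> \<tau> = of_real (\<gamma>$2$1) * \<tau> + of_real (\<gamma>$2$2)"

definition Xfac :: "real^2^2 \<Rightarrow> complex \<Rightarrow> complex" where
  "Xfac \<gamma> \<tau> = of_real (\<gamma>$2$1) / jfac \<gamma> \<tau>"

definition moebius :: "real^2^2 \<Rightarrow> complex \<Rightarrow> complex" where
  "moebius \<gamma> \<tau> = (of_real (\<gamma>$1$1) * \<tau> + of_real (\<gamma>$1$2)) / jfac \<gamma> \<tau>"

text \<open>The action on the Riemann sphere \<open>complex option\<close>, where \<open>None\<close> is the point \<open>\<infinity>\<close>.\<close>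

definition moebius_ext :: "real^2^2 \<Rightarrow> complex option \<Rightarrow> complex option" where
  "moebius_ext \<gamma> p = (case p of
      None \<Rightarrow> if \<gamma>$2$1 = 0 then None else Some (of_real (\<gamma>$1$1 / \<gamma>$2$1))
    | Some z \<Rightarrow> if jfac \<gamma> z = 0 then None else Some (moebius \<gamma> z))"

text \<open>
  A subgroup of \<open>PSL\<^sub>2(\<real>)\<close> is represented by its full preimage in \<open>SL\<^sub>2(\<real>)\<close>, i.e. by a subgroup of
  \<open>SL\<^sub>2(\<real>)\<close> containing \<open>-1\<close>.
\<close>

definition PSL2R_subgroup :: "(real^2^2) set \<Rightarrow> bool" where
  "PSL2R_subgroup \<Gamma> \<longleftrightarrow> \<Gamma> \<subseteq> SL2R \<and> mat 1 \<in> \<Gamma> \<and> - mat 1 \<in> \<Gamma> \<and>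
     (\<forall>\<gamma>\<in>\<Gamma>. \<forall>\<delta>\<in>\<Gamma>. \<gamma> ** \<delta> \<in> \<Gamma>) \<and> (\<forall>\<gamma>\<in>\<Gamma>. matrix_inv \<gamma> \<in> \<Gamma>)"

definition parabolic :: "real^2^2 \<Rightarrow> bool" where
  "parabolic \<gamma> \<longleftrightarrow> \<gamma> \<in> SL2R \<and> \<bar>trace \<gamma>\<bar> = 2 \<and> \<gamma> \<noteq> mat 1 \<and> \<gamma> \<noteq> - mat 1"

definition cusps :: "(real^2^2) set \<Rightarrow> complex option set" where
  "cusps \<Gamma> = {s \<in> insert None (range (\<lambda>x::real. Some (of_real x))).
     \<exists>\<gamma>\<in>\<Gamma>. parabolic \<gamma> \<and> moebius_ext \<gamma> s = s}"

definition translation :: "real \<Rightarrow> real^2^2" where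
  "translation h = vector [vector [1, h], vector [0, 1]]"

text \<open>
  \<open>\<lambda>\<close> is the width of the cusp \<open>\<sigma>\<infinity>\<close> with respect to \<open>\<sigma>\<close>: the stabilizer of \<open>\<infinity>\<close> in
  \<open>\<sigma>\<^sup>-\<^sup>1\<Gamma>\<sigma>\<close> is generated by \<open>\<tau> \<mapsto> \<tau> + \<lambda>\<close>.
\<close>

definition cusp_width :: "(real^2^2) set \<Rightarrow> real^2^2 \<Rightarrow> real \<Rightarrow> bool" where
  "cusp_width \<Gamma> \<sigma> w \<longleftrightarrow> w > 0 \<and>
     {h. \<sigma> ** translation h ** matrix_inv \<sigma> \<in> \<Gamma>} = range (\<lambda>n::int. of_int n * w)"

definition stabilizer_generator :: "(real^2^2) set \<Rightarrow> complex \<Rightarrow> real^2^2 \<Rightarrow> bool" where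
  "stabilizer_generator \<Gamma> \<tau> \<gamma>0 \<longleftrightarrow> \<gamma>0 \<in> \<Gamma> \<and> moebius \<gamma>0 \<tau> = \<tau> \<and>
     (\<forall>\<gamma>\<in>\<Gamma>. moebius \<gamma> \<tau> = \<tau> \<longrightarrow>
        (\<exists>n. \<gamma> = (((**) \<gamma>0) ^^ n) (mat 1) \<or> \<gamma> = - (((**) \<gamma>0) ^^ n) (mat 1)))"

definition elliptic_points :: "(real^2^2) set \<Rightarrow> complex set" where
  "elliptic_points \<Gamma> =
     {\<tau>\<in>uhp. \<exists>\<gamma>\<in>\<Gamma>. \<gamma> \<noteq> mat 1 \<and> \<gamma> \<noteq> - mat 1 \<and> moebius \<gamma> \<tau> = \<tau>}"

text \<open>
  \<open>\<H>\<^sup>* = \<H> \<union> {cusps}\<close> with the horodisc topology: a subbase is given by the open subsets of \<open>\<H>\<close> and the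
  sets \<open>{\<sigma>\<infinity>} \<union> \<sigma>{Im \<tau> > y}\<close> at the cusps \<open>\<sigma>\<infinity>\<close>.
\<close>

definition Hstar_topology :: "(real^2^2) set \<Rightarrow> complex option topology" where
  "Hstar_topology \<Gamma> = topology_generated_by
     ({Some ` W |W. open W \<and> W \<subseteq> uhp} \<union>
      {insert (moebius_ext \<sigma> None) (Some ` moebius \<sigma> ` {\<tau>. Im \<tau> > y}) |\<sigma> y.
         \<sigma> \<in> SL2R \<and> moebius_ext \<sigma> None \<in> cusps \<Gamma> \<and> y > 0})"

definition quotient_topology :: "'a topology \<Rightarrow> ('a \<Rightarrow> 'b) \<Rightarrow> 'b topology" where
  "quotient_topology T p =
     topology (\<lambda>U. U \<subseteq> p ` topspace T \<and> openin T {x \<in> topspace T. p x \<in> U})"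

lemma openin_quotient_topology:
  "openin (quotient_topology T p) U \<longleftrightarrow>
     U \<subseteq> p ` topspace T \<and> openin T {x \<in> topspace T. p x \<in> U}"
proof -
  have int: "{x \<in> topspace T. p x \<in> A \<inter> B} =
      {x \<in> topspace T. p x \<in> A} \<inter> {x \<in> topspace T. p x \<in> B}" for A B
    by auto
  have un: "{x \<in> topspace T. p x \<in> \<Union>\<K>} = (\<Union>K\<in>\<K>. {x \<in> topspace T. p x \<in> K})" for \<K>
    by auto
  have "istopology (\<lambda>U. U \<subseteq> p ` topspace T \<and> openin T {x \<in> topspace T. p x \<in> U})"
    unfolding istopology_def int un by (auto intro: openin_Int openin_Union)
  thus ?thesis by (simp add: quotient_topology_def)
qed

definition group_orbit :: "(real^2^2) set \<Rightarrow> complex option \<Rightarrow> complex option set" where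
  "group_orbit \<Gamma> p = {moebius_ext \<gamma> p |\<gamma>. \<gamma> \<in> \<Gamma>}"

text \<open>First kind in the sense of Shimura: the quotient \<open>\<Gamma>\<setminus>\<H>\<^sup>*\<close> is compact.\<close>

definition fuchsian_first_kind :: "(real^2^2) set \<Rightarrow> bool" where
  "fuchsian_first_kind \<Gamma> \<longleftrightarrow> PSL2R_subgroup \<Gamma> \<and> discrete \<Gamma> \<and>
     compact_space (quotient_topology (Hstar_topology \<Gamma>) (group_orbit \<Gamma>))"


section \<open>Scalar-valued quasi-modular and modular forms\<close>

text \<open>
  A function on \<open>\<H>\<close> is represented by a function on all of \<open>\<complex>\<close> that is zero outside \<open>\<H>\<close>, so that
  equality of functions on \<open>\<H>\<close> is equality in HOL.
\<close>

definition slash :: "int \<Rightarrow> real^2^2 \<Rightarrow> (complex \<Rightarrow> complex) \<Rightarrow> complex \<Rightarrow> complex" where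
  "slash k \<gamma> f \<tau> = jfac \<gamma> \<tau> powi (- k) * f (moebius \<gamma> \<tau>)"

definition bounded_at_i_infinity :: "(complex \<Rightarrow> complex) \<Rightarrow> bool" where
  "bounded_at_i_infinity g \<longleftrightarrow>
     (\<forall>a b::real. \<exists>y>0. \<exists>B. \<forall>\<tau>. a \<le> Re \<tau> \<and> Re \<tau> \<le> b \<and> y \<le> Im \<tau> \<longrightarrow> cmod (g \<tau>) \<le> B)"

definition quasimodular :: "(real^2^2) set \<Rightarrow> int \<Rightarrow> (complex \<Rightarrow> complex) set" where
  "quasimodular \<Gamma> k = {f. f holomorphic_on uhp \<and> (\<forall>\<tau>. \<tau> \<notin> uhp \<longrightarrow> f \<tau> = 0) \<and>
     (\<exists>(s::nat) Q. (\<forall>m\<le>s. Q m holomorphic_on uhp) \<and>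
        (\<forall>\<gamma>\<in>\<Gamma>. \<forall>\<tau>\<in>uhp. slash k \<gamma> f \<tau> = (\<Sum>m\<le>s. Xfac \<gamma> \<tau> ^ m * Q m \<tau>)) \<and>
        (\<forall>\<sigma>\<in>SL2R. moebius_ext \<sigma> None \<in> cusps \<Gamma> \<longrightarrow>
           (\<forall>m\<le>s. bounded_at_i_infinity (slash (k - 2 * int m) \<sigma> (Q m)))))}"

definition modular :: "(real^2^2) set \<Rightarrow> int \<Rightarrow> (complex \<Rightarrow> complex) set" where
  "modular \<Gamma> k = {f \<in> quasimodular \<Gamma> k. \<forall>\<gamma>\<in>\<Gamma>. \<forall>\<tau>\<in>uhp. slash k \<gamma> f \<tau> = f \<tau>}"

text \<open>
  The sum over the weights \<open>k \<in> K\<close>, as a space of functions. For the spaces of forms considered here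
  forms of different weights are linearly independent, so this is the direct sum.
\<close>

definition weight_sum :: "int set \<Rightarrow> (int \<Rightarrow> (complex \<Rightarrow> 'b::comm_monoid_add) set)
    \<Rightarrow> (complex \<Rightarrow> 'b) set" where
  "weight_sum K A = {F. \<exists>S g. finite S \<and> S \<subseteq> K \<and> (\<forall>k\<in>S. g k \<in> A k) \<and>
     F = (\<lambda>\<tau>. \<Sum>k\<in>S. g k \<tau>)}"

definition quasimodular_ring :: "(real^2^2) set \<Rightarrow> (complex \<Rightarrow> complex) set" where
  "quasimodular_ring \<Gamma> = weight_sum {0..} (quasimodular \<Gamma>)"

definition modular_ring :: "(real^2^2) set \<Rightarrow> (complex \<Rightarrow> complex) set" where
  "modular_ring \<Gamma> = weight_sum {0..} (modular \<Gamma>)"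

definition is_E2 :: "(real^2^2) set \<Rightarrow> (complex \<Rightarrow> complex) \<Rightarrow> bool" where
  "is_E2 \<Gamma> E \<longleftrightarrow> E \<in> quasimodular \<Gamma> 2 \<and>
     (\<forall>\<gamma>\<in>\<Gamma>. \<forall>\<tau>\<in>uhp. slash 2 \<gamma> E \<tau> = E \<tau> + 12 / (2 * of_real pi * \<i>) * Xfac \<gamma> \<tau>)"

text \<open>
  Formal differentiation with respect to \<open>E = E\<^sub>2\<^sup>\<Gamma>\<close> on \<open>Q(\<Gamma>) = M(\<Gamma>)[E]\<close>; the result is determined
  because \<open>E\<close> is transcendental over \<open>M(\<Gamma>)\<close>.
\<close>

definition deriv_E2 :: "(real^2^2) set \<Rightarrow> (complex \<Rightarrow> complex) \<Rightarrow> (complex \<Rightarrow> complex)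
    \<Rightarrow> complex \<Rightarrow> complex" where
  "deriv_E2 \<Gamma> E f = (THE g. \<exists>(n::nat) a. (\<forall>i\<le>n. a i \<in> modular_ring \<Gamma>) \<and>
     f = (\<lambda>\<tau>. \<Sum>i\<le>n. a i \<tau> * E \<tau> ^ i) \<and>
     g = (\<lambda>\<tau>. \<Sum>i\<le>n. of_nat i * a i \<tau> * E \<tau> ^ (i - 1)))"


section \<open>Vector-valued quasi-modular and modular forms\<close>

text \<open>\<open>K(\<gamma>,\<tau>) = e\<^bsup>-c j L(1)\<^esup> j\<^bsup>-2 L(0)\<^esup>\<close>\<close>

definition Kop :: "('v::ab_group_add) qvoa_data \<Rightarrow> real^2^2 \<Rightarrow> complex \<Rightarrow> 'v \<Rightarrow> 'v" where
  "Kop V \<gamma> \<tau> v = exp_op V (- of_real (\<gamma>$2$1) * jfac \<gamma> \<tau>) (vL V 1) (L0_power V (-2) (jfac \<gamma> \<tau>) v)"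

definition vslash :: "('v::ab_group_add) qvoa_data \<Rightarrow> int \<Rightarrow> real^2^2 \<Rightarrow> (complex \<Rightarrow> 'v)
    \<Rightarrow> complex \<Rightarrow> 'v" where
  "vslash V k \<gamma> f \<tau> = vscale V (jfac \<gamma> \<tau> powi (- k)) (inv (Kop V \<gamma> \<tau>) (f (moebius \<gamma> \<tau>)))"

text \<open>
  As \<open>F\<^sub>N V\<close> is finite-dimensional, holomorphy of and bounds for functions into \<open>F\<^sub>N V\<close>, and convergence
  of series in it, are tested on linear functionals.
\<close>

definition vholomorphic :: "('v::ab_group_add) qvoa_data \<Rightarrow> int \<Rightarrow> (complex \<Rightarrow> 'v) \<Rightarrow> bool" where
  "vholomorphic V N f \<longleftrightarrow> (\<forall>\<tau>\<in>uhp. f \<tau> \<in> vfilt V N) \<and>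
     (\<forall>\<phi>. vfunctional V \<phi> \<longrightarrow> (\<lambda>\<tau>. \<phi> (f \<tau>)) holomorphic_on uhp)"

definition vbounded_at_i_infinity :: "('v::ab_group_add) qvoa_data \<Rightarrow> (complex \<Rightarrow> 'v) \<Rightarrow> bool" where
  "vbounded_at_i_infinity V g \<longleftrightarrow>
     (\<forall>\<phi>. vfunctional V \<phi> \<longrightarrow> bounded_at_i_infinity (\<lambda>\<tau>. \<phi> (g \<tau>)))"

definition vquasimodular :: "('v::ab_group_add) qvoa_data \<Rightarrow> (real^2^2) set \<Rightarrow> int
    \<Rightarrow> (complex \<Rightarrow> 'v) set" where
  "vquasimodular V \<Gamma> k = {f. (\<forall>\<tau>. \<tau> \<notin> uhp \<longrightarrow> f \<tau> = 0) \<and>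
     (\<exists>N. vholomorphic V N f \<and>
     (\<exists>(s::nat) Q. (\<forall>m\<le>s. vholomorphic V N (Q m)) \<and>
        (\<forall>\<gamma>\<in>\<Gamma>. \<forall>\<tau>\<in>uhp. vslash V k \<gamma> f \<tau> = (\<Sum>m\<le>s. vscale V (Xfac \<gamma> \<tau> ^ m) (Q m \<tau>))) \<and>
        (\<forall>\<sigma>\<in>SL2R. moebius_ext \<sigma> None \<in> cusps \<Gamma> \<longrightarrow>
           (\<forall>m\<le>s. vbounded_at_i_infinity V (vslash V (k - 2 * int m) \<sigma> (Q m))))))}"

text \<open>\<open>g \<in> F\<^sub>N V[[q\<^sub>w]]\<close>, where \<open>q\<^sub>w = e\<^bsup>2\<pi>i\<tau>/w\<^esup>\<close>\<close>

definition has_q_expansion :: "('v::ab_group_add) qvoa_data \<Rightarrow> int \<Rightarrow> real \<Rightarrow> (complex \<Rightarrow> 'v) \<Rightarrow> bool" where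
  "has_q_expansion V N w g \<longleftrightarrow> (\<exists>a. (\<forall>n::nat. a n \<in> vfilt V N) \<and>
     (\<forall>\<tau>\<in>uhp. \<forall>\<phi>. vfunctional V \<phi> \<longrightarrow>
        (\<lambda>n. \<phi> (a n) * exp (2 * of_real pi * \<i> * \<tau> / of_real w) ^ n) sums \<phi> (g \<tau>)))"

definition vmodular :: "('v::ab_group_add) qvoa_data \<Rightarrow> (real^2^2) set \<Rightarrow> int
    \<Rightarrow> (complex \<Rightarrow> 'v) set" where
  "vmodular V \<Gamma> k = {f. (\<forall>\<tau>. \<tau> \<notin> uhp \<longrightarrow> f \<tau> = 0) \<and>
     (\<exists>N. vholomorphic V N f \<and>
        (\<forall>\<gamma>\<in>\<Gamma>. \<forall>\<tau>\<in>uhp. vslash V k \<gamma> f \<tau> = f \<tau>) \<and>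
        (\<forall>\<sigma>\<in>SL2R. \<forall>w. moebius_ext \<sigma> None \<in> cusps \<Gamma> \<and> cusp_width \<Gamma> \<sigma> w \<longrightarrow>
           has_q_expansion V N w (vslash V k \<sigma> f)) \<and>
        (\<forall>\<tau>\<in>elliptic_points \<Gamma>. \<forall>\<gamma>. stabilizer_generator \<Gamma> \<tau> \<gamma> \<longrightarrow>
           vscale V (jfac \<gamma> \<tau> powi k) (Kop V \<gamma> \<tau> (f \<tau>)) = f \<tau>))}"

text \<open>
  \<open>\<Lambda> = 12/(2\<pi>i) \<partial>/\<partial>E + L(1)\<close>, transported along \<open>Q(\<Gamma>) \<otimes> V \<cong> Q(V,\<Gamma>)\<close>, \<open>f \<otimes> v \<mapsto> f v\<close>; the result is
  determined because this map is injective.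
\<close>

definition Lambda_op :: "('v::ab_group_add) qvoa_data \<Rightarrow> (real^2^2) set \<Rightarrow> (complex \<Rightarrow> complex)
    \<Rightarrow> (complex \<Rightarrow> 'v) \<Rightarrow> complex \<Rightarrow> 'v" where
  "Lambda_op V \<Gamma> E F = (THE G. \<exists>(n::nat) f v. (\<forall>i<n. f i \<in> quasimodular_ring \<Gamma>) \<and>
     F = (\<lambda>\<tau>. \<Sum>i<n. vscale V (f i \<tau>) (v i)) \<and>
     G = (\<lambda>\<tau>. \<Sum>i<n. vscale V (12 / (2 * of_real pi * \<i>) * deriv_E2 \<Gamma> E (f i) \<tau>) (v i)
                    + vscale V (f i \<tau>) (vL V 1 (v i))))"

text \<open>
  \<open>V\<close> may have components of negative degree, and then \<open>Q(\<Gamma>) \<otimes> V\<^sup>(\<^sup>2\<^sup>)\<close> has elements of negative weight.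
  Hence \<open>Q(V,\<Gamma>)\<close> and \<open>M(V,\<Gamma>)\<close> are the sums over all integral weights.
\<close>

definition vquasimodular_space :: "('v::ab_group_add) qvoa_data \<Rightarrow> (real^2^2) set
    \<Rightarrow> (complex \<Rightarrow> 'v) set" where
  "vquasimodular_space V \<Gamma> = weight_sum UNIV (vquasimodular V \<Gamma>)"

definition vmodular_space :: "('v::ab_group_add) qvoa_data \<Rightarrow> (real^2^2) set
    \<Rightarrow> (complex \<Rightarrow> 'v) set" where
  "vmodular_space V \<Gamma> = weight_sum UNIV (vmodular V \<Gamma>)"

end

theory Submission
  imports Defs "HOL-Complex_Analysis.Complex_Analysis"
begin

text \<open>
Write \<open>j\<close> and \<open>X\<close> for the factors of \<open>\<gamma>\<close> at \<open>\<tau>\<close>, and \<open>\<kappa> = 12/(2\<pi>i)\<close>. The coefficients \<open>Q\<^sub>m\<close> of a form \<open>f\<close>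
of weight \<open>k\<close> are given by \<open>f \<parallel>\<^sub>k \<gamma> = \<Sum>\<^sub>m X\<^sup>m Q\<^sub>m\<close>. The theorem says that \<open>\<Lambda>\<close> is the operator
\<open>f \<mapsto> Q\<^sub>1\<close>, and that this operator generates all the \<open>Q\<^sub>m\<close>: \<open>\<Lambda>\<^sup>m f = m! Q\<^sub>m\<close>.

\<^item> The coefficients are determined by \<open>f\<close>. For fixed \<open>\<tau>\<close> the functions \<open>j\<^sup>w X\<^sup>m\<close> on \<open>\<Gamma>\<close> are linearly
independent (\<open>weight_depth_independent\<close>). Indeed, along the powers of a unipotent element of \<open>\<Gamma>\<close> that fixes
a cusp \<open>\<noteq> \<infinity>\<close>, \<open>j\<close> tends to infinity while \<open>X\<close> converges to a number given by the cusp. So the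
highest power of \<open>j\<close> splits off, and its coefficient is a polynomial that vanishes at the numbers belonging to all
the cusps of a \<open>\<Gamma>\<close>-orbit. This orbit is infinite since \<open>\<Gamma>\<close> does not fix a cusp (\<open>cusp_moved\<close>); otherwise
\<open>\<Gamma>\<close> would act by translations after conjugation, and its quotient would not be compact.

\<^item> Scalar forms. The top coefficient of a quasi-modular form is modular, so the depth can be lowered by subtracting a
modular form times a power of \<open>E = E\<^sub>2\<^sup>\<Gamma>\<close>; hence \<open>f\<close> is a polynomial in \<open>E\<close> over the modular forms. No negative weights
occur, by the maximum principle (\<open>negative_weight_vanishes\<close>). For \<open>f = a E\<^sup>i\<close> with \<open>a\<close> modular,
\<open>Q\<^sub>1 = i \<kappa> a E\<^sup>i\<^sup>-\<^sup>1\<close>, so that \<open>\<kappa> \<partial>/\<partial>E\<close> is \<open>f \<mapsto> Q\<^sub>1\<close> on all scalar forms (\<open>deriv_E2_xcoeff\<close>).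

\<^item> Vector-valued forms. Moving \<open>j\<^bsup>2L(0)\<^esup>\<close> past \<open>e\<^bsup>tL(1)\<^esup>\<close> multiplies \<open>t\<close> by \<open>j\<^sup>-\<^sup>2\<close>; therefore
\<open>K\<^sup>-\<^sup>1 = e\<^bsup>X L(1)\<^esup> j\<^bsup>2L(0)\<^esup>\<close> (\<open>inv_Kop\<close>). Multiplying \<open>f \<parallel>\<^sub>k \<gamma>\<close> by \<open>e\<^bsup>-X L(1)\<^esup>\<close> turns each homogeneous
coordinate \<open>\<phi>(f)\<close> into a scalar quasi-modular form with first coefficient \<open>\<phi>(Q\<^sub>1) - \<phi>(L(1) f)\<close>
(\<open>coordinate_quasimodular\<close>). By the scalar case this is \<open>\<kappa> \<partial>\<phi>(f)/\<partial>E\<close>, which gives \<open>\<Lambda> f = Q\<^sub>1\<close>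
(\<open>Lambda_eq_Q1\<close>). Comparing coefficients in \<open>f \<parallel> \<gamma>\<delta> = (f \<parallel> \<gamma>) \<parallel> \<delta>\<close> shows that \<open>Q\<^sub>1\<close> is again
quasi-modular, of weight \<open>k - 2\<close> and with coefficients \<open>(m + 1) Q\<^sub>m\<^sub>+\<^sub>1\<close> (\<open>vq_data_shift\<close>). Induction yields
\<open>\<Lambda>\<^sup>m f = m! Q\<^sub>m\<close>.

\<^item> The kernel. \<open>\<Lambda> f = 0\<close> means that \<open>Q\<^sub>m = 0\<close> for all \<open>m > 0\<close>, that is, \<open>f \<parallel>\<^sub>k \<gamma> = f\<close>. For such \<open>f\<close>, being
bounded at a cusp is the same as having a \<open>q\<close>-expansion there, and the condition at an elliptic point is the invariance
under its stabilizer (\<open>vmodular_iff\<close>). Sums of several weights reduce to single weights by the independence of the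
powers of \<open>j\<close>.
\<close>

section \<open>Moebius transformations and automorphy factors\<close>

text \<open>
Without this, every matrix entry \<open>A$i$j\<close> would also parse as a coefficient of a formal power series.
\<close>

no_notation fps_nth (infixl "$" 75)

lemma mat_entries [simp]:
  "(A ** B) $ i $ j = A$i$1 * B$1$j + A$i$2 * B$2$j" for A B :: "real^2^2"
  by (simp add: matrix_matrix_mult_def sum_2)

lemma mat_eq_iff2:
  "A = B \<longleftrightarrow> A$1$1 = B$1$1 \<and> A$1$2 = B$1$2 \<and> A$2$1 = B$2$1 \<and> A$2$2 = B$2$2" for A B :: "real^2^2"
  by (simp only: vec_eq_iff forall_2 conj_assoc)

lemma mat1_entries [simp]:
  "(mat 1 :: real^2^2)$1$1 = 1" "(mat 1 :: real^2^2)$1$2 = 0"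
  "(mat 1 :: real^2^2)$2$1 = 0" "(mat 1 :: real^2^2)$2$2 = 1"
  by (auto simp: mat_def)

lemma SL2R_iff: "A \<in> SL2R \<longleftrightarrow> A$1$1 * A$2$2 - A$1$2 * A$2$1 = 1"
  by (simp add: SL2R_def det_2)

lemma SL2R_one [simp]: "mat 1 \<in> SL2R" by (simp add: SL2R_iff)

lemma SL2R_mult: "A \<in> SL2R \<Longrightarrow> B \<in> SL2R \<Longrightarrow> A ** B \<in> SL2R"
  by (simp add: SL2R_def det_mul)

lemma matrix_inv_SL2R:
  assumes "A \<in> SL2R"
  shows "matrix_inv A = vector [vector [A$2$2, - A$1$2], vector [- A$2$1, A$1$1]]" (is "_ = ?B")
proof -
  have 1: "A ** ?B = mat 1" "?B ** A = mat 1"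
    using assms by (simp_all add: mat_eq_iff2 SL2R_iff algebra_simps)
  have 2: "C = ?B" if "A ** C = mat 1 \<and> C ** A = mat 1" for C
  proof -
    have "C = (?B ** A) ** C" by (simp only: 1 matrix_mul_lid)
    also have "\<dots> = ?B" unfolding matrix_mul_assoc[symmetric] using that by simp
    finally show ?thesis .
  qed
  show ?thesis unfolding matrix_inv_def by (rule some_equality, rule conjI[OF 1], rule 2)
qed

lemma matrix_inv_entries:
  assumes "A \<in> SL2R"
  shows "matrix_inv A $1$1 = A$2$2" "matrix_inv A $1$2 = - A$1$2"
    "matrix_inv A $2$1 = - A$2$1" "matrix_inv A $2$2 = A$1$1"
  using assms by (simp_all add: matrix_inv_SL2R)

lemma SL2R_inv: "A \<in> SL2R \<Longrightarrow> matrix_inv A \<in> SL2R"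
  by (simp add: SL2R_iff matrix_inv_entries mult.commute)

lemma SL2R_inv_left: "A \<in> SL2R \<Longrightarrow> matrix_inv A ** A = mat 1"
  by (simp add: mat_eq_iff2 matrix_inv_entries SL2R_iff algebra_simps)

lemma SL2R_inv_right: "A \<in> SL2R \<Longrightarrow> A ** matrix_inv A = mat 1"
  by (simp add: mat_eq_iff2 matrix_inv_entries SL2R_iff algebra_simps)

lemma jfac_nz:
  assumes "A \<in> SL2R" "\<tau> \<in> uhp"
  shows "jfac A \<tau> \<noteq> 0"
proof
  assume 0: "jfac A \<tau> = 0"
  hence "A$2$1 * Im \<tau> = 0" by (auto simp: jfac_def complex_eq_iff)
  hence "A$2$1 = 0" using assms(2) by (simp add: uhp_def)
  moreover from this 0 have "A$2$2 = 0" by (auto simp: jfac_def complex_eq_iff)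
  ultimately show False using assms(1) by (simp add: SL2R_iff)
qed

lemma Im_moebius:
  assumes "A \<in> SL2R" "\<tau> \<in> uhp"
  shows "Im (moebius A \<tau>) = Im \<tau> / (cmod (jfac A \<tau>))\<^sup>2"
proof -
  have "(A$1$1 * A$2$2 - A$1$2 * A$2$1) * Im \<tau> = Im \<tau>" using assms by (simp add: SL2R_iff)
  thus ?thesis
    by (simp add: moebius_def Im_divide jfac_def cmod_power2 algebra_simps power2_eq_square)
      (simp add: cmod_power2[unfolded power2_eq_square] algebra_simps)
qed

lemma moebius_uhp:
  assumes "A \<in> SL2R" "\<tau> \<in> uhp"
  shows "moebius A \<tau> \<in> uhp"
  using Im_moebius[OF assms] jfac_nz[OF assms] assms(2) by (simp add: uhp_def)

lemma jfac_mult: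
  assumes "B \<in> SL2R" "\<tau> \<in> uhp"
  shows "jfac (A ** B) \<tau> = jfac A (moebius B \<tau>) * jfac B \<tau>"
  using jfac_nz[OF assms] by (simp add: jfac_def moebius_def field_simps)

lemma moebius_mult:
  assumes "A \<in> SL2R" "B \<in> SL2R" "\<tau> \<in> uhp"
  shows "moebius (A ** B) \<tau> = moebius A (moebius B \<tau>)"
proof -
  define N where "N = complex_of_real (A$1$1) * (B$1$1 * \<tau> + B$1$2) + A$1$2 * jfac B \<tau>"
  have nz: "jfac B \<tau> \<noteq> 0" using jfac_nz assms by blast
  have 1: "complex_of_real (A$1$1) * moebius B \<tau> + A$1$2 = N / jfac B \<tau>"
    using nz by (simp add: N_def moebius_def field_simps)
  have 2: "complex_of_real ((A**B)$1$1) * \<tau> + (A**B)$1$2 = N"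
    by (simp add: N_def jfac_def algebra_simps)
  have "moebius (A ** B) \<tau> = N / (jfac A (moebius B \<tau>) * jfac B \<tau>)"
    unfolding moebius_def[of "A**B"] 2 jfac_mult[OF assms(2,3)] ..
  also have "\<dots> = moebius A (moebius B \<tau>)"
    unfolding moebius_def[of A "moebius B \<tau>"] 1 by simp
  finally show ?thesis .
qed

text \<open>
\<open>X\<close> is the logarithmic derivative of \<open>j\<close> in \<open>\<tau>\<close>, so its cocycle relation is the derivative of that of \<open>j\<close>.
\<close>

lemma Xfac_mult:
  assumes "A \<in> SL2R" "B \<in> SL2R" "\<tau> \<in> uhp"
  shows "Xfac (A ** B) \<tau> = Xfac B \<tau> + Xfac A (moebius B \<tau>) / jfac B \<tau> ^ 2"
proof -
  have jB: "jfac B \<tau> \<noteq> 0" and jA: "jfac A (moebius B \<tau>) \<noteq> 0"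
    using assms jfac_nz moebius_uhp by blast+
  define n where "n = moebius B \<tau> * jfac B \<tau>"
  have n: "n = B$1$1 * \<tau> + B$1$2" using jB by (simp add: n_def moebius_def)
  have "complex_of_real (B$1$1 * B$2$2 - B$1$2 * B$2$1) = 1"
    using assms(2) unfolding SL2R_iff by simp
  hence d: "complex_of_real (B$1$1) * B$2$2 - complex_of_real (B$1$2) * B$2$1 = 1" by simp
  have key: "complex_of_real ((A**B)$2$1) * jfac B \<tau> = B$2$1 * (A$2$1 * n + A$2$2 * jfac B \<tau>) + A$2$1"
    using d unfolding n jfac_def mat_entries of_real_add of_real_mult by algebra
  have e: "A$2$1 * n + A$2$2 * jfac B \<tau> = jfac A (moebius B \<tau>) * jfac B \<tau>"
    by (simp add: n_def jfac_def[of A] algebra_simps)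
  have "Xfac (A ** B) \<tau> = ((A**B)$2$1 * jfac B \<tau>) / (jfac A (moebius B \<tau>) * jfac B \<tau> ^ 2)"
    using jA jB unfolding Xfac_def jfac_mult[OF assms(2,3)] by (simp add: field_simps power2_eq_square)
  also have "\<dots> = Xfac B \<tau> + Xfac A (moebius B \<tau>) / jfac B \<tau> ^ 2"
    unfolding key e Xfac_def using jA jB by (simp add: field_simps power2_eq_square)
  finally show ?thesis .
qed

lemma jfac_one [simp]: "jfac (mat 1) \<tau> = 1" by (simp add: jfac_def)
lemma Xfac_one [simp]: "Xfac (mat 1) \<tau> = 0" by (simp add: Xfac_def)
lemma moebius_one [simp]: "moebius (mat 1) \<tau> = \<tau>" by (simp add: moebius_def)

lemma open_uhp [simp]: "open uhp"
  unfolding uhp_def by (rule open_halfspace_Im_gt)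

lemma connected_uhp [simp]: "connected uhp"
  unfolding uhp_def by (intro convex_connected convex_halfspace_Im_gt)

lemma jfac_holomorphic: "jfac A holomorphic_on S"
  unfolding jfac_def by (intro holomorphic_intros)

lemma moebius_holomorphic: "A \<in> SL2R \<Longrightarrow> moebius A holomorphic_on uhp"
  unfolding moebius_def by (intro holomorphic_intros jfac_holomorphic) (auto simp: jfac_nz)

lemma Xfac_holomorphic: "A \<in> SL2R \<Longrightarrow> Xfac A holomorphic_on uhp"
  unfolding Xfac_def by (intro holomorphic_intros jfac_holomorphic) (auto simp: jfac_nz)

lemma Xfac_bounded: "bounded_at_i_infinity (Xfac A)" 
proof (cases "A$2$1 = 0")
  case True
  thus ?thesis unfolding bounded_at_i_infinity_def Xfac_def by (auto intro!: exI[of _ 1])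
next
  case False
  have "cmod (Xfac A \<tau>) \<le> 1" if "1 \<le> Im \<tau>" for \<tau>
  proof -
    have "\<bar>A$2$1\<bar> * 1 \<le> \<bar>A$2$1\<bar> * \<bar>Im \<tau>\<bar>" using that by (intro mult_left_mono) auto
    also have "\<dots> = \<bar>Im (jfac A \<tau>)\<bar>" by (simp add: jfac_def abs_mult)
    also have "\<dots> \<le> cmod (jfac A \<tau>)" by (rule abs_Im_le_cmod)
    finally show ?thesis using False by (simp add: Xfac_def norm_divide divide_simps)
  qed
  thus ?thesis unfolding bounded_at_i_infinity_def by (auto intro!: exI[of _ 1])
qed

lemma bounded_at_i_infinity_add:
  assumes "bounded_at_i_infinity f" "bounded_at_i_infinity g"
  shows "bounded_at_i_infinity (\<lambda>\<tau>. f \<tau> + g \<tau>)"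
  unfolding bounded_at_i_infinity_def
proof (intro allI)
  fix a b :: real
  obtain y B where 1: "y > 0" "\<And>\<tau>. a \<le> Re \<tau> \<and> Re \<tau> \<le> b \<and> y \<le> Im \<tau> \<Longrightarrow> cmod (f \<tau>) \<le> B"
    using assms(1) unfolding bounded_at_i_infinity_def by meson
  obtain y' B' where 2: "y' > 0" "\<And>\<tau>. a \<le> Re \<tau> \<and> Re \<tau> \<le> b \<and> y' \<le> Im \<tau> \<Longrightarrow> cmod (g \<tau>) \<le> B'"
    using assms(2) unfolding bounded_at_i_infinity_def by meson
  have "cmod (f \<tau> + g \<tau>) \<le> B + B'" if "a \<le> Re \<tau> \<and> Re \<tau> \<le> b \<and> max y y' \<le> Im \<tau>" for \<tau>
    using 1(2)[of \<tau>] 2(2)[of \<tau>] that norm_triangle_le[of "f \<tau>" "g \<tau>" "B+B'"] by auto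
  thus "\<exists>y>0. \<exists>B. \<forall>\<tau>. a \<le> Re \<tau> \<and> Re \<tau> \<le> b \<and> y \<le> Im \<tau> \<longrightarrow> cmod (f \<tau> + g \<tau>) \<le> B"
    using 1(1) by (intro exI[of _ "max y y'"]) auto
qed

lemma bounded_at_i_infinity_mult:
  assumes "bounded_at_i_infinity f" "bounded_at_i_infinity g"
  shows "bounded_at_i_infinity (\<lambda>\<tau>. f \<tau> * g \<tau>)"
  unfolding bounded_at_i_infinity_def
proof (intro allI)
  fix a b :: real
  obtain y B where 1: "y > 0" "\<And>\<tau>. a \<le> Re \<tau> \<and> Re \<tau> \<le> b \<and> y \<le> Im \<tau> \<Longrightarrow> cmod (f \<tau>) \<le> B"
    using assms(1) unfolding bounded_at_i_infinity_def by meson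
  obtain y' B' where 2: "y' > 0" "\<And>\<tau>. a \<le> Re \<tau> \<and> Re \<tau> \<le> b \<and> y' \<le> Im \<tau> \<Longrightarrow> cmod (g \<tau>) \<le> B'"
    using assms(2) unfolding bounded_at_i_infinity_def by meson
  have "cmod (f \<tau> * g \<tau>) \<le> B * B'" if "a \<le> Re \<tau> \<and> Re \<tau> \<le> b \<and> max y y' \<le> Im \<tau>" for \<tau>
  proof -
    have "cmod (f \<tau>) \<le> B" "cmod (g \<tau>) \<le> B'" using 1(2)[of \<tau>] 2(2)[of \<tau>] that by auto
    thus ?thesis unfolding norm_mult by (intro mult_mono) (auto intro: order_trans[OF norm_ge_zero])
  qed
  thus "\<exists>y>0. \<exists>B. \<forall>\<tau>. a \<le> Re \<tau> \<and> Re \<tau> \<le> b \<and> y \<le> Im \<tau> \<longrightarrow> cmod (f \<tau> * g \<tau>) \<le> B"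
    using 1(1) by (intro exI[of _ "max y y'"]) auto
qed

lemma bounded_at_i_infinity_const [simp]: "bounded_at_i_infinity (\<lambda>\<tau>. c)"
  unfolding bounded_at_i_infinity_def by (intro allI exI[of _ 1] conjI exI[of _ "cmod c"]) auto

lemma bounded_at_i_infinity_power:
  "bounded_at_i_infinity f \<Longrightarrow> bounded_at_i_infinity (\<lambda>\<tau>. f \<tau> ^ n)"
  by (induction n) (auto intro: bounded_at_i_infinity_mult)

lemma bounded_at_i_infinity_sum:
  "(\<And>i. i \<in> I \<Longrightarrow> bounded_at_i_infinity (f i)) \<Longrightarrow> bounded_at_i_infinity (\<lambda>\<tau>. \<Sum>i\<in>I. f i \<tau>)"
  by (induction I rule: infinite_finite_induct) (auto intro: bounded_at_i_infinity_add)

text \<open>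
The bound concerns large \<open>Im \<tau>\<close> only, so agreement on the upper half plane suffices.
\<close>

lemma bounded_at_i_infinity_cong:
  assumes "\<And>\<tau>. \<tau> \<in> uhp \<Longrightarrow> f \<tau> = g \<tau>" "bounded_at_i_infinity f"
  shows "bounded_at_i_infinity g"
  unfolding bounded_at_i_infinity_def
proof (intro allI)
  fix a b :: real
  obtain y B where 1: "y > 0" "\<And>\<tau>. a \<le> Re \<tau> \<and> Re \<tau> \<le> b \<and> y \<le> Im \<tau> \<Longrightarrow> cmod (f \<tau>) \<le> B"
    using assms(2) unfolding bounded_at_i_infinity_def by meson
  have "cmod (g \<tau>) \<le> B" if "a \<le> Re \<tau> \<and> Re \<tau> \<le> b \<and> y \<le> Im \<tau>" for \<tau>
    using 1(2)[of \<tau>] 1(1) that assms(1)[of \<tau>] by (auto simp: uhp_def)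
  thus "\<exists>y>0. \<exists>B. \<forall>\<tau>. a \<le> Re \<tau> \<and> Re \<tau> \<le> b \<and> y \<le> Im \<tau> \<longrightarrow> cmod (g \<tau>) \<le> B"
    using 1(1) by blast
qed


section \<open>Unipotent elements at a cusp\<close>

text \<open>
The unipotent elements that fix the cusp \<open>\<sigma>\<infinity>\<close>. They depend only on the first column \<open>(a, c)\<close> of \<open>\<sigma>\<close>: the
matrix is \<open>1 + h N\<close> with \<open>N = (-ac, a\<^sup>2; -c\<^sup>2, ac)\<close>.
\<close>

definition cusp_shift :: "real^2^2 \<Rightarrow> real \<Rightarrow> real^2^2" where
  "cusp_shift \<sigma> h = \<sigma> ** translation h ** matrix_inv \<sigma>"

lemma translation_entries [simp]:
  "translation h $1$1 = 1" "translation h $1$2 = h" "translation h $2$1 = 0" "translation h $2$2 = 1"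
  by (simp_all add: translation_def)

lemma translation_SL2R [simp]: "translation h \<in> SL2R" by (simp add: SL2R_iff)

lemma matrix_inv_mult:
  assumes "A \<in> SL2R" "B \<in> SL2R" shows "matrix_inv (A ** B) = matrix_inv B ** matrix_inv A"
  using assms by (simp add: mat_eq_iff2 matrix_inv_entries SL2R_mult algebra_simps)

lemma SL2R_cancel:
  assumes "A \<in> SL2R"
  shows "matrix_inv A ** (A ** B) = B" "A ** (matrix_inv A ** B) = B"
    "C ** A ** matrix_inv A = C" "C ** matrix_inv A ** A = C"
  using assms by (simp_all add: matrix_mul_assoc SL2R_inv_left SL2R_inv_right)
    (simp_all add: matrix_mul_assoc[symmetric] SL2R_inv_left SL2R_inv_right)

lemma cusp_shift_entries:
  assumes "\<sigma> \<in> SL2R"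
  shows "cusp_shift \<sigma> h $1$1 = 1 - h * (\<sigma>$1$1 * \<sigma>$2$1)" "cusp_shift \<sigma> h $1$2 = h * (\<sigma>$1$1)\<^sup>2"
    "cusp_shift \<sigma> h $2$1 = - h * (\<sigma>$2$1)\<^sup>2" "cusp_shift \<sigma> h $2$2 = 1 + h * (\<sigma>$1$1 * \<sigma>$2$1)"
  using assms by (simp_all add: cusp_shift_def matrix_inv_entries SL2R_iff algebra_simps power2_eq_square)

lemma cusp_shift_SL2R: "\<sigma> \<in> SL2R \<Longrightarrow> cusp_shift \<sigma> h \<in> SL2R"
  by (simp add: cusp_shift_def SL2R_mult SL2R_inv)

lemma cusp_shift_0: "\<sigma> \<in> SL2R \<Longrightarrow> cusp_shift \<sigma> 0 = mat 1"
  by (simp add: mat_eq_iff2 cusp_shift_entries)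

lemma cusp_shift_add: "\<sigma> \<in> SL2R \<Longrightarrow> cusp_shift \<sigma> h ** cusp_shift \<sigma> h' = cusp_shift \<sigma> (h + h')"
  by (simp add: mat_eq_iff2 cusp_shift_entries algebra_simps power2_eq_square)

lemma cusp_shift_inv: "\<sigma> \<in> SL2R \<Longrightarrow> matrix_inv (cusp_shift \<sigma> h) = cusp_shift \<sigma> (- h)"
  by (simp add: mat_eq_iff2 matrix_inv_entries cusp_shift_SL2R cusp_shift_entries)

lemma cusp_shift_conj:
  assumes "A \<in> SL2R" "\<sigma> \<in> SL2R"
  shows "cusp_shift (A ** \<sigma>) h = A ** cusp_shift \<sigma> h ** matrix_inv A"
  using assms by (simp add: cusp_shift_def matrix_inv_mult matrix_mul_assoc)

lemma cusp_shift_scaleR: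
  assumes "\<sigma> \<in> SL2R"
  shows "cusp_shift \<sigma> h - mat 1 = h *\<^sub>R (cusp_shift \<sigma> 1 - mat 1)"
  using assms by (simp add: mat_eq_iff2 cusp_shift_entries)

lemma cusp_shift_eq_1:
  assumes "\<sigma> \<in> SL2R" "cusp_shift \<sigma> h = mat 1" shows "h = 0"
proof (rule ccontr)
  assume "h \<noteq> 0"
  hence "\<sigma>$1$1 = 0" "\<sigma>$2$1 = 0"
    using assms by (auto simp: mat_eq_iff2 cusp_shift_entries)
  thus False using assms(1) by (simp add: SL2R_iff)
qed

locale fuchsian =
  fixes \<Gamma> :: "(real^2^2) set"
  assumes first_kind: "fuchsian_first_kind \<Gamma>" and has_cusp: "cusps \<Gamma> \<noteq> {}"
begin

abbreviation at_cusp :: "real^2^2 \<Rightarrow> bool" where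
  "at_cusp \<sigma> \<equiv> moebius_ext \<sigma> None \<in> cusps \<Gamma>"

lemma subgroup: "PSL2R_subgroup \<Gamma>" and discrete_G: "discrete \<Gamma>"
  and compact_quotient: "compact_space (quotient_topology (Hstar_topology \<Gamma>) (group_orbit \<Gamma>))"
  using first_kind by (auto simp: fuchsian_first_kind_def)

lemma G_SL2R: "\<gamma> \<in> \<Gamma> \<Longrightarrow> \<gamma> \<in> SL2R"
  and G_one: "mat 1 \<in> \<Gamma>" and G_minus_one: "- mat 1 \<in> \<Gamma>"
  and G_mult: "\<gamma> \<in> \<Gamma> \<Longrightarrow> \<delta> \<in> \<Gamma> \<Longrightarrow> \<gamma> ** \<delta> \<in> \<Gamma>"
  and G_inv: "\<gamma> \<in> \<Gamma> \<Longrightarrow> matrix_inv \<gamma> \<in> \<Gamma>"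
  using subgroup by (auto simp: PSL2R_subgroup_def)

section \<open>Compactness of the quotient\<close>

lemma topspace_Hstar_uhp: "\<tau> \<in> uhp \<Longrightarrow> Some \<tau> \<in> topspace (Hstar_topology \<Gamma>)"
  by (auto simp: Hstar_topology_def intro!: UnI1 exI[of _ uhp])

text \<open>
The form in which compactness of \<open>\<Gamma>\<setminus>\<H>\<^sup>*\<close> is used. The sets where \<open>F < r n\<close>, together with all cusps, are
\<open>\<Gamma>\<close>-stable and increase with \<open>n\<close>; they are open because each cusp has a horodisc on which \<open>F < r n\<close>. Their
images cover the quotient, so one of them is everything.
\<close>

lemma invariant_bounded_by_cusps:
  fixes F :: "complex \<Rightarrow> real" and r :: "nat \<Rightarrow> real"
  assumes cont: "continuous_on uhp F"
    and inv: "\<And>\<gamma> \<tau>. \<gamma> \<in> \<Gamma> \<Longrightarrow> \<tau> \<in> uhp \<Longrightarrow> F (moebius \<gamma> \<tau>) = F \<tau>"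
    and "mono r" and pt: "\<And>\<tau>. \<tau> \<in> uhp \<Longrightarrow> \<exists>n. F \<tau> < r n"
    and cusp: "\<And>\<sigma> n. \<sigma> \<in> SL2R \<Longrightarrow> at_cusp \<sigma> \<Longrightarrow>
        \<exists>y>0. \<forall>\<tau>. y < Im \<tau> \<longrightarrow> F (moebius \<sigma> \<tau>) < r n"
  shows "\<exists>n. \<forall>\<tau>\<in>uhp. F \<tau> < r n"
proof -
  define T where "T = Hstar_topology \<Gamma>"
  define p where "p = group_orbit \<Gamma>"
  define Q where "Q = quotient_topology T p"
  define U where "U n = {x \<in> topspace T. \<forall>\<tau>\<in>uhp. x = Some \<tau> \<longrightarrow> F \<tau> < r n}" for n
  have p_self: "x \<in> p x" for x
    unfolding p_def group_orbit_def
    by (auto intro!: exI[of _ "mat 1"] G_one simp: moebius_ext_def split: option.splits)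
  have inner: "\<exists>W. openin T W \<and> Some \<tau> \<in> W \<and> W \<subseteq> U n" if "\<tau> \<in> uhp" "F \<tau> < r n" for \<tau> n
  proof -
    define W where "W = {\<tau> \<in> uhp. F \<tau> \<in> {..<r n}}"
    have "open (F -` {..<r n} \<inter> uhp)"
      by (rule cont[unfolded continuous_on_open_vimage[OF open_uhp], rule_format, OF open_lessThan])
    also have "F -` {..<r n} \<inter> uhp = W" by (auto simp: W_def)
    finally have "open W" .
    hence "openin T (Some ` W)"
      unfolding T_def Hstar_topology_def
      by (intro topology_generated_by_Basis) (auto simp: W_def)
    moreover have "Some \<tau> \<in> Some ` W" using that by (auto simp: W_def)
    moreover have "Some ` W \<subseteq> U n" unfolding U_def T_def using topspace_Hstar_uhp by (auto simp: W_def)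
    ultimately show ?thesis by blast
  qed
  have opn: "openin T (U n)" for n
  proof (subst openin_subopen, intro ballI)
    fix x assume x: "x \<in> U n"
    hence "x \<in> topspace T" by (simp add: U_def)
    then obtain K where K: "x \<in> K" "K \<in> {Some ` W |W. open W \<and> W \<subseteq> uhp} \<union>
      {insert (moebius_ext \<sigma> None) (Some ` moebius \<sigma> ` {\<tau>. Im \<tau> > y}) |\<sigma> y.
         \<sigma> \<in> SL2R \<and> at_cusp \<sigma> \<and> y > 0}"
      unfolding T_def Hstar_topology_def topology_generated_by_topspace by (elim UnionE)
    have "(\<exists>\<tau>\<in>uhp. x = Some \<tau>) \<or>
        (\<exists>\<sigma>\<in>SL2R. at_cusp \<sigma> \<and> x = moebius_ext \<sigma> None)"
      using K(2)
    proof (elim UnE CollectE exE conjE)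
      fix \<sigma> :: "real^2^2" and y :: real
      assume *: "K = insert (moebius_ext \<sigma> None) (Some ` moebius \<sigma> ` {\<tau>. Im \<tau> > y})"
        "\<sigma> \<in> SL2R" "at_cusp \<sigma>" "y > 0"
      have "moebius \<sigma> \<tau> \<in> uhp" if "y < Im \<tau>" for \<tau>
        using that * by (intro moebius_uhp) (auto simp: uhp_def)
      thus ?thesis using K(1) * by blast
    qed (use K(1) in blast)
    then consider (a) \<tau> where "x = Some \<tau>" "\<tau> \<in> uhp"
      | (b) \<sigma> where "\<sigma> \<in> SL2R" "at_cusp \<sigma>" "x = moebius_ext \<sigma> None"
      by blast
    thus "\<exists>W. openin T W \<and> x \<in> W \<and> W \<subseteq> U n"
    proof cases
      case a
      thus ?thesis using inner x by (auto simp: U_def)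
    next
      case b
      obtain y where y: "y > 0" "\<And>\<tau>. y < Im \<tau> \<Longrightarrow> F (moebius \<sigma> \<tau>) < r n" using cusp[OF b(1,2)] by blast
      define W where "W = insert (moebius_ext \<sigma> None) (Some ` moebius \<sigma> ` {\<tau>. Im \<tau> > y})"
      have o: "openin T W" unfolding T_def Hstar_topology_def W_def
        using b y(1) by (intro topology_generated_by_Basis) blast
      have ne: "moebius_ext \<sigma> None \<noteq> Some \<tau>" if "\<tau> \<in> uhp" for \<tau>
        using that by (auto simp: moebius_ext_def uhp_def complex_eq_iff)
      have "W \<subseteq> U n" using openin_subset[OF o] y(2) ne by (auto simp: U_def W_def)
      thus ?thesis using o b by (auto simp: W_def)
    qed
  qed
  \<comment> \<open>saturation under \<open>\<Gamma>\<close>: a cusp is never in the orbit of an interior point, so nothing has to be checked for it\<close>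
  have sat: "y \<in> U n" if "x \<in> U n" "y \<in> topspace T" "p x = p y" for x y n
  proof -
    have "F \<tau> < r n" if y: "y = Some \<tau>" "\<tau> \<in> uhp" for \<tau>
    proof -
      have "x \<in> p y" using p_self[of x] \<open>p x = p y\<close> by simp
      then obtain \<gamma> where g: "\<gamma> \<in> \<Gamma>" "x = moebius_ext \<gamma> (Some \<tau>)" using y by (auto simp: p_def group_orbit_def)
      hence "x = Some (moebius \<gamma> \<tau>)" using y jfac_nz[OF G_SL2R] by (auto simp: moebius_ext_def)
      hence "F (moebius \<gamma> \<tau>) < r n" using \<open>x \<in> U n\<close> moebius_uhp[OF G_SL2R[OF g(1)] y(2)] by (auto simp: U_def)
      thus ?thesis using inv g(1) y(2) by simp
    qed
    thus ?thesis using that by (auto simp: U_def)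
  qed
  have pre: "{x \<in> topspace T. p x \<in> p ` U n} = U n" for n
    using sat by (auto simp: U_def)
  have VO: "openin Q (p ` U n)" for n
    unfolding Q_def openin_quotient_topology pre using opn by (auto simp: U_def)
  have "{x \<in> topspace T. p x \<in> p ` topspace T} = topspace T" by auto
  hence "openin Q (p ` topspace T)" unfolding Q_def openin_quotient_topology by simp
  hence top: "p ` topspace T \<subseteq> topspace Q" by (rule openin_subset)
  have top': "topspace Q \<subseteq> p ` topspace T"
    using openin_topspace[of Q] unfolding Q_def openin_quotient_topology by blast
  have "\<exists>n. x \<in> U n" if "x \<in> topspace T" for x
  proof (cases "\<exists>\<tau>\<in>uhp. x = Some \<tau>")
    case True
    thus ?thesis using pt that by (auto simp: U_def)
  next
    case False
    thus ?thesis using that by (auto simp: U_def)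
  qed
  hence cov: "topspace Q \<subseteq> \<Union> (range (\<lambda>n. p ` U n))" using top' by fastforce
  have "compact_space Q" using compact_quotient by (simp add: Q_def T_def p_def)
  then obtain \<F> where fin: "finite \<F>" "\<F> \<subseteq> range (\<lambda>n. p ` U n)" "topspace Q \<subseteq> \<Union>\<F>"
    unfolding compact_space_alt using cov VO by (metis (no_types, lifting) imageE)
  then obtain I where I: "finite I" "\<F> = (\<lambda>n. p ` U n) ` I"
    by (meson finite_subset_image)
  define n where "n = Max (insert 0 I)"
  have "U m \<subseteq> U n" if "m \<in> I" for m
  proof -
    have "m \<le> n" unfolding n_def by (rule Max_ge) (use that I(1) in auto)
    hence "r m \<le> r n" by (rule monoD[OF \<open>mono r\<close>])
    thus ?thesis by (auto simp: U_def)
  qed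
  hence all: "topspace Q \<subseteq> p ` U n" using fin(3) I(2) by blast
  have "F \<tau> < r n" if "\<tau> \<in> uhp" for \<tau>
  proof -
    have 1: "Some \<tau> \<in> topspace T" using topspace_Hstar_uhp that by (simp add: T_def)
    hence "Some \<tau> \<in> {x \<in> topspace T. p x \<in> p ` U n}" using top all by blast
    hence "Some \<tau> \<in> U n" unfolding pre .
    thus ?thesis using that by (simp add: U_def)
  qed
  thus ?thesis by blast
qed

section \<open>The stabilizer of a cusp\<close>

lemma exists_at_cusp: "\<exists>\<sigma>\<in>SL2R. at_cusp \<sigma>"
proof -
  obtain s where s: "s \<in> cusps \<Gamma>" using has_cusp by blast
  then consider "s = None" | x where "s = Some (complex_of_real x)" by (auto simp: cusps_def)
  thus ?thesis
  proof cases
    case 1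
    thus ?thesis using s by (intro bexI[of _ "mat 1"]) (auto simp: moebius_ext_def)
  next
    case 2
    define \<sigma> :: "real^2^2" where "\<sigma> = vector [vector [x, -1], vector [1, 0]]"
    have "\<sigma> \<in> SL2R" "moebius_ext \<sigma> None = s" by (auto simp: \<sigma>_def SL2R_iff moebius_ext_def 2)
    thus ?thesis using s by blast
  qed
qed

text \<open>
Conjugating a parabolic element that fixes \<open>\<sigma>\<infinity>\<close> by \<open>\<sigma>\<close> gives an upper triangular matrix of determinant 1 and trace
\<open>\<plusminus>2\<close>, hence \<open>\<plusminus>\<close> a translation; the sign does not matter because \<open>-1 \<in> \<Gamma>\<close>.
\<close>

lemma cusp_unipotent:
  assumes \<sigma>: "\<sigma> \<in> SL2R" and cusp: "at_cusp \<sigma>"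
  obtains h where "h \<noteq> 0" "cusp_shift \<sigma> h \<in> \<Gamma>"
proof -
  obtain \<gamma> where g: "\<gamma> \<in> \<Gamma>" "parabolic \<gamma>" and fx: "moebius_ext \<gamma> (moebius_ext \<sigma> None) = moebius_ext \<sigma> None"
    using cusp by (auto simp: cusps_def)
  define \<delta> where "\<delta> = matrix_inv \<sigma> ** \<gamma> ** \<sigma>"
  have gS: "\<gamma> \<in> SL2R" using g G_SL2R by blast
  have \<delta>: "\<delta> \<in> SL2R" unfolding \<delta>_def using \<sigma> gS by (intro SL2R_mult SL2R_inv)
  have g_eq: "\<gamma> = \<sigma> ** \<delta> ** matrix_inv \<sigma>"
    unfolding \<delta>_def using \<sigma> by (simp add: matrix_mul_assoc SL2R_cancel SL2R_inv_right)
  have d21: "\<delta>$2$1 = - \<sigma>$2$1 * (\<gamma>$1$1 * \<sigma>$1$1 + \<gamma>$1$2 * \<sigma>$2$1) + \<sigma>$1$1 * (\<gamma>$2$1 * \<sigma>$1$1 + \<gamma>$2$2 * \<sigma>$2$1)"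
    using \<sigma> by (simp add: \<delta>_def matrix_inv_entries algebra_simps)
  have "\<delta>$2$1 = 0"
  proof (cases "\<sigma>$2$1 = 0")
    case True
    hence "\<gamma>$2$1 = 0" using fx by (auto simp: moebius_ext_def split: if_splits)
    thus ?thesis using d21 True by simp
  next
    case c: False
    define s where "s = \<sigma>$1$1 / \<sigma>$2$1"
    have j: "jfac \<gamma> (of_real s) = of_real (\<gamma>$2$1 * s + \<gamma>$2$2)" by (simp add: jfac_def)
    from fx c have j00: "jfac \<gamma> (of_real s) \<noteq> 0" and m: "moebius \<gamma> (of_real s) = of_real s"
      unfolding moebius_ext_def s_def[symmetric] by (auto split: if_splits)
    have j0: "\<gamma>$2$1 * s + \<gamma>$2$2 \<noteq> 0" using j00 unfolding j of_real_eq_0_iff .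
    have "complex_of_real ((\<gamma>$1$1 * s + \<gamma>$1$2) / (\<gamma>$2$1 * s + \<gamma>$2$2)) = of_real s"
      using m unfolding moebius_def j by simp
    hence "(\<gamma>$1$1 * s + \<gamma>$1$2) / (\<gamma>$2$1 * s + \<gamma>$2$2) = s" by (simp only: of_real_eq_iff)
    hence "\<gamma>$1$1 * s + \<gamma>$1$2 = s * (\<gamma>$2$1 * s + \<gamma>$2$2)" using j0 by (simp add: field_simps)
    hence "(\<gamma>$1$1 * s + \<gamma>$1$2) * (\<sigma>$2$1)\<^sup>2 = s * (\<gamma>$2$1 * s + \<gamma>$2$2) * (\<sigma>$2$1)\<^sup>2" by simp
    moreover have "s * \<sigma>$2$1 = \<sigma>$1$1" using c by (simp add: s_def)
    ultimately show ?thesis unfolding d21 by algebra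
  qed
  moreover have det: "\<delta>$1$1 * \<delta>$2$2 - \<delta>$1$2 * \<delta>$2$1 = 1" using \<delta> by (simp add: SL2R_iff)
  ultimately have prod: "\<delta>$1$1 * \<delta>$2$2 = 1" by simp
  have tr: "trace \<gamma> = \<delta>$1$1 + \<delta>$2$2"
  proof -
    have "\<gamma>$1$1 + \<gamma>$2$2 = (\<sigma>$1$1 * \<sigma>$2$2 - \<sigma>$1$2 * \<sigma>$2$1) * (\<gamma>$1$1 + \<gamma>$2$2)" using \<sigma> by (simp add: SL2R_iff)
    also have "\<dots> = \<delta>$1$1 + \<delta>$2$2" using \<sigma> by (simp add: \<delta>_def matrix_inv_entries algebra_simps)
    finally show ?thesis by (simp add: trace_def sum_2)
  qed
  have "\<bar>\<delta>$1$1 + \<delta>$2$2\<bar> = 2" using g(2) tr by (simp add: parabolic_def)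
  hence "(\<delta>$1$1 + \<delta>$2$2)\<^sup>2 = 4" by (metis abs_numeral power2_abs power2_eq_square mult_2 numeral_Bit0)
  hence "(\<delta>$1$1 - \<delta>$2$2)\<^sup>2 = 0" using prod by (simp add: power2_eq_square algebra_simps)
  hence eq: "\<delta>$2$2 = \<delta>$1$1" by simp
  hence "\<delta>$1$1 = 1 \<or> \<delta>$1$1 = -1" using prod by (simp add: square_eq_1_iff)
  then obtain e where e: "e = 1 \<or> e = (-1::real)" "\<delta>$1$1 = e" by blast
  have dT: "\<delta> = e *\<^sub>R translation (e * \<delta>$1$2)" using e eq \<open>\<delta>$2$1 = 0\<close> by (auto simp: mat_eq_iff2)
  define h where "h = e * \<delta>$1$2"
  have gh: "\<gamma> = e *\<^sub>R cusp_shift \<sigma> h"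
  proof -
    have "\<sigma> ** (e *\<^sub>R translation h) ** M = e *\<^sub>R (\<sigma> ** translation h ** M)" for M :: "real^2^2"
      by (simp add: mat_eq_iff2 algebra_simps)
    thus ?thesis unfolding cusp_shift_def using g_eq dT by (simp add: h_def)
  qed
  have "h \<noteq> 0"
  proof
    assume "h = 0"
    hence "\<gamma> = e *\<^sub>R mat 1" using gh cusp_shift_0[OF \<sigma>] by simp
    thus False using e g(2) by (auto simp: parabolic_def)
  qed
  moreover have "cusp_shift \<sigma> h \<in> \<Gamma>"
  proof (cases "e = 1")
    case True thus ?thesis using gh g by simp
  next
    case False
    hence "cusp_shift \<sigma> h = (- mat 1) ** \<gamma>" using e gh by (auto simp: mat_eq_iff2)
    thus ?thesis using G_mult G_minus_one g by simp
  qed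
  ultimately show ?thesis using that by blast
qed

lemma cusp_shift_of_nat:
  assumes "\<sigma> \<in> SL2R" "cusp_shift \<sigma> h \<in> \<Gamma>" shows "cusp_shift \<sigma> (of_nat n * h) \<in> \<Gamma>"
proof (induction n)
  case 0 thus ?case using G_one cusp_shift_0 assms by simp
next
  case (Suc n)
  have "cusp_shift \<sigma> (of_nat (Suc n) * h) = cusp_shift \<sigma> h ** cusp_shift \<sigma> (of_nat n * h)"
    using assms by (simp add: cusp_shift_add algebra_simps)
  thus ?case using G_mult assms Suc by simp
qed

lemma cusp_shift_minus: "\<sigma> \<in> SL2R \<Longrightarrow> cusp_shift \<sigma> h \<in> \<Gamma> \<Longrightarrow> cusp_shift \<sigma> (- h) \<in> \<Gamma>"
  using G_inv[of "cusp_shift \<sigma> h"] by (simp add: cusp_shift_inv)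

lemma cusp_shift_of_int:
  assumes "\<sigma> \<in> SL2R" "cusp_shift \<sigma> h \<in> \<Gamma>" shows "cusp_shift \<sigma> (of_int n * h) \<in> \<Gamma>"
proof (cases "n \<ge> 0")
  case True
  thus ?thesis using cusp_shift_of_nat[OF assms, of "nat n"] by simp
next
  case False
  thus ?thesis using cusp_shift_minus[OF assms(1) cusp_shift_of_nat[OF assms, of "nat (-n)"]] by simp
qed

lemma cusp_shift_discrete:
  assumes \<sigma>: "\<sigma> \<in> SL2R"
  obtains \<delta> where "\<delta> > 0" "\<And>h. cusp_shift \<sigma> h \<in> \<Gamma> \<Longrightarrow> \<bar>h\<bar> < \<delta> \<Longrightarrow> h = 0"
proof -
  have "(mat 1 :: real^2^2) isolated_in \<Gamma>" using discrete_G G_one by (auto simp: discrete_def)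
  then obtain d where d: "d > 0" "\<And>y. y \<in> \<Gamma> \<Longrightarrow> dist (mat 1) y < d \<Longrightarrow> y = mat 1"
    by (elim isolated_inE_dist) blast
  define M where "M = norm (cusp_shift \<sigma> 1 - mat 1) + 1"
  have M: "M > 0" unfolding M_def by (smt (verit) norm_ge_zero)
  show ?thesis
  proof
    show "d / M > 0" using d M by simp
    fix h assume h: "cusp_shift \<sigma> h \<in> \<Gamma>" "\<bar>h\<bar> < d / M"
    have "dist (mat 1) (cusp_shift \<sigma> h) = \<bar>h\<bar> * norm (cusp_shift \<sigma> 1 - mat 1)"
      using cusp_shift_scaleR[OF \<sigma>, of h] by (simp add: dist_norm norm_minus_commute[of "mat 1"])
    also have "\<dots> \<le> \<bar>h\<bar> * M" by (intro mult_left_mono) (auto simp: M_def)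
    also have "\<dots> < d" using h(2) M by (simp add: field_simps)
    finally have "cusp_shift \<sigma> h = mat 1" using d(2) h(1) by blast
    thus "h = 0" using cusp_shift_eq_1 \<sigma> by blast
  qed
qed

end


lemma matrix_mul_assoc_right: "A ** B ** C = A ** (B ** C)" for A B C :: "real^2^2"
  by (simp add: matrix_mul_assoc)

lemma conj_upper_triangular:
  assumes "\<delta> \<in> SL2R" "\<delta>$2$1 = 0"
  shows "cusp_shift \<delta> h = translation ((\<delta>$1$1)\<^sup>2 * h)"
  using assms by (simp add: mat_eq_iff2 cusp_shift_entries mult.commute)

context fuchsian
begin

text \<open>
The \<open>h\<close> for which the unipotent element lies in \<open>\<Gamma>\<close> form a discrete subgroup of \<open>\<real>\<close>, which is nonzero because the
point is a cusp. Its smallest positive element is the width.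
\<close>

lemma cusp_width_exists:
  assumes \<sigma>: "\<sigma> \<in> SL2R" and cusp: "at_cusp \<sigma>"
  obtains w where "cusp_width \<Gamma> \<sigma> w"
proof -
  obtain h0 where h0: "h0 \<noteq> 0" "cusp_shift \<sigma> h0 \<in> \<Gamma>" using cusp_unipotent[OF assms] .
  obtain \<delta> where \<delta>: "\<delta> > 0" "\<And>h. cusp_shift \<sigma> h \<in> \<Gamma> \<Longrightarrow> \<bar>h\<bar> < \<delta> \<Longrightarrow> h = 0"
    using cusp_shift_discrete[OF \<sigma>] by blast
  define H where "H = {h. 0 < h \<and> cusp_shift \<sigma> h \<in> \<Gamma>}"
  have ne: "H \<noteq> {}"
  proof (cases "h0 > 0")
    case True thus ?thesis using h0 by (auto simp: H_def)
  next
    case False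
    hence "- h0 \<in> H" using h0 cusp_shift_minus[OF \<sigma>] by (auto simp: H_def)
    thus ?thesis by blast
  qed
  have bdd: "bdd_below H" by (intro bdd_belowI[of _ 0]) (auto simp: H_def)
  define w where "w = Inf H"
  have diff: "cusp_shift \<sigma> (x - y) \<in> \<Gamma>" if "cusp_shift \<sigma> x \<in> \<Gamma>" "cusp_shift \<sigma> y \<in> \<Gamma>" for x y
    using G_mult[OF that(1) cusp_shift_minus[OF \<sigma> that(2)]] by (simp add: cusp_shift_add \<sigma>)
  \<comment> \<open>the infimum is attained: two elements of \<open>H\<close> close to it would differ by less than \<open>\<delta>\<close>\<close>
  have wH: "w \<in> H"
  proof -
    have "Inf H < w + \<delta>" using \<delta> by (simp add: w_def)
    then obtain h where h: "h \<in> H" "h < w + \<delta>" using cInf_less_iff[OF ne bdd] by blast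
    have "w \<le> h" using cInf_lower[OF h(1) bdd] by (simp add: w_def)
    show ?thesis
    proof (rule ccontr)
      assume "w \<notin> H"
      hence "w < h" using h \<open>w \<le> h\<close> by (cases "w = h") auto
      then obtain h' where h': "h' \<in> H" "h' < h" using cInf_less_iff[OF ne bdd, of h] by (auto simp: w_def)
      have "w \<le> h'" using cInf_lower[OF h'(1) bdd] by (simp add: w_def)
      have "cusp_shift \<sigma> (h - h') \<in> \<Gamma>" using diff h(1) h'(1) by (simp add: H_def)
      moreover have "\<bar>h - h'\<bar> < \<delta>" using h(2) h'(2) \<open>w \<le> h'\<close> by simp
      ultimately show False using \<delta>(2)[of "h - h'"] h'(2) by simp
    qed
  qed
  hence w: "w > 0" "cusp_shift \<sigma> w \<in> \<Gamma>" by (auto simp: H_def)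
  have "x \<in> range (\<lambda>n::int. of_int n * w)" if x: "cusp_shift \<sigma> x \<in> \<Gamma>" for x
  proof -
    define r where "r = x - of_int \<lfloor>x / w\<rfloor> * w"
    have "cusp_shift \<sigma> r \<in> \<Gamma>" unfolding r_def using diff[OF x cusp_shift_of_int[OF \<sigma> w(2)]] .
    moreover have "0 \<le> r" using floor_divide_lower[OF w(1), of x] by (simp add: r_def)
    moreover have "r < w" using floor_divide_upper[OF w(1), of x] by (simp add: r_def algebra_simps)
    ultimately have "r = 0" using cInf_lower[OF _ bdd, of r] by (cases "r = 0") (auto simp: w_def H_def)
    thus ?thesis by (auto simp: r_def intro: range_eqI[of _ _ "\<lfloor>x / w\<rfloor>"])
  qed
  hence "{h. cusp_shift \<sigma> h \<in> \<Gamma>} = range (\<lambda>n::int. of_int n * w)"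
    using cusp_shift_of_int[OF \<sigma> w(2)] by auto
  hence "cusp_width \<Gamma> \<sigma> w" using w(1) by (simp add: cusp_width_def cusp_shift_def)
  thus ?thesis using that by blast
qed

text \<open>
Suppose that \<open>\<Gamma>\<close> fixes the cusp \<open>\<sigma>\<infinity>\<close>; conjugated by \<open>\<sigma>\<close>, it is then upper triangular. A diagonal entry of absolute
value different from 1 would, by repeated conjugation, make the translations in the group arbitrarily short, against
discreteness. So \<open>Im (\<sigma>\<^sup>-\<^sup>1\<tau>)\<close> is \<open>\<Gamma>\<close>-invariant, and its inverse \<open>G\<close> is small near the only cusp; by compactness
\<open>G\<close> is then bounded, which is absurd.
\<close>

lemma cusp_moved:
  assumes \<sigma>: "\<sigma> \<in> SL2R" and cusp: "at_cusp \<sigma>"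
  shows "\<exists>\<gamma>\<in>\<Gamma>. (matrix_inv \<sigma> ** \<gamma> ** \<sigma>)$2$1 \<noteq> 0"
proof (rule ccontr)
  assume "\<not> ?thesis"
  hence fx: "(matrix_inv \<sigma> ** \<gamma> ** \<sigma>)$2$1 = 0" if "\<gamma> \<in> \<Gamma>" for \<gamma> using that by blast
  define cj where "cj \<gamma> = matrix_inv \<sigma> ** \<gamma> ** \<sigma>" for \<gamma>
  obtain h where h: "h \<noteq> 0" "cusp_shift \<sigma> h \<in> \<Gamma>" using cusp_unipotent[OF assms] .
  obtain \<epsilon> where \<epsilon>: "\<epsilon> > 0" "\<And>h. cusp_shift \<sigma> h \<in> \<Gamma> \<Longrightarrow> \<bar>h\<bar> < \<epsilon> \<Longrightarrow> h = 0"
    using cusp_shift_discrete[OF \<sigma>] by blast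
  have cjS: "cj \<gamma> \<in> SL2R" if "\<gamma> \<in> \<Gamma>" for \<gamma>
    unfolding cj_def using that \<sigma> G_SL2R by (intro SL2R_mult SL2R_inv)
  have cj_back: "\<gamma> ** \<sigma> = \<sigma> ** cj \<gamma>" for \<gamma>
    unfolding cj_def using \<sigma> by (simp add: matrix_mul_assoc_right SL2R_cancel)
  have step: "cusp_shift \<sigma> ((cj \<gamma> $1$1)\<^sup>2 * h) \<in> \<Gamma>" if g: "\<gamma> \<in> \<Gamma>" "cusp_shift \<sigma> h \<in> \<Gamma>" for \<gamma> h
  proof -
    have "\<gamma> ** cusp_shift \<sigma> h ** matrix_inv \<gamma> = cusp_shift (\<sigma> ** cj \<gamma>) h"
      using cusp_shift_conj[OF G_SL2R[OF g(1)] \<sigma>] by (simp add: cj_back)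
    also have "\<dots> = \<sigma> ** cusp_shift (cj \<gamma>) h ** matrix_inv \<sigma>"
      using cusp_shift_conj[OF \<sigma> cjS[OF g(1)]] .
    also have "cusp_shift (cj \<gamma>) h = translation ((cj \<gamma> $1$1)\<^sup>2 * h)"
      using conj_upper_triangular[OF cjS[OF g(1)]] fx[OF g(1)] by (simp add: cj_def)
    finally have "\<gamma> ** cusp_shift \<sigma> h ** matrix_inv \<gamma> = cusp_shift \<sigma> ((cj \<gamma> $1$1)\<^sup>2 * h)" by (simp add: cusp_shift_def)
    thus ?thesis using G_mult G_inv g by metis
  qed
  have not_small: False if g: "\<gamma> \<in> \<Gamma>" and "\<bar>cj \<gamma> $1$1\<bar> < 1" "cj \<gamma> $1$1 \<noteq> 0" for \<gamma>
  proof -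
    define a where "a = (cj \<gamma> $1$1)\<^sup>2"
    have a: "0 < a" "a < 1" using that by (auto simp: a_def power_less_one_iff abs_square_less_1)
    have "cusp_shift \<sigma> (a ^ n * h) \<in> \<Gamma>" for n
    proof (induction n)
      case 0 thus ?case using h by simp
    next
      case (Suc n) thus ?case using step[OF g Suc] by (simp add: a_def mult.assoc)
    qed
    moreover obtain n where "a ^ n < \<epsilon> / \<bar>h\<bar>" using real_arch_pow_inv[of "\<epsilon> / \<bar>h\<bar>" a] a \<epsilon> h by auto
    ultimately have "a ^ n * h = 0" using \<epsilon>(2)[of "a ^ n * h"] a h by (simp add: abs_mult field_simps)
    thus False using a h by simp
  qed
  have unit: "\<bar>cj \<gamma> $2$2\<bar> = 1" if g: "\<gamma> \<in> \<Gamma>" for \<gamma>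
  proof -
    have prod: "cj \<gamma> $1$1 * cj \<gamma> $2$2 = 1" using cjS[OF g] fx[OF g] by (simp add: SL2R_iff cj_def)
    have inv: "cj (matrix_inv \<gamma>) = matrix_inv (cj \<gamma>)"
      unfolding cj_def using \<sigma> G_SL2R[OF g]
      by (simp add: mat_eq_iff2 matrix_inv_entries SL2R_mult SL2R_inv algebra_simps)
    have nz: "cj \<gamma> $1$1 \<noteq> 0" "cj \<gamma> $2$2 \<noteq> 0" using prod by auto
    have "\<not> \<bar>cj \<gamma> $1$1\<bar> < 1" using not_small[OF g] nz by blast
    moreover have "\<not> \<bar>cj \<gamma> $2$2\<bar> < 1" using not_small[OF G_inv[OF g]] nz
      by (auto simp: inv matrix_inv_entries cjS[OF g])
    moreover have "\<bar>cj \<gamma> $1$1\<bar> * \<bar>cj \<gamma> $2$2\<bar> = 1" using prod by (simp flip: abs_mult)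
    ultimately show ?thesis
      using mult_right_mono[of 1 "\<bar>cj \<gamma> $1$1\<bar>" "\<bar>cj \<gamma> $2$2\<bar>"] by linarith
  qed
  define G where "G \<tau> = 1 / Im (moebius (matrix_inv \<sigma>) \<tau>)" for \<tau>
  have Gpos: "Im (moebius (matrix_inv \<sigma>) \<tau>) > 0" if "\<tau> \<in> uhp" for \<tau>
    using moebius_uhp[OF SL2R_inv[OF \<sigma>] that] by (simp add: uhp_def)
  have "\<exists>n. \<forall>\<tau>\<in>uhp. G \<tau> < real (Suc n)"
  proof (rule invariant_bounded_by_cusps)
    show "continuous_on uhp G" unfolding G_def
      using holomorphic_on_imp_continuous_on[OF moebius_holomorphic[OF SL2R_inv[OF \<sigma>]]] Gpos
      by (intro continuous_intros) force+
  next
    fix \<gamma> \<tau> assume g: "\<gamma> \<in> \<Gamma>" and t: "\<tau> \<in> uhp"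
    have eq: "matrix_inv \<sigma> ** \<gamma> = cj \<gamma> ** matrix_inv \<sigma>"
      unfolding cj_def using \<sigma> by (simp add: matrix_mul_assoc_right SL2R_inv_right)
    have "moebius (matrix_inv \<sigma>) (moebius \<gamma> \<tau>) = moebius (matrix_inv \<sigma> ** \<gamma>) \<tau>"
      using moebius_mult[OF SL2R_inv[OF \<sigma>] G_SL2R[OF g] t] by simp
    also have "\<dots> = moebius (cj \<gamma>) (moebius (matrix_inv \<sigma>) \<tau>)"
      unfolding eq by (rule moebius_mult[OF cjS[OF g] SL2R_inv[OF \<sigma>] t])
    finally have "Im (moebius (matrix_inv \<sigma>) (moebius \<gamma> \<tau>)) =
        Im (moebius (matrix_inv \<sigma>) \<tau>) / (cmod (jfac (cj \<gamma>) (moebius (matrix_inv \<sigma>) \<tau>)))\<^sup>2"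
      using Im_moebius[OF cjS[OF g] moebius_uhp[OF SL2R_inv[OF \<sigma>] t]] by simp
    also have "jfac (cj \<gamma>) (moebius (matrix_inv \<sigma>) \<tau>) = of_real (cj \<gamma> $2$2)"
      using fx[OF g] by (simp add: jfac_def cj_def)
    finally show "G (moebius \<gamma> \<tau>) = G \<tau>" using unit[OF g] by (simp add: G_def)
  next
    show "mono (\<lambda>n. real (Suc n))" by (intro monoI) simp
  next
    fix \<tau> show "\<exists>n. G \<tau> < real (Suc n)"
      using reals_Archimedean2[of "G \<tau>"] by (metis less_trans lessI of_nat_less_iff)
  next
    fix \<rho> and n :: nat assume r: "\<rho> \<in> SL2R" "at_cusp \<rho>"
    obtain h' where h': "h' \<noteq> 0" "cusp_shift \<rho> h' \<in> \<Gamma>" using cusp_unipotent[OF r] .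
    define \<kappa> where "\<kappa> = matrix_inv \<sigma> ** \<rho>"
    have \<kappa>: "\<kappa> \<in> SL2R" unfolding \<kappa>_def using r \<sigma> by (intro SL2R_mult SL2R_inv)
    \<comment> \<open>every cusp equals \<open>\<sigma>\<infinity>\<close>: a unipotent element at \<open>\<rho>\<infinity>\<close> is upper triangular after conjugation only if \<open>\<kappa>\<close> is\<close>
    have "cj (cusp_shift \<rho> h') = cusp_shift \<kappa> h'"
      using cusp_shift_conj[OF SL2R_inv[OF \<sigma>] r(1), of h'] \<sigma>
      by (simp add: cj_def \<kappa>_def mat_eq_iff2 matrix_inv_entries SL2R_inv)
    hence "cusp_shift \<kappa> h' $2$1 = 0" using fx[OF h'(2)] by (simp only: cj_def)
    hence k21: "\<kappa>$2$1 = 0" using h' by (simp add: cusp_shift_entries \<kappa>)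
    show "\<exists>y>0. \<forall>\<tau>. y < Im \<tau> \<longrightarrow> G (moebius \<rho> \<tau>) < real (Suc n)"
    proof (intro exI[of _ "(\<kappa>$2$2)\<^sup>2 / real (Suc n)"] conjI allI impI)
      have "\<kappa>$2$2 \<noteq> 0" using \<kappa> k21 by (auto simp: SL2R_iff)
      thus 0: "0 < (\<kappa>$2$2)\<^sup>2 / real (Suc n)" by simp
      fix \<tau> assume t: "(\<kappa>$2$2)\<^sup>2 / real (Suc n) < Im \<tau>"
      hence tu: "\<tau> \<in> uhp" using 0 by (simp add: uhp_def del: of_nat_Suc)
      have "moebius (matrix_inv \<sigma>) (moebius \<rho> \<tau>) = moebius \<kappa> \<tau>"
        unfolding \<kappa>_def using moebius_mult[OF SL2R_inv[OF \<sigma>] r(1) tu] by simp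
      hence "G (moebius \<rho> \<tau>) = (\<kappa>$2$2)\<^sup>2 / Im \<tau>"
        using Im_moebius[OF \<kappa> tu] k21 by (simp add: G_def jfac_def)
      moreover have "(\<kappa>$2$2)\<^sup>2 / Im \<tau> < real (Suc n)"
        using t tu by (simp add: uhp_def field_simps)
      ultimately show "G (moebius \<rho> \<tau>) < real (Suc n)" by simp
    qed
  qed
  then obtain n where n: "\<And>\<tau>. \<tau> \<in> uhp \<Longrightarrow> G \<tau> < real (Suc n)" by blast
  define \<tau>0 where "\<tau>0 = Complex 0 (1 / real (Suc n))"
  have t0: "\<tau>0 \<in> uhp" by (simp add: \<tau>0_def uhp_def)
  have "moebius (matrix_inv \<sigma>) (moebius \<sigma> \<tau>0) = \<tau>0"
    using moebius_mult[OF SL2R_inv[OF \<sigma>] \<sigma> t0] by (simp add: SL2R_inv_left \<sigma>)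
  hence "G (moebius \<sigma> \<tau>0) = real (Suc n)" by (simp add: G_def \<tau>0_def)
  thus False using n[OF moebius_uhp[OF \<sigma> t0]] by simp
qed

end

section \<open>Independence of the automorphy factors\<close>

text \<open>
\<open>1/(\<tau> - s)\<close> for \<open>s = \<rho>\<infinity>\<close>, and 0 if \<open>s = \<infinity>\<close>: the limit of \<open>X(\<gamma>,\<tau>)\<close> along the powers of a unipotent element at
\<open>s\<close>.
\<close>

abbreviation limit_value :: "real^2^2 \<Rightarrow> complex \<Rightarrow> complex" where
  "limit_value \<rho> \<tau> \<equiv> of_real (\<rho>$2$1) / (of_real (\<rho>$2$1) * \<tau> - of_real (\<rho>$1$1))"

lemma column_nz:
  assumes "\<rho> \<in> SL2R" "\<tau> \<in> uhp"
  shows "of_real (\<rho>$2$1) * \<tau> - of_real (\<rho>$1$1) \<noteq> 0"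
proof -
  have "jfac (matrix_inv \<rho>) \<tau> \<noteq> 0" using assms by (intro jfac_nz SL2R_inv)
  thus ?thesis using assms by (simp add: jfac_def matrix_inv_entries)
qed

context fuchsian
begin

text \<open>
If \<open>\<gamma>\<close> moves the cusp \<open>\<sigma>\<infinity>\<close>, then the unipotent elements at \<open>\<sigma>\<infinity>\<close> carry \<open>\<gamma>\<sigma>\<infinity>\<close> to infinitely many cusps. The
translation length \<open>h\<close> is the same for all cusps in the orbit.
\<close>

lemma infinite_limit_values:
  assumes t: "\<tau> \<in> uhp"
  obtains \<sigma> h where "\<sigma> \<in> SL2R" "h \<noteq> 0" "\<And>\<gamma>. \<gamma> \<in> \<Gamma> \<Longrightarrow> cusp_shift (\<gamma> ** \<sigma>) h \<in> \<Gamma>"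
    "infinite {limit_value (\<gamma> ** \<sigma>) \<tau> |\<gamma>. \<gamma> \<in> \<Gamma>}"
proof -
  obtain \<sigma> where \<sigma>: "\<sigma> \<in> SL2R" "at_cusp \<sigma>" using exists_at_cusp by blast
  obtain h where h: "h \<noteq> 0" "cusp_shift \<sigma> h \<in> \<Gamma>" using cusp_unipotent[OF \<sigma>] .
  obtain \<gamma>1 where g1: "\<gamma>1 \<in> \<Gamma>" "(matrix_inv \<sigma> ** \<gamma>1 ** \<sigma>)$2$1 \<noteq> 0" using cusp_moved[OF \<sigma>] by blast
  define v where "v \<gamma> = limit_value (\<gamma> ** \<sigma>) \<tau>" for \<gamma> :: "real^2^2"
  define a0 c0 a1 c1 where "a0 = \<sigma>$1$1" "c0 = \<sigma>$2$1" "a1 = (\<gamma>1 ** \<sigma>)$1$1" "c1 = (\<gamma>1 ** \<sigma>)$2$1"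
  have om: "a0 * c1 - c0 * a1 \<noteq> 0"
    using g1(2) \<sigma> by (simp add: a0_c0_a1_c1_def matrix_inv_entries algebra_simps)
  define g where "g n = cusp_shift \<sigma> (real n * h) ** \<gamma>1" for n :: nat
  define k where "k = h * (a0 * c1 - c0 * a1)"
  have k: "k \<noteq> 0" using om h by (simp add: k_def)
  have gG: "g n \<in> \<Gamma>" for n unfolding g_def using cusp_shift_of_nat[OF \<sigma>(1) h(2)] g1 G_mult by blast
  have gs: "g n ** \<sigma> = cusp_shift \<sigma> (real n * h) ** (\<gamma>1 ** \<sigma>)" for n by (simp add: g_def matrix_mul_assoc)
  have g11: "(g n ** \<sigma>)$1$1 = a1 + real n * k * a0" for n
    unfolding gs mat_entries[of "cusp_shift _ _"] cusp_shift_entries[OF \<sigma>(1)] a0_c0_a1_c1_def[symmetric] k_def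
    by (simp add: algebra_simps power2_eq_square)
  have g21: "(g n ** \<sigma>)$2$1 = c1 + real n * k * c0" for n
    unfolding gs mat_entries[of "cusp_shift _ _"] cusp_shift_entries[OF \<sigma>(1)] a0_c0_a1_c1_def[symmetric] k_def
    by (simp add: algebra_simps power2_eq_square)
  have "inj (\<lambda>n. v (g n))"
  proof (rule injI)
    fix n m assume eq: "v (g n) = v (g m)"
    define A where "A n = (g n ** \<sigma>)$1$1" for n
    define C where "C n = (g n ** \<sigma>)$2$1" for n
    have nz: "of_real (C n) * \<tau> - of_real (A n) \<noteq> 0" for n
      unfolding A_def C_def using column_nz[OF SL2R_mult[OF G_SL2R[OF gG] \<sigma>(1)] t] .
    have "of_real (C n) * (of_real (C m) * \<tau> - of_real (A m)) = of_real (C m) * (of_real (C n) * \<tau> - of_real (A n))"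
      using eq nz[of n] nz[of m] unfolding v_def A_def[symmetric] C_def[symmetric] by (simp add: field_simps)
    hence "complex_of_real (C n * A m) = of_real (C m * A n)" by (simp add: algebra_simps)
    hence "C n * A m = C m * A n" by (simp only: of_real_eq_iff)
    hence "k * (a0 * c1 - c0 * a1) * (real n - real m) = 0"
      unfolding A_def C_def g11 g21 by (simp add: algebra_simps)
    thus "n = m" using k om by simp
  qed
  hence "infinite (range (\<lambda>n. v (g n)))" using finite_imageD by blast
  moreover have "range (\<lambda>n. v (g n)) \<subseteq> {v \<gamma> |\<gamma>. \<gamma> \<in> \<Gamma>}" using gG by blast
  ultimately have "infinite {v \<gamma> |\<gamma>. \<gamma> \<in> \<Gamma>}" using finite_subset by blast
  moreover have "cusp_shift (\<gamma> ** \<sigma>) h \<in> \<Gamma>" if "\<gamma> \<in> \<Gamma>" for \<gamma>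
    using cusp_shift_conj[OF G_SL2R[OF that] \<sigma>(1), of h] G_mult G_inv that h by metis
  ultimately show ?thesis using that[OF \<sigma>(1) h(1)] unfolding v_def by blast
qed

text \<open>
Induction on the largest weight \<open>b\<close>. Along \<open>\<gamma>\<^sub>n = 1 + n h N\<close> at a cusp \<open>s \<noteq> \<infinity>\<close>, division by \<open>j\<^sup>b\<close> leaves in the limit
only the part of weight \<open>b\<close>, a polynomial in \<open>lim X = 1/(\<tau> - s)\<close>. It vanishes for infinitely many \<open>s\<close>, so its
coefficients are 0.
\<close>

lemma weight_depth_independent:
  assumes t: "\<tau> \<in> uhp" and "finite W"
    and "\<And>\<gamma>. \<gamma> \<in> \<Gamma> \<Longrightarrow> (\<Sum>w\<in>W. jfac \<gamma> \<tau> powi w * (\<Sum>m\<le>s. Xfac \<gamma> \<tau> ^ m * q w m)) = 0"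
    and "w \<in> W" "m \<le> s"
  shows "q w m = 0"
proof -
  obtain \<sigma> h where \<sigma>: "\<sigma> \<in> SL2R" and h: "h \<noteq> 0" and hG: "\<And>\<gamma>. \<gamma> \<in> \<Gamma> \<Longrightarrow> cusp_shift (\<gamma> ** \<sigma>) h \<in> \<Gamma>"
    and inf: "infinite {limit_value (\<gamma> ** \<sigma>) \<tau> |\<gamma>. \<gamma> \<in> \<Gamma>}"
      (is "infinite ?S")
    by (rule infinite_limit_values[OF t]) (rule that)
  have "\<forall>w\<in>W. \<forall>m\<le>s. q w m = 0"
    using \<open>finite W\<close> assms(3)
  proof (induction W rule: finite_linorder_max_induct)
    case empty thus ?case by simp
  next
    case (insert b A)
    have root: "(\<Sum>m\<le>s. q b m * x ^ m) = 0" if "x \<in> ?S - {0}" for x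
    proof -
      from that obtain \<gamma> where g: "\<gamma> \<in> \<Gamma>" and x0: "x \<noteq> 0" and
        x: "x = limit_value (\<gamma> ** \<sigma>) \<tau>" by blast
      define \<rho> where "\<rho> = \<gamma> ** \<sigma>"
      have \<rho>: "\<rho> \<in> SL2R" unfolding \<rho>_def using g \<sigma> G_SL2R SL2R_mult by blast
      define c where "c = complex_of_real (\<rho>$2$1)"
      define D where "D = c * \<tau> - of_real (\<rho>$1$1)"
      have D: "D \<noteq> 0" unfolding D_def c_def by (rule column_nz[OF \<rho> t])
      have xD: "x = c / D" using x by (simp add: \<rho>_def c_def D_def)
      have c: "c \<noteq> 0" using x0 xD by auto
      define G where "G n = cusp_shift \<rho> (real n * h)" for n :: nat
      have GG: "G n \<in> \<Gamma>" for n unfolding G_def using cusp_shift_of_nat[OF \<rho>] hG[OF g] by (simp add: \<rho>_def)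
      define J where "J n = jfac (G n) \<tau>" for n
      define X where "X n = Xfac (G n) \<tau>" for n
      have J: "J n = 1 - of_nat n * (h * c * D)" for n
        by (simp add: J_def G_def jfac_def cusp_shift_entries \<rho> c_def D_def algebra_simps power2_eq_square)
      have Xn: "X n = - of_nat n * (h * c ^ 2) / J n" for n
        unfolding J_def X_def Xfac_def by (simp add: G_def cusp_shift_entries \<rho> c_def)
      have hcD: "of_real h * c * D \<noteq> 0" using h c D by simp
      have Jinf: "filterlim J at_infinity sequentially"
      proof -
        have "filterlim (\<lambda>n. of_nat n * - (of_real h * c * D)) at_infinity sequentially"
          using tendsto_mult_filterlim_at_infinity[OF tendsto_const, of "- (of_real h * c * D)"] hcD tendsto_of_nat
          by (simp add: mult.commute)
        hence "filterlim (\<lambda>n. 1 + of_nat n * - (of_real h * c * D)) at_infinity sequentially"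
          by (rule tendsto_add_filterlim_at_infinity[OF tendsto_const])
        thus ?thesis unfolding J[abs_def] by simp
      qed
      have Jnz: "J n \<noteq> 0" for n unfolding J_def using jfac_nz[OF G_SL2R[OF GG] t] .
      have Jinv: "(\<lambda>n. inverse (J n)) \<longlonglongrightarrow> 0" using tendsto_inverse_0 Jinf by (rule filterlim_compose)
      have Xeq: "X n = c / D * (1 - inverse (J n))" for n
      proof -
        have "1 - J n = of_nat n * (of_real h * c * D)" by (simp add: J)
        hence "of_nat n * (of_real h * c ^ 2) = c / D * (1 - J n)" using D by (simp add: power2_eq_square)
        hence "X n = - (c / D * (1 - J n)) / J n" unfolding Xn by simp
        also have "\<dots> = c / D * (1 - inverse (J n))" using Jnz[of n] D by (simp add: field_simps)
        finally show ?thesis .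
      qed
      have "(\<lambda>n. c / D * (1 - inverse (J n))) \<longlonglongrightarrow> c / D * (1 - 0)"
        by (intro tendsto_intros Jinv)
      hence Xlim: "X \<longlonglongrightarrow> x" unfolding Xeq[symmetric] by (simp add: xD)
      define P where "P w z = (\<Sum>m\<le>s. z ^ m * q w m)" for w z
      have Plim: "(\<lambda>n. P w (X n)) \<longlonglongrightarrow> P w x" for w
        unfolding P_def by (intro tendsto_intros Xlim)
      have "P b (X n) = - (\<Sum>w\<in>A. inverse (J n) ^ nat (b - w) * P w (X n))" for n
      proof -
        have bA: "b \<notin> A" using insert.hyps(2) by auto
        have "0 = (\<Sum>w\<in>insert b A. J n powi w * P w (X n))"
          using insert.prems[OF GG[of n]] by (simp add: J_def X_def P_def)
        also have "\<dots> = J n powi b * P b (X n) + (\<Sum>w\<in>A. J n powi w * P w (X n))"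
          using insert.hyps(1) bA by simp
        finally have "J n powi b * P b (X n) = - (\<Sum>w\<in>A. J n powi w * P w (X n))"
          by (simp add: eq_neg_iff_add_eq_0)
        hence "J n powi (- b) * (J n powi b * P b (X n)) = J n powi (- b) * - (\<Sum>w\<in>A. J n powi w * P w (X n))"
          by (rule arg_cong)
        moreover have "J n powi (- b) * J n powi b = 1"
          using Jnz[of n] by (simp add: power_int_minus)
        ultimately have "P b (X n) = J n powi (- b) * - (\<Sum>w\<in>A. J n powi w * P w (X n))"
          by (simp only: mult.assoc[symmetric] mult_1)
        also have "\<dots> = - (\<Sum>w\<in>A. (J n powi (- b) * J n powi w) * P w (X n))"
          by (simp add: sum_distrib_left mult.assoc)
        also have "(\<Sum>w\<in>A. (J n powi (- b) * J n powi w) * P w (X n)) =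
            (\<Sum>w\<in>A. inverse (J n) ^ nat (b - w) * P w (X n))"
        proof (rule sum.cong[OF refl])
          fix w assume "w \<in> A"
          hence "w < b" using insert.hyps(2) by blast
          hence "J n powi (- b) * J n powi w = inverse (J n) ^ nat (b - w)"
            using Jnz[of n] by (simp add: power_int_add[symmetric]) (simp add: power_int_def)
          thus "J n powi (- b) * J n powi w * P w (X n) = inverse (J n) ^ nat (b - w) * P w (X n)" by simp
        qed
        finally show ?thesis .
      qed
      moreover have "(\<lambda>n. - (\<Sum>w\<in>A. inverse (J n) ^ nat (b - w) * P w (X n))) \<longlonglongrightarrow> - (\<Sum>w\<in>A. 0 ^ nat (b - w) * P w x)"
        by (intro tendsto_intros Plim Jinv)
      moreover have "(\<Sum>w\<in>A. 0 ^ nat (b - w) * P w x) = 0"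
        using insert.hyps(2) by (intro sum.neutral) auto
      ultimately have "(\<lambda>n. P b (X n)) \<longlonglongrightarrow> 0" by simp
      hence "P b x = 0" using Plim LIMSEQ_unique by blast
      thus ?thesis by (simp add: P_def mult.commute)
    qed
    have sub: "?S - {0} \<subseteq> {x. (\<Sum>m\<le>s. q b m * x ^ m) = 0}"
      by (rule subsetI, rule CollectI, rule root)
    have "infinite (?S - {0})" using inf by simp
    hence "infinite {x. (\<Sum>m\<le>s. q b m * x ^ m) = 0}" by (rule infinite_super[OF sub])
    hence qb: "\<forall>m\<le>s. q b m = 0" unfolding polyfun_finite_roots[of "q b" s] by simp
    have "(\<Sum>w\<in>A. jfac \<gamma> \<tau> powi w * (\<Sum>m\<le>s. Xfac \<gamma> \<tau> ^ m * q w m)) = 0" if "\<gamma> \<in> \<Gamma>" for \<gamma>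
      using insert.prems[OF that] insert.hyps qb by (subst (asm) sum.insert) auto
    hence "\<forall>w\<in>A. \<forall>m\<le>s. q w m = 0" by (rule insert.IH)
    thus ?case using qb by blast
  qed
  thus ?thesis using assms by blast
qed

end


section \<open>Sums over weights\<close>

lemma weight_sum_zero: "(\<lambda>_. 0) \<in> weight_sum K A"
  unfolding weight_sum_def by (intro CollectI exI[of _ "{}"]) auto

lemma weight_sum_single: "f \<in> A k \<Longrightarrow> k \<in> K \<Longrightarrow> f \<in> weight_sum K A"
  unfolding weight_sum_def by (intro CollectI exI[of _ "{k}"] exI[of _ "\<lambda>_. f"]) auto

lemma weight_sum_add:
  assumes "\<And>k. (\<lambda>_. 0) \<in> A k" "\<And>k f g. f \<in> A k \<Longrightarrow> g \<in> A k \<Longrightarrow> (\<lambda>\<tau>. f \<tau> + g \<tau>) \<in> A k"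
    and "F \<in> weight_sum K A" "G \<in> weight_sum K A"
  shows "(\<lambda>\<tau>. F \<tau> + G \<tau>) \<in> weight_sum K A"
proof -
  obtain S f where F: "finite S" "S \<subseteq> K" "\<And>k. k \<in> S \<Longrightarrow> f k \<in> A k" "F = (\<lambda>\<tau>. \<Sum>k\<in>S. f k \<tau>)"
    using assms(3) unfolding weight_sum_def by blast
  obtain T g where G: "finite T" "T \<subseteq> K" "\<And>k. k \<in> T \<Longrightarrow> g k \<in> A k" "G = (\<lambda>\<tau>. \<Sum>k\<in>T. g k \<tau>)"
    using assms(4) unfolding weight_sum_def by blast
  define f' where "f' k = (if k \<in> S then f k else (\<lambda>_. 0))" for k
  define g' where "g' k = (if k \<in> T then g k else (\<lambda>_. 0))" for k
  have F': "F \<tau> = (\<Sum>k\<in>S \<union> T. f' k \<tau>)" for \<tau>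
    unfolding F(4) by (intro sum.mono_neutral_cong_left) (use F(1) G(1) in \<open>auto simp: f'_def\<close>)
  have G': "G \<tau> = (\<Sum>k\<in>S \<union> T. g' k \<tau>)" for \<tau>
    unfolding G(4) by (intro sum.mono_neutral_cong_left) (use F(1) G(1) in \<open>auto simp: g'_def\<close>)
  have "f' k \<in> A k" "g' k \<in> A k" for k using F(3) G(3) assms(1) by (auto simp: f'_def g'_def)
  hence "\<forall>k\<in>S \<union> T. (\<lambda>\<tau>. f' k \<tau> + g' k \<tau>) \<in> A k" using assms(2) by blast
  moreover have "(\<lambda>\<tau>. F \<tau> + G \<tau>) = (\<lambda>\<tau>. \<Sum>k\<in>S \<union> T. f' k \<tau> + g' k \<tau>)"
    by (rule ext) (simp only: F' G' sum.distrib)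
  ultimately show ?thesis unfolding weight_sum_def mem_Collect_eq
    using F(1,2) G(1,2) by (intro exI[of _ "S \<union> T"] exI[of _ "\<lambda>k \<tau>. f' k \<tau> + g' k \<tau>"]) auto
qed

lemma weight_sum_sum:
  assumes "\<And>k. (\<lambda>_. 0) \<in> A k" "\<And>k f g. f \<in> A k \<Longrightarrow> g \<in> A k \<Longrightarrow> (\<lambda>\<tau>. f \<tau> + g \<tau>) \<in> A k"
    and "\<And>i. i \<in> I \<Longrightarrow> F i \<in> weight_sum K A"
  shows "(\<lambda>\<tau>. \<Sum>i\<in>I. F i \<tau>) \<in> weight_sum K A"
  using assms(3)
proof (induction I rule: infinite_finite_induct)
  case (insert x J)
  have "(\<lambda>\<tau>. F x \<tau> + (\<Sum>i\<in>J. F i \<tau>)) \<in> weight_sum K A"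
    by (rule weight_sum_add[OF assms(1,2)]) (use insert in auto)
  thus ?case using insert.hyps by simp
qed (auto simp: weight_sum_zero)

context fuchsian
begin

section \<open>Modular forms of negative weight\<close>

text \<open>
The invariant function \<open>F = |f| (Im \<tau>)\<^bsup>k/2\<^esup>\<close> tends to 0 at the cusps because \<open>k < 0\<close>, so by compactness it has a
maximum, at \<open>\<tau>\<^sub>0\<close> say. Put \<open>g = f (\<tau> - cnj \<tau>\<^sub>0)\<^sup>k\<close> and \<open>D = |\<tau> - cnj \<tau>\<^sub>0|\<^sup>2 / Im \<tau>\<close>; then
\<open>|g| = F D\<^bsup>k/2\<^esup>\<close>. As \<open>D\<close> has a strict minimum at \<open>\<tau>\<^sub>0\<close> and \<open>k < 0\<close>, \<open>|g|\<close> has a strict maximum at \<open>\<tau>\<^sub>0\<close> unless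
\<open>f = 0\<close>, against the maximum modulus principle.
\<close>

lemma negative_weight_vanishes:
  assumes hol: "f holomorphic_on uhp" and k: "k < 0"
    and inv: "\<And>\<gamma> \<tau>. \<gamma> \<in> \<Gamma> \<Longrightarrow> \<tau> \<in> uhp \<Longrightarrow> slash k \<gamma> f \<tau> = f \<tau>"
    and cusp: "\<And>\<sigma>. \<sigma> \<in> SL2R \<Longrightarrow> at_cusp \<sigma> \<Longrightarrow> bounded_at_i_infinity (slash k \<sigma> f)"
    and t1: "\<tau>1 \<in> uhp"
  shows "f \<tau>1 = 0"
proof (rule ccontr)
  assume f1: "f \<tau>1 \<noteq> 0"
  define F where "F \<tau> = cmod (f \<tau>) * Im \<tau> powr (real_of_int k / 2)" for \<tau>
  have slashF: "F (moebius A \<tau>) = cmod (slash k A f \<tau>) * Im \<tau> powr (real_of_int k / 2)"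
    if "A \<in> SL2R" "\<tau> \<in> uhp" for A \<tau>
  proof -
    define j where "j = cmod (jfac A \<tau>)"
    have j: "j > 0" using jfac_nz[OF that] by (simp add: j_def)
    have "Im (moebius A \<tau>) powr (real_of_int k / 2) = Im \<tau> powr (real_of_int k / 2) / (j\<^sup>2) powr (real_of_int k / 2)"
      using Im_moebius[OF that] that(2) j by (simp add: powr_divide uhp_def j_def)
    also have "(j\<^sup>2) powr (real_of_int k / 2) = j powr (real_of_int k)"
      using j by (simp add: powr_powr flip: powr_numeral)
    also have "\<dots> = j powi k" using j by (simp add: powr_real_of_int')
    finally show ?thesis
      using j by (simp add: F_def slash_def norm_mult norm_divide norm_power_int j_def power_int_minus field_simps)
  qed
  have Finv: "F (moebius \<gamma> \<tau>) = F \<tau>" if "\<gamma> \<in> \<Gamma>" "\<tau> \<in> uhp" for \<gamma> \<tau>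
    using slashF[OF G_SL2R[OF that(1)] that(2)] inv[OF that] by (simp add: F_def)
  have Fcont: "continuous_on uhp F" unfolding F_def
    using holomorphic_on_imp_continuous_on[OF hol] by (intro continuous_intros) (auto simp: uhp_def)
  have Fcusp: "\<exists>y>0. \<forall>\<tau>. y < Im \<tau> \<longrightarrow> F (moebius \<sigma> \<tau>) < r"
    if \<sigma>: "\<sigma> \<in> SL2R" "at_cusp \<sigma>" and r: "r > 0" for \<sigma> and r :: real
  proof -
    obtain h0 where h0: "h0 \<noteq> 0" "cusp_shift \<sigma> h0 \<in> \<Gamma>" using cusp_unipotent[OF \<sigma>] .
    obtain h where h: "h > 0" "cusp_shift \<sigma> h \<in> \<Gamma>"
      using that[of "\<bar>h0\<bar>"] h0 cusp_shift_minus[OF \<sigma>(1) h0(2)] by (metis abs_if neg_0_less_iff_less not_less_iff_gr_or_eq)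
    have per: "F (moebius \<sigma> (\<tau> + of_real (of_int n * h))) = F (moebius \<sigma> \<tau>)" if "\<tau> \<in> uhp" for \<tau> and n :: int
    proof -
      define T where "T = translation (of_int n * h)"
      have T: "T \<in> SL2R" by (simp add: T_def)
      have "\<tau> + of_real (of_int n * h) = moebius T \<tau>" by (simp add: T_def moebius_def jfac_def)
      moreover have "moebius \<sigma> (moebius T \<tau>) = moebius (cusp_shift \<sigma> (of_int n * h)) (moebius \<sigma> \<tau>)"
        unfolding moebius_mult[OF \<sigma>(1) T that, symmetric] moebius_mult[OF cusp_shift_SL2R[OF \<sigma>(1)] \<sigma>(1) that, symmetric]
        by (simp add: cusp_shift_def SL2R_cancel \<sigma> T_def)
      ultimately show ?thesis
        using Finv[OF cusp_shift_of_int[OF \<sigma>(1) h(2)] moebius_uhp[OF \<sigma>(1) that]] by simp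
    qed
    obtain y B where yB: "y > 0" "\<And>\<tau>. 0 \<le> Re \<tau> \<and> Re \<tau> \<le> h \<and> y \<le> Im \<tau> \<Longrightarrow> cmod (slash k \<sigma> f \<tau>) \<le> B"
      using cusp[OF \<sigma>] unfolding bounded_at_i_infinity_def by meson
    have "((\<lambda>x. B * x powr (real_of_int k / 2)) \<longlongrightarrow> B * 0) at_top"
      using k by (intro tendsto_intros tendsto_neg_powr filterlim_ident) auto
    hence "eventually (\<lambda>x. B * x powr (real_of_int k / 2) < r) at_top"
      using r by (intro order_tendstoD(2)) auto
    then obtain y' where y': "\<And>x. x \<ge> y' \<Longrightarrow> B * x powr (real_of_int k / 2) < r"
      unfolding eventually_at_top_linorder by blast
    have "F (moebius \<sigma> \<tau>) < r" if t: "max y y' < Im \<tau>" for \<tau>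
    proof -
      \<comment> \<open>boundedness at a cusp is uniform only for \<open>Re \<tau>\<close> in compact sets; periodicity extends it to all \<open>\<tau>\<close>\<close>
      define \<tau>' where "\<tau>' = \<tau> + of_real (of_int (- \<lfloor>Re \<tau> / h\<rfloor>) * h)"
      have tu: "\<tau> \<in> uhp" "\<tau>' \<in> uhp" using t yB(1) by (auto simp: uhp_def \<tau>'_def)
      have "0 \<le> Re \<tau>'" using floor_divide_lower[OF h(1), of "Re \<tau>"] by (simp add: \<tau>'_def)
      moreover have "Re \<tau>' \<le> h" using floor_divide_upper[OF h(1), of "Re \<tau>"] by (simp add: \<tau>'_def algebra_simps)
      moreover have "Im \<tau>' = Im \<tau>" by (simp add: \<tau>'_def)
      ultimately have "cmod (slash k \<sigma> f \<tau>') \<le> B" using yB(2)[of \<tau>'] t by simp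
      hence "F (moebius \<sigma> \<tau>') \<le> B * Im \<tau> powr (real_of_int k / 2)"
        using slashF[OF \<sigma>(1) tu(2)] \<open>Im \<tau>' = Im \<tau>\<close> by (simp add: mult_right_mono)
      moreover have "F (moebius \<sigma> \<tau>') = F (moebius \<sigma> \<tau>)" unfolding \<tau>'_def by (rule per[OF tu(1)])
      ultimately show ?thesis using y'[of "Im \<tau>"] t by simp
    qed
    thus ?thesis using yB(1) by (intro exI[of _ "max y y'"]) auto
  qed
  have F1: "F \<tau>1 > 0" using f1 t1 by (simp add: F_def uhp_def)
  have "\<exists>n. \<forall>\<tau>\<in>uhp. F \<tau> < F \<tau>1 + real n"
  proof (rule invariant_bounded_by_cusps[OF Fcont Finv])
    show "mono (\<lambda>n. F \<tau>1 + real n)" by (intro monoI) simp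
    fix \<tau> show "\<exists>n. F \<tau> < F \<tau>1 + real n" using reals_Archimedean2[of "F \<tau> - F \<tau>1"] by (auto simp: algebra_simps)
  next
    fix \<sigma> and n :: nat assume "\<sigma> \<in> SL2R" "at_cusp \<sigma>"
    thus "\<exists>y>0. \<forall>\<tau>. y < Im \<tau> \<longrightarrow> F (moebius \<sigma> \<tau>) < F \<tau>1 + real n" using F1 by (intro Fcusp) auto
  qed
  then obtain N where N: "\<And>\<tau>. \<tau> \<in> uhp \<Longrightarrow> F \<tau> < F \<tau>1 + real N" by blast
  have bdd: "bdd_above (F ` uhp)" by (rule bdd_aboveI2[of _ _ "F \<tau>1 + real N"]) (use N in \<open>auto intro: less_imp_le\<close>)
  define S where "S = Sup (F ` uhp)"
  have S: "F \<tau> \<le> S" if "\<tau> \<in> uhp" for \<tau> unfolding S_def using bdd that by (intro cSup_upper) auto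
  have Spos: "S > 0" using S[OF t1] F1 by simp
  have "\<exists>\<tau>0\<in>uhp. F \<tau>0 = S"
  proof (rule ccontr)
    assume "\<not> ?thesis"
    hence lt: "F \<tau> < S" if "\<tau> \<in> uhp" for \<tau> using S[OF that] that by (metis less_le)
    \<comment> \<open>levels increasing to the supremum; all are positive, so that they are not reached near the cusps\<close>
    define r where "r n = S - S * inverse (real (n + 2))" for n :: nat
    have "\<exists>n. \<forall>\<tau>\<in>uhp. F \<tau> < r n"
    proof (rule invariant_bounded_by_cusps[OF Fcont Finv])
      show "mono r" unfolding r_def using Spos by (intro monoI diff_left_mono mult_left_mono) (auto simp: field_simps)
      fix \<tau> assume t: "\<tau> \<in> uhp"
      obtain n where n: "S / (S - F \<tau>) < real n" using reals_Archimedean2 by blast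
      have "S < real (n + 2) * (S - F \<tau>)" using n lt[OF t] Spos by (simp add: field_simps)
      hence "F \<tau> < r n" unfolding r_def by (simp add: field_simps)
      thus "\<exists>n. F \<tau> < r n" by blast
    next
      fix \<sigma> and n :: nat assume "\<sigma> \<in> SL2R" "at_cusp \<sigma>"
      moreover have "r n > 0" unfolding r_def using Spos mult_nonneg_nonneg[of S "real n"]
        by (simp add: field_simps add_pos_nonneg)
      ultimately show "\<exists>y>0. \<forall>\<tau>. y < Im \<tau> \<longrightarrow> F (moebius \<sigma> \<tau>) < r n" by (intro Fcusp)
    qed
    then obtain n where n: "\<And>\<tau>. \<tau> \<in> uhp \<Longrightarrow> F \<tau> < r n" by blast
    have "S \<le> r n" unfolding S_def using t1 n by (intro cSup_least) (auto intro: less_imp_le)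
    moreover have "r n < S" unfolding r_def using Spos by simp
    ultimately show False by simp
  qed
  then obtain \<tau>0 where t0: "\<tau>0 \<in> uhp" and max: "\<And>\<tau>. \<tau> \<in> uhp \<Longrightarrow> F \<tau> \<le> F \<tau>0" and F0: "F \<tau>0 > 0"
    using S Spos by metis
  define y0 where "y0 = Im \<tau>0"
  have y0: "y0 > 0" using t0 by (simp add: y0_def uhp_def)
  define g where "g \<tau> = f \<tau> * (\<tau> - cnj \<tau>0) powi k" for \<tau>
  define D where "D \<tau> = (cmod (\<tau> - cnj \<tau>0))\<^sup>2 / Im \<tau>" for \<tau>
  have nz: "\<tau> - cnj \<tau>0 \<noteq> 0" if "\<tau> \<in> uhp" for \<tau>
    using that y0 by (auto simp: uhp_def y0_def complex_eq_iff)
  have ghol: "g holomorphic_on uhp" unfolding g_def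
    using nz by (intro holomorphic_intros hol) auto
  have D_eq: "D \<tau> = 4 * y0 + (cmod (\<tau> - \<tau>0))\<^sup>2 / Im \<tau>" if "\<tau> \<in> uhp" for \<tau>
    using that unfolding D_def cmod_power2 by (simp add: uhp_def y0_def field_simps power2_eq_square)
  have gF: "cmod (g \<tau>) = F \<tau> * D \<tau> powr (real_of_int k / 2)" if "\<tau> \<in> uhp" for \<tau>
  proof -
    define n where "n = cmod (\<tau> - cnj \<tau>0)"
    have n: "n > 0" using nz[OF that] by (simp add: n_def)
    have "(n\<^sup>2) powr (real_of_int k / 2) = n powr (real_of_int k)"
      using n by (simp add: powr_powr flip: powr_numeral)
    also have "\<dots> = n powi k" using n by (simp add: powr_real_of_int')
    finally show ?thesis
      using that n by (simp add: g_def F_def D_def norm_mult norm_power_int n_def powr_divide uhp_def)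
  qed
  have Dmono: "D \<tau> powr (real_of_int k / 2) \<le> (4 * y0) powr (real_of_int k / 2)" if "\<tau> \<in> uhp" for \<tau>
    using that k y0 by (intro powr_mono2') (auto simp: D_eq uhp_def)
  have D0: "D \<tau>0 = 4 * y0" using t0 by (simp add: D_eq)
  have "g constant_on uhp"
  proof (rule maximum_modulus_principle[OF ghol open_uhp connected_uhp open_uhp order_refl t0])
    fix \<tau> assume t: "\<tau> \<in> uhp"
    show "norm (g \<tau>) \<le> norm (g \<tau>0)"
      unfolding gF[OF t] gF[OF t0] D0 using max[OF t] Dmono[OF t] F0 by (intro mult_mono) auto
  qed
  then obtain c where c: "\<And>\<tau>. \<tau> \<in> uhp \<Longrightarrow> g \<tau> = c" unfolding constant_on_def by blast
  \<comment> \<open>any point other than \<open>\<tau>\<^sub>0\<close> contradicts constancy of \<open>g\<close>\<close>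
  define \<tau>2 where "\<tau>2 = \<tau>0 + \<i>"
  have t2: "\<tau>2 \<in> uhp" using t0 by (simp add: \<tau>2_def uhp_def)
  have "D \<tau>2 > 4 * y0" using D_eq[OF t2] t2 by (simp add: \<tau>2_def uhp_def)
  hence "D \<tau>2 powr (real_of_int k / 2) < (4 * y0) powr (real_of_int k / 2)"
    using k y0 by (intro powr_less_mono2_neg) auto
  moreover have "F \<tau>2 * D \<tau>2 powr (real_of_int k / 2) \<le> F \<tau>0 * D \<tau>2 powr (real_of_int k / 2)"
    using max[OF t2] by (intro mult_right_mono) auto
  ultimately have "cmod (g \<tau>2) < cmod (g \<tau>0)"
    unfolding gF[OF t2] gF[OF t0] D0 using F0 by (smt (verit) mult_strict_left_mono)
  thus False using c[OF t2] c[OF t0] by simp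
qed

end


section \<open>Quasi-modular forms and their coefficients\<close>

lemma sum_atMost_extend:
  assumes "s \<le> s'" "\<And>m. m > s \<Longrightarrow> f m = 0"
  shows "(\<Sum>m\<le>s. f m) = (\<Sum>m\<le>s'. f (m::nat))"
  by (rule sum.mono_neutral_left) (use assms in \<open>auto simp: not_le\<close>)

text \<open>
\<open>f\<close> is quasi-modular of weight \<open>k\<close> and depth at most \<open>s\<close>, with coefficient functions \<open>Q m = Q\<^sub>m(f)\<close>. The sequence \<open>Q\<close>
is infinite and vanishes above \<open>s\<close> and outside the upper half plane, so that it does not depend on the choice of \<open>s\<close>.
\<close>

definition qm_data :: "(real^2^2) set \<Rightarrow> int \<Rightarrow> nat \<Rightarrow> (complex \<Rightarrow> complex) \<Rightarrow> (nat \<Rightarrow> complex \<Rightarrow> complex) \<Rightarrow> bool" where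
  "qm_data \<Gamma> k s f Q \<longleftrightarrow> f holomorphic_on uhp \<and> (\<forall>\<tau>. \<tau> \<notin> uhp \<longrightarrow> f \<tau> = 0) \<and>
     (\<forall>m. Q m holomorphic_on uhp) \<and> (\<forall>m \<tau>. \<tau> \<notin> uhp \<longrightarrow> Q m \<tau> = 0) \<and> (\<forall>m>s. Q m = (\<lambda>_. 0)) \<and>
     (\<forall>\<gamma>\<in>\<Gamma>. \<forall>\<tau>\<in>uhp. slash k \<gamma> f \<tau> = (\<Sum>m\<le>s. Xfac \<gamma> \<tau> ^ m * Q m \<tau>)) \<and>
     (\<forall>\<sigma>\<in>SL2R. moebius_ext \<sigma> None \<in> cusps \<Gamma> \<longrightarrow>
        (\<forall>m. bounded_at_i_infinity (slash (k - 2 * int m) \<sigma> (Q m))))"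

lemma slash_zero [simp]: "slash k \<gamma> (\<lambda>_. 0) = (\<lambda>_. 0)" by (simp add: slash_def fun_eq_iff)

lemma slash_add: "slash k \<gamma> (\<lambda>\<tau>. f \<tau> + g \<tau>) \<tau> = slash k \<gamma> f \<tau> + slash k \<gamma> g \<tau>"
  by (simp add: slash_def algebra_simps)

lemma slash_scale: "slash k \<gamma> (\<lambda>\<tau>. c * f \<tau>) \<tau> = c * slash k \<gamma> f \<tau>"
  by (simp add: slash_def algebra_simps)

lemma slash_mult:
  assumes "\<gamma> \<in> SL2R" "\<tau> \<in> uhp"
  shows "slash (k + l) \<gamma> (\<lambda>\<tau>. f \<tau> * g \<tau>) \<tau> = slash k \<gamma> f \<tau> * slash l \<gamma> g \<tau>"
  using jfac_nz[OF assms] by (simp add: slash_def power_int_diff power_int_minus field_simps power_int_add)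

lemma slash_power:
  assumes "\<gamma> \<in> SL2R" "\<tau> \<in> uhp"
  shows "slash (int n * k) \<gamma> (\<lambda>\<tau>. f \<tau> ^ n) \<tau> = slash k \<gamma> f \<tau> ^ n"
proof (induction n)
  case 0 thus ?case by (simp add: slash_def)
next
  case (Suc n)
  show ?case using slash_mult[OF assms, of k "int n * k" f "\<lambda>\<tau>. f \<tau> ^ n"] Suc
    by (simp add: algebra_simps)
qed

lemma quasimodular_iff: "f \<in> quasimodular \<Gamma> k \<longleftrightarrow> (\<exists>s Q. qm_data \<Gamma> k s f Q)" if G: "\<Gamma> \<subseteq> SL2R"
proof
  assume "f \<in> quasimodular \<Gamma> k"
  then obtain s Q where *: "f holomorphic_on uhp" "\<forall>\<tau>. \<tau> \<notin> uhp \<longrightarrow> f \<tau> = 0" "\<forall>m\<le>s. Q m holomorphic_on uhp"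
    "\<forall>\<gamma>\<in>\<Gamma>. \<forall>\<tau>\<in>uhp. slash k \<gamma> f \<tau> = (\<Sum>m\<le>s. Xfac \<gamma> \<tau> ^ m * Q m \<tau>)"
    "\<forall>\<sigma>\<in>SL2R. moebius_ext \<sigma> None \<in> cusps \<Gamma> \<longrightarrow>
           (\<forall>m\<le>s. bounded_at_i_infinity (slash (k - 2 * int m) \<sigma> (Q m)))"
    unfolding quasimodular_def by blast
  define Q' where "Q' m \<tau> = (if m \<le> s \<and> \<tau> \<in> uhp then Q m \<tau> else 0)" for m \<tau>
  have "Q' m holomorphic_on uhp" for m
  proof (cases "m \<le> s")
    case True
    have "Q m holomorphic_on uhp" using *(3) True by blast
    thus ?thesis by (rule holomorphic_transform) (simp add: Q'_def True)
  next
    case False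
    hence "Q' m = (\<lambda>_. 0)" by (auto simp: Q'_def)
    thus ?thesis by simp
  qed
  moreover have "bounded_at_i_infinity (slash (k - 2 * int m) \<sigma> (Q' m))"
    if s: "\<sigma> \<in> SL2R" "moebius_ext \<sigma> None \<in> cusps \<Gamma>" for \<sigma> m
  proof (cases "m \<le> s")
    case True
    hence eq: "slash (k - 2 * int m) \<sigma> (Q m) \<tau> = slash (k - 2 * int m) \<sigma> (Q' m) \<tau>" if "\<tau> \<in> uhp" for \<tau>
      using moebius_uhp[OF s(1) that] by (simp add: slash_def Q'_def)
    have "bounded_at_i_infinity (slash (k - 2 * int m) \<sigma> (Q m))" using *(5) s True by blast
    thus ?thesis by (rule bounded_at_i_infinity_cong[rotated]) (rule eq)
  next
    case False
    hence "Q' m = (\<lambda>_. 0)" by (auto simp: Q'_def)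
    thus ?thesis by simp
  qed
  ultimately have "qm_data \<Gamma> k s f Q'"
    unfolding qm_data_def using *(1,2,4) by (auto simp: Q'_def fun_eq_iff)
  thus "\<exists>s Q. qm_data \<Gamma> k s f Q" by blast
next
  assume "\<exists>s Q. qm_data \<Gamma> k s f Q"
  then obtain s Q where "qm_data \<Gamma> k s f Q" by blast
  thus "f \<in> quasimodular \<Gamma> k" unfolding qm_data_def quasimodular_def mem_Collect_eq
    by (intro conjI exI[of _ s] exI[of _ Q]) simp_all
qed

lemma qm_data_mono:
  assumes "qm_data \<Gamma> k s f Q" "s \<le> s'" shows "qm_data \<Gamma> k s' f Q"
proof -
  have "(\<Sum>m\<le>s. Xfac \<gamma> \<tau> ^ m * Q m \<tau>) = (\<Sum>m\<le>s'. Xfac \<gamma> \<tau> ^ m * Q m \<tau>)" for \<gamma> \<tau>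
    by (rule sum_atMost_extend) (use assms in \<open>auto simp: qm_data_def\<close>)
  thus ?thesis using assms unfolding qm_data_def by auto
qed

lemma qm_data_add:
  assumes "qm_data \<Gamma> k s f Q" "qm_data \<Gamma> k s g R"
  shows "qm_data \<Gamma> k s (\<lambda>\<tau>. f \<tau> + g \<tau>) (\<lambda>m \<tau>. Q m \<tau> + R m \<tau>)"
  using assms unfolding qm_data_def slash_add[abs_def]
  by (auto simp: sum.distrib algebra_simps intro!: holomorphic_on_add bounded_at_i_infinity_add)

lemma qm_data_scale:
  assumes "qm_data \<Gamma> k s f Q"
  shows "qm_data \<Gamma> k s (\<lambda>\<tau>. c * f \<tau>) (\<lambda>m \<tau>. c * Q m \<tau>)"
  using assms unfolding qm_data_def slash_scale[abs_def]
  by (auto simp: sum_distrib_left algebra_simps intro!: holomorphic_on_mult bounded_at_i_infinity_mult)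

lemma qm_data_zero: "qm_data \<Gamma> k s (\<lambda>_. 0) (\<lambda>_ _. 0)"
  unfolding qm_data_def by auto

lemma quasimodular_subspace:
  assumes G: "\<Gamma> \<subseteq> SL2R"
  shows quasimodular_zero: "(\<lambda>_. 0) \<in> quasimodular \<Gamma> k"
    and quasimodular_add: "f \<in> quasimodular \<Gamma> k \<Longrightarrow> g \<in> quasimodular \<Gamma> k \<Longrightarrow> (\<lambda>\<tau>. f \<tau> + g \<tau>) \<in> quasimodular \<Gamma> k"
    and quasimodular_scale: "f \<in> quasimodular \<Gamma> k \<Longrightarrow> (\<lambda>\<tau>. c * f \<tau>) \<in> quasimodular \<Gamma> k"
proof -
  show "(\<lambda>_. 0) \<in> quasimodular \<Gamma> k" unfolding quasimodular_iff[OF G] using qm_data_zero by blast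
  show "(\<lambda>\<tau>. c * f \<tau>) \<in> quasimodular \<Gamma> k" if "f \<in> quasimodular \<Gamma> k"
    using that qm_data_scale unfolding quasimodular_iff[OF G] by blast
  assume "f \<in> quasimodular \<Gamma> k" "g \<in> quasimodular \<Gamma> k"
  then obtain s Q s' R where "qm_data \<Gamma> k s f Q" "qm_data \<Gamma> k s' g R" unfolding quasimodular_iff[OF G] by blast
  hence "qm_data \<Gamma> k (max s s') f Q" "qm_data \<Gamma> k (max s s') g R" by (auto intro: qm_data_mono)
  thus "(\<lambda>\<tau>. f \<tau> + g \<tau>) \<in> quasimodular \<Gamma> k" unfolding quasimodular_iff[OF G] using qm_data_add by blast
qed

context fuchsian
begin

lemma G_sub: "\<Gamma> \<subseteq> SL2R" using G_SL2R by blast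

lemma X_coeffs_unique:
  assumes "\<tau> \<in> uhp" "\<And>\<gamma>. \<gamma> \<in> \<Gamma> \<Longrightarrow> (\<Sum>m\<le>s. Xfac \<gamma> \<tau> ^ m * a m) = (\<Sum>m\<le>s. Xfac \<gamma> \<tau> ^ m * b m)" "m \<le> s"
  shows "a m = b m"
proof -
  have "(a m - b m) = 0"
  proof (rule weight_depth_independent[OF assms(1), where W = "{0}" and s = s and q = "\<lambda>w m. a m - b m" and w = 0 and m = m])
    fix \<gamma> assume "\<gamma> \<in> \<Gamma>"
    thus "(\<Sum>w\<in>{0}. jfac \<gamma> \<tau> powi w * (\<Sum>m\<le>s. Xfac \<gamma> \<tau> ^ m * (a m - b m))) = 0"
      using assms(2)[of \<gamma>] by (simp add: right_diff_distrib sum_subtractf)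
  qed (use assms in auto)
  thus ?thesis by simp
qed

text \<open>
Comparison of coefficients after the substitution \<open>X(\<gamma>\<delta>,\<tau>) = x + X(\<gamma>,\<delta>\<tau>)/J\<close>, where \<open>x = X(\<delta>,\<tau>)\<close>,
\<open>J = j(\<delta>,\<tau>)\<^sup>2\<close> and \<open>\<gamma>\<close> runs through \<open>\<Gamma>\<close>: expand by the binomial theorem.
\<close>

lemma X_shift_coeffs:
  assumes t: "\<tau> \<in> uhp" and J: "J \<noteq> 0"
    and eq: "\<And>\<gamma>. \<gamma> \<in> \<Gamma> \<Longrightarrow> (\<Sum>r\<le>s. (x + Xfac \<gamma> \<tau> / J) ^ r * a r) = (\<Sum>m\<le>s. Xfac \<gamma> \<tau> ^ m * e m)" and m: "m \<le> s"
  shows "J ^ m * e m = (\<Sum>r\<le>s. of_nat (r choose m) * x ^ (r - m) * a r)"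
proof -
  define c where "c m = (\<Sum>r\<le>s. of_nat (r choose m) * x ^ (r - m) * a r)" for m
  have "c m / J ^ m = e m"
  proof (rule X_coeffs_unique[OF t _ m])
    fix \<gamma> assume g: "\<gamma> \<in> \<Gamma>"
    define X where "X = Xfac \<gamma> \<tau>"
    have "(\<Sum>m\<le>s. X ^ m * (c m / J ^ m)) = (\<Sum>m\<le>s. \<Sum>r\<le>s. (X / J) ^ m * (of_nat (r choose m) * x ^ (r - m) * a r))"
      by (simp add: c_def sum_distrib_left sum_divide_distrib power_divide field_simps)
    also have "\<dots> = (\<Sum>r\<le>s. (\<Sum>m\<le>s. of_nat (r choose m) * (X / J) ^ m * x ^ (r - m)) * a r)"
      by (subst sum.swap) (simp add: sum_distrib_left sum_distrib_right mult_ac)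
    also have "\<dots> = (\<Sum>r\<le>s. (x + X / J) ^ r * a r)"
    proof (rule sum.cong[OF refl])
      fix r assume "r \<in> {..s}"
      hence "(\<Sum>m\<le>r. of_nat (r choose m) * (X / J) ^ m * x ^ (r - m)) = (\<Sum>m\<le>s. of_nat (r choose m) * (X / J) ^ m * x ^ (r - m))"
        by (intro sum_atMost_extend) (auto simp: binomial_eq_0)
      thus "(\<Sum>m\<le>s. of_nat (r choose m) * (X / J) ^ m * x ^ (r - m)) * a r = (x + X / J) ^ r * a r"
        unfolding add.commute[of x] binomial_ring by simp
    qed
    finally show "(\<Sum>m\<le>s. Xfac \<gamma> \<tau> ^ m * (c m / J ^ m)) = (\<Sum>m\<le>s. Xfac \<gamma> \<tau> ^ m * e m)"
      using eq[OF g] by (simp add: X_def)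
  qed
  hence "J ^ m * e m = J ^ m * (c m / J ^ m)" by simp
  also have "\<dots> = c m" using J by simp
  finally show ?thesis unfolding c_def .
qed

lemma qm_data_Q0:
  assumes "qm_data \<Gamma> k s f Q" shows "Q 0 = f"
proof
  fix \<tau> show "Q 0 \<tau> = f \<tau>"
  proof (cases "\<tau> \<in> uhp")
    case True
    have "slash k (mat 1) f \<tau> = (\<Sum>m\<le>s. 0 ^ m * Q m \<tau>)"
      using assms G_one True unfolding qm_data_def by fastforce
    also have "\<dots> = Q 0 \<tau>" by (subst sum.remove[of _ 0]) (auto intro!: sum.neutral)
    finally show ?thesis by (simp add: slash_def)
  qed (use assms in \<open>auto simp: qm_data_def\<close>)
qed

text \<open>
Expand \<open>f|\<gamma>\<delta> = (f|\<gamma>)|\<delta>\<close> in powers of \<open>X(\<gamma>,\<delta>\<tau>)\<close>; for the top power the binomial expansion has a single term.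
\<close>

lemma top_coefficient_modular:
  assumes d: "qm_data \<Gamma> k s f Q" and g: "\<delta> \<in> \<Gamma>" and t: "\<tau> \<in> uhp"
  shows "slash (k - 2 * int s) \<delta> (Q s) \<tau> = Q s \<tau>"
proof -
  define J where "J = jfac \<delta> \<tau>"
  have J: "J \<noteq> 0" unfolding J_def using jfac_nz G_SL2R g t by blast
  have t': "moebius \<delta> \<tau> \<in> uhp" using moebius_uhp G_SL2R g t by blast
  have "(J ^ 2) ^ s * (J powi (-k) * Q s (moebius \<delta> \<tau>)) =
      (\<Sum>r\<le>s. of_nat (r choose s) * Xfac \<delta> \<tau> ^ (r - s) * Q r \<tau>)"
  proof (rule X_shift_coeffs[OF t'])
    fix \<gamma> assume c: "\<gamma> \<in> \<Gamma>"
    have "(\<Sum>r\<le>s. (Xfac \<delta> \<tau> + Xfac \<gamma> (moebius \<delta> \<tau>) / J ^ 2) ^ r * Q r \<tau>) = (\<Sum>r\<le>s. Xfac (\<gamma> ** \<delta>) \<tau> ^ r * Q r \<tau>)"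
      by (simp add: Xfac_mult G_SL2R c g t J_def)
    also have "\<dots> = slash k (\<gamma> ** \<delta>) f \<tau>" using d G_mult[OF c g] t unfolding qm_data_def by simp
    also have "\<dots> = J powi (-k) * slash k \<gamma> f (moebius \<delta> \<tau>)"
      using G_SL2R c g t by (simp add: slash_def moebius_mult jfac_mult J_def power_int_mult_distrib)
    also have "\<dots> = (\<Sum>m\<le>s. Xfac \<gamma> (moebius \<delta> \<tau>) ^ m * (J powi (-k) * Q m (moebius \<delta> \<tau>)))"
      using d c t' unfolding qm_data_def by (simp add: sum_distrib_left mult_ac)
    finally show "(\<Sum>r\<le>s. (Xfac \<delta> \<tau> + Xfac \<gamma> (moebius \<delta> \<tau>) / J ^ 2) ^ r * Q r \<tau>) =
        (\<Sum>m\<le>s. Xfac \<gamma> (moebius \<delta> \<tau>) ^ m * (J powi (-k) * Q m (moebius \<delta> \<tau>)))" .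
  qed (use J in auto)
  also have "\<dots> = Q s \<tau>"
    by (subst sum.remove[of _ s]) (auto intro!: sum.neutral)
  also have "(J ^ 2) ^ s * (J powi (-k) * Q s (moebius \<delta> \<tau>)) = J powi (- (k - 2 * int s)) * Q s (moebius \<delta> \<tau>)"
    using J by (simp add: power_int_diff power_int_minus power_int_mult field_simps flip: power_mult)
  finally show ?thesis by (simp add: slash_def J_def)
qed

lemma modular_iff:
  "f \<in> modular \<Gamma> k \<longleftrightarrow> qm_data \<Gamma> k 0 f (\<lambda>m. if m = 0 then f else (\<lambda>_. 0))"
proof
  assume f: "f \<in> modular \<Gamma> k"
  then obtain s Q where d: "qm_data \<Gamma> k s f Q" unfolding modular_def quasimodular_iff[OF G_sub] by blast
  have "bounded_at_i_infinity (slash (k - 2 * int m) \<sigma> (if m = 0 then f else (\<lambda>_. 0)))"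
    if "\<sigma> \<in> SL2R" "at_cusp \<sigma>" for \<sigma> m
  proof (cases "m = 0")
    case True
    have "bounded_at_i_infinity (slash (k - 2 * int 0) \<sigma> (Q 0))" using d that unfolding qm_data_def by blast
    thus ?thesis using True qm_data_Q0[OF d] by simp
  qed simp
  thus "qm_data \<Gamma> k 0 f (\<lambda>m. if m = 0 then f else (\<lambda>_. 0))"
    using d f unfolding qm_data_def modular_def by auto
next
  assume d: "qm_data \<Gamma> k 0 f (\<lambda>m. if m = 0 then f else (\<lambda>_. 0))"
  hence "f \<in> quasimodular \<Gamma> k" unfolding quasimodular_iff[OF G_sub] by blast
  thus "f \<in> modular \<Gamma> k" using d unfolding modular_def qm_data_def by auto
qed

lemma modular_zero: "(\<lambda>_. 0) \<in> modular \<Gamma> k"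
  using quasimodular_zero[OF G_sub] by (simp add: modular_def)

lemma modular_add: "f \<in> modular \<Gamma> k \<Longrightarrow> g \<in> modular \<Gamma> k \<Longrightarrow> (\<lambda>\<tau>. f \<tau> + g \<tau>) \<in> modular \<Gamma> k"
  using quasimodular_add[OF G_sub] by (simp add: modular_def slash_add)

lemma modular_scale: "f \<in> modular \<Gamma> k \<Longrightarrow> (\<lambda>\<tau>. c * f \<tau>) \<in> modular \<Gamma> k"
  using quasimodular_scale[OF G_sub] by (simp add: modular_def slash_scale)

lemma modular_negative: "f \<in> modular \<Gamma> k \<Longrightarrow> k < 0 \<Longrightarrow> f = (\<lambda>_. 0)"
proof
  fix \<tau> assume f: "f \<in> modular \<Gamma> k" and k: "k < 0"
  hence d: "qm_data \<Gamma> k 0 f (\<lambda>m. if m = 0 then f else (\<lambda>_. 0))" unfolding modular_iff by blast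
  show "f \<tau> = 0"
  proof (cases "\<tau> \<in> uhp")
    case True
    show ?thesis
    proof (rule negative_weight_vanishes[OF _ k _ _ True])
      show "f holomorphic_on uhp" using d by (simp add: qm_data_def)
      show "\<And>\<gamma> \<tau>. \<gamma> \<in> \<Gamma> \<Longrightarrow> \<tau> \<in> uhp \<Longrightarrow> slash k \<gamma> f \<tau> = f \<tau>" using f by (simp add: modular_def)
      fix \<sigma> assume "\<sigma> \<in> SL2R" "at_cusp \<sigma>"
      hence "bounded_at_i_infinity (slash (k - 2 * int 0) \<sigma> (if (0::nat) = 0 then f else (\<lambda>_. 0)))"
        using d unfolding qm_data_def by blast
      thus "bounded_at_i_infinity (slash k \<sigma> f)" by simp
    qed
  qed (use d in \<open>auto simp: qm_data_def\<close>)
qed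

lemma modular_in_ring: "f \<in> modular \<Gamma> k \<Longrightarrow> f \<in> modular_ring \<Gamma>"
  unfolding modular_ring_def using modular_negative[of f k] weight_sum_zero
  by (cases "k < 0") (auto intro: weight_sum_single)

end


section \<open>Derivation with respect to E\<close>

definition kappa :: complex where "kappa = 12 / (2 * of_real pi * \<i>)"

lemma kappa_nz: "kappa \<noteq> 0" by (simp add: kappa_def)

text \<open>
The value at \<open>\<gamma>\<tau>\<close> of a sum of quasi-modular forms with weights in \<open>W\<close>, where \<open>q w m\<close> is the \<open>m\<close>-th coefficient of the
component of weight \<open>w\<close>.
\<close>

abbreviation expansion ::
  "int set \<Rightarrow> nat \<Rightarrow> (int \<Rightarrow> nat \<Rightarrow> complex \<Rightarrow> complex) \<Rightarrow> real^2^2 \<Rightarrow> complex \<Rightarrow> complex" where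
  "expansion W s q \<gamma> \<tau> \<equiv> \<Sum>w\<in>W. jfac \<gamma> \<tau> powi w * (\<Sum>m\<le>s. Xfac \<gamma> \<tau> ^ m * q w m \<tau>)"

text \<open>
\<open>xcoeff \<Gamma> f g\<close> says that \<open>f\<close> has such an expansion and that \<open>g\<close> is the sum of its coefficients of \<open>X\<^sup>1\<close>. It is
the graph of the additive operator that is \<open>f \<mapsto> Q\<^sub>1(f)\<close> on forms of a single weight; the sum of the coefficients is all
that is kept, so that \<open>f\<close> need not be split into its weights.
\<close>

definition xcoeff :: "(real^2^2) set \<Rightarrow> (complex \<Rightarrow> complex) \<Rightarrow> (complex \<Rightarrow> complex) \<Rightarrow> bool" where
  "xcoeff \<Gamma> f g \<longleftrightarrow> (\<exists>W s q. finite W \<and> (\<forall>w m. w \<notin> W \<or> m > s \<longrightarrow> q w m = (\<lambda>_. 0)) \<and>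
     (\<forall>\<gamma>\<in>\<Gamma>. \<forall>\<tau>\<in>uhp. f (moebius \<gamma> \<tau>) = expansion W s q \<gamma> \<tau>) \<and>
     (\<forall>\<tau>\<in>uhp. g \<tau> = (\<Sum>w\<in>W. q w (1::nat) \<tau>)))"

lemma expansion_extend:
  fixes q :: "int \<Rightarrow> nat \<Rightarrow> complex \<Rightarrow> complex"
  assumes "finite W'" "W \<subseteq> W'" "s \<le> s'" "\<And>w m. w \<notin> W \<or> m > s \<Longrightarrow> q w m = (\<lambda>_. 0)"
  shows "(\<Sum>w\<in>W. j w * (\<Sum>m\<le>s. X ^ m * q w m \<tau>)) = (\<Sum>w\<in>W'. j w * (\<Sum>m\<le>s'. X ^ m * q w m \<tau>))"
proof -
  have "(\<Sum>m\<le>s. X ^ m * q w m \<tau>) = (\<Sum>m\<le>s'. X ^ m * q w m \<tau>)" for w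
    by (rule sum_atMost_extend) (use assms in auto)
  thus ?thesis using assms by (simp, intro sum.mono_neutral_left) auto
qed

lemma xcoeffE:
  assumes "xcoeff \<Gamma> f g"
  obtains W s q where "finite W" "\<And>w m. w \<notin> W \<or> m > s \<Longrightarrow> q w m = (\<lambda>_. 0)"
    "\<And>\<gamma> \<tau>. \<gamma> \<in> \<Gamma> \<Longrightarrow> \<tau> \<in> uhp \<Longrightarrow> f (moebius \<gamma> \<tau>) = expansion W s q \<gamma> \<tau>"
    "\<And>\<tau>. \<tau> \<in> uhp \<Longrightarrow> g \<tau> = (\<Sum>w\<in>W. q w (1::nat) \<tau>)"
proof -
  from assms[unfolded xcoeff_def] obtain W s q where "finite W"
    and 1: "\<forall>w m. w \<notin> W \<or> m > s \<longrightarrow> q w m = (\<lambda>_. 0)"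
    and 2: "\<forall>\<gamma>\<in>\<Gamma>. \<forall>\<tau>\<in>uhp. f (moebius \<gamma> \<tau>) = expansion W s q \<gamma> \<tau>"
    and 3: "\<forall>\<tau>\<in>uhp. g \<tau> = (\<Sum>w\<in>W. q w (1::nat) \<tau>)"
    by (elim exE conjE) (rule that)
  show ?thesis
    by (rule that[of W s q, OF \<open>finite W\<close> 1[rule_format] 2[rule_format] 3[rule_format]])
qed

lemma xcoeff_common:
  assumes "xcoeff \<Gamma> f g" "xcoeff \<Gamma> f' g'"
  obtains W s q q' where "finite W"
    "\<And>w m. w \<notin> W \<or> m > s \<Longrightarrow> q w m = (\<lambda>_. 0)" "\<And>w m. w \<notin> W \<or> m > s \<Longrightarrow> q' w m = (\<lambda>_. 0)"
    "\<And>\<gamma> \<tau>. \<gamma> \<in> \<Gamma> \<Longrightarrow> \<tau> \<in> uhp \<Longrightarrow> f (moebius \<gamma> \<tau>) = expansion W s q \<gamma> \<tau>"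
    "\<And>\<gamma> \<tau>. \<gamma> \<in> \<Gamma> \<Longrightarrow> \<tau> \<in> uhp \<Longrightarrow> f' (moebius \<gamma> \<tau>) = expansion W s q' \<gamma> \<tau>"
    "\<And>\<tau>. \<tau> \<in> uhp \<Longrightarrow> g \<tau> = (\<Sum>w\<in>W. q w 1 \<tau>)" "\<And>\<tau>. \<tau> \<in> uhp \<Longrightarrow> g' \<tau> = (\<Sum>w\<in>W. q' w 1 \<tau>)"
proof -
  obtain W s q where 1: "finite W" "\<And>w m. w \<notin> W \<or> m > s \<Longrightarrow> q w m = (\<lambda>_. 0)"
    "\<And>\<gamma> \<tau>. \<gamma> \<in> \<Gamma> \<Longrightarrow> \<tau> \<in> uhp \<Longrightarrow> f (moebius \<gamma> \<tau>) = expansion W s q \<gamma> \<tau>"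
    "\<And>\<tau>. \<tau> \<in> uhp \<Longrightarrow> g \<tau> = (\<Sum>w\<in>W. q w (1::nat) \<tau>)"
    by (rule xcoeffE[OF assms(1)]) (rule that)
  obtain W' s' q' where 2: "finite W'" "\<And>w m. w \<notin> W' \<or> m > s' \<Longrightarrow> q' w m = (\<lambda>_. 0)"
    "\<And>\<gamma> \<tau>. \<gamma> \<in> \<Gamma> \<Longrightarrow> \<tau> \<in> uhp \<Longrightarrow> f' (moebius \<gamma> \<tau>) = expansion W' s' q' \<gamma> \<tau>"
    "\<And>\<tau>. \<tau> \<in> uhp \<Longrightarrow> g' \<tau> = (\<Sum>w\<in>W'. q' w (1::nat) \<tau>)"
    by (rule xcoeffE[OF assms(2)]) (rule that)
  define U t where "U = W \<union> W'" and "t = max s s'"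
  have fin: "finite U" using 1(1) 2(1) by (simp add: U_def)
  show ?thesis
  proof (rule that[of U t q q'])
    fix \<gamma> \<tau> assume g: "\<gamma> \<in> \<Gamma>" "\<tau> \<in> uhp"
    show "f (moebius \<gamma> \<tau>) = expansion U t q \<gamma> \<tau>"
      unfolding 1(3)[OF g] by (rule expansion_extend) (use fin 1(2) in \<open>auto simp: U_def t_def\<close>)
    show "f' (moebius \<gamma> \<tau>) = expansion U t q' \<gamma> \<tau>"
      unfolding 2(3)[OF g] by (rule expansion_extend) (use fin 2(2) in \<open>auto simp: U_def t_def\<close>)
  next
    fix \<tau> assume g: "\<tau> \<in> uhp"
    show "g \<tau> = (\<Sum>w\<in>U. q w 1 \<tau>)"
      unfolding 1(4)[OF g] by (rule sum.mono_neutral_left) (use fin 1(2) in \<open>auto simp: U_def\<close>)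
    show "g' \<tau> = (\<Sum>w\<in>U. q' w 1 \<tau>)"
      unfolding 2(4)[OF g] by (rule sum.mono_neutral_left) (use fin 2(2) in \<open>auto simp: U_def\<close>)
  qed (use fin 1(2) 2(2) in \<open>auto simp: U_def t_def\<close>)
qed

lemma xcoeff_add:
  assumes "xcoeff \<Gamma> f g" "xcoeff \<Gamma> f' g'"
  shows "xcoeff \<Gamma> (\<lambda>\<tau>. f \<tau> + f' \<tau>) (\<lambda>\<tau>. g \<tau> + g' \<tau>)"
proof -
  obtain W s q q' where *: "finite W"
    "\<And>w m. w \<notin> W \<or> m > s \<Longrightarrow> q w m = (\<lambda>_. 0)" "\<And>w m. w \<notin> W \<or> m > s \<Longrightarrow> q' w m = (\<lambda>_. 0)"
    "\<And>\<gamma> \<tau>. \<gamma> \<in> \<Gamma> \<Longrightarrow> \<tau> \<in> uhp \<Longrightarrow> f (moebius \<gamma> \<tau>) = expansion W s q \<gamma> \<tau>"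
    "\<And>\<gamma> \<tau>. \<gamma> \<in> \<Gamma> \<Longrightarrow> \<tau> \<in> uhp \<Longrightarrow> f' (moebius \<gamma> \<tau>) = expansion W s q' \<gamma> \<tau>"
    "\<And>\<tau>. \<tau> \<in> uhp \<Longrightarrow> g \<tau> = (\<Sum>w\<in>W. q w 1 \<tau>)" "\<And>\<tau>. \<tau> \<in> uhp \<Longrightarrow> g' \<tau> = (\<Sum>w\<in>W. q' w 1 \<tau>)"
    by (rule xcoeff_common[OF assms]) (rule that)
  show ?thesis unfolding xcoeff_def
  proof (intro exI[of _ W] exI[of _ s] exI[of _ "\<lambda>w m \<tau>. q w m \<tau> + q' w m \<tau>"] conjI ballI)
    show "\<forall>w m. w \<notin> W \<or> s < m \<longrightarrow> (\<lambda>\<tau>. q w m \<tau> + q' w m \<tau>) = (\<lambda>_. 0)" using *(2,3) by simp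
  qed (use * in \<open>simp_all add: sum.distrib distrib_left\<close>)
qed

lemma xcoeff_scale:
  assumes "xcoeff \<Gamma> f g" shows "xcoeff \<Gamma> (\<lambda>\<tau>. c * f \<tau>) (\<lambda>\<tau>. c * g \<tau>)"
proof -
  obtain W s q where 1: "finite W" "\<And>w m. w \<notin> W \<or> m > s \<Longrightarrow> q w m = (\<lambda>_. 0)"
    "\<And>\<gamma> \<tau>. \<gamma> \<in> \<Gamma> \<Longrightarrow> \<tau> \<in> uhp \<Longrightarrow> f (moebius \<gamma> \<tau>) = expansion W s q \<gamma> \<tau>"
    "\<And>\<tau>. \<tau> \<in> uhp \<Longrightarrow> g \<tau> = (\<Sum>w\<in>W. q w (1::nat) \<tau>)"
    by (rule xcoeffE[OF assms(1)]) (rule that)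
  show ?thesis unfolding xcoeff_def
  proof (intro exI[of _ W] exI[of _ s] exI[of _ "\<lambda>w m \<tau>. c * q w m \<tau>"] conjI ballI)
    show "\<forall>w m. w \<notin> W \<or> s < m \<longrightarrow> (\<lambda>\<tau>. c * q w m \<tau>) = (\<lambda>_. 0)" using 1 by simp
  qed (use 1 in \<open>simp_all add: sum_distrib_left mult_ac\<close>)
qed

lemma xcoeff_zero: "xcoeff \<Gamma> (\<lambda>_. 0) (\<lambda>_. 0)"
  unfolding xcoeff_def by (intro exI[of _ "{}"] exI[of _ 0] exI[of _ "\<lambda>_ _ _. 0"]) auto

lemma xcoeff_sum:
  assumes "\<And>i. i \<in> I \<Longrightarrow> xcoeff \<Gamma> (f i) (g i)"
  shows "xcoeff \<Gamma> (\<lambda>\<tau>. \<Sum>i\<in>I. f i \<tau>) (\<lambda>\<tau>. \<Sum>i\<in>I. g i \<tau>)"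
  using assms by (induction I rule: infinite_finite_induct) (auto intro: xcoeff_zero xcoeff_add)

context fuchsian
begin

lemma xcoeff_unique:
  assumes "xcoeff \<Gamma> f g" "xcoeff \<Gamma> f g'" "\<tau> \<in> uhp"
  shows "g \<tau> = g' \<tau>"
proof -
  obtain W s q q' where *: "finite W"
    "\<And>w m. w \<notin> W \<or> m > s \<Longrightarrow> q w m = (\<lambda>_. 0)" "\<And>w m. w \<notin> W \<or> m > s \<Longrightarrow> q' w m = (\<lambda>_. 0)"
    "\<And>\<gamma> \<tau>. \<gamma> \<in> \<Gamma> \<Longrightarrow> \<tau> \<in> uhp \<Longrightarrow> f (moebius \<gamma> \<tau>) = expansion W s q \<gamma> \<tau>"
    "\<And>\<gamma> \<tau>. \<gamma> \<in> \<Gamma> \<Longrightarrow> \<tau> \<in> uhp \<Longrightarrow> f (moebius \<gamma> \<tau>) = expansion W s q' \<gamma> \<tau>"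
    "\<And>\<tau>. \<tau> \<in> uhp \<Longrightarrow> g \<tau> = (\<Sum>w\<in>W. q w 1 \<tau>)" "\<And>\<tau>. \<tau> \<in> uhp \<Longrightarrow> g' \<tau> = (\<Sum>w\<in>W. q' w 1 \<tau>)"
    by (rule xcoeff_common[OF assms(1,2)]) (rule that)
  have "q w 1 \<tau> = q' w 1 \<tau>" if "w \<in> W" for w
  proof (cases "1 \<le> s")
    case True
    have "q w 1 \<tau> - q' w 1 \<tau> = 0"
    proof (rule weight_depth_independent[OF assms(3) *(1), where s = s and q = "\<lambda>w m. q w m \<tau> - q' w m \<tau>"])
      fix \<gamma> assume g: "\<gamma> \<in> \<Gamma>"
      show "(\<Sum>w\<in>W. jfac \<gamma> \<tau> powi w * (\<Sum>m\<le>s. Xfac \<gamma> \<tau> ^ m * (q w m \<tau> - q' w m \<tau>))) = 0"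
        using *(4)[OF g assms(3)] *(5)[OF g assms(3)]
        by (simp add: right_diff_distrib sum_subtractf)
    qed (use that True in auto)
    thus ?thesis by simp
  qed (use *(2,3) in auto)
  thus ?thesis using *(6,7) assms(3) by simp
qed

lemma qm_data_expand:
  assumes "qm_data \<Gamma> k s f Q" "\<gamma> \<in> \<Gamma>" "\<tau> \<in> uhp"
  shows "f (moebius \<gamma> \<tau>) = jfac \<gamma> \<tau> powi k * (\<Sum>m\<le>s. Xfac \<gamma> \<tau> ^ m * Q m \<tau>)"
proof -
  have "jfac \<gamma> \<tau> powi (- k) * f (moebius \<gamma> \<tau>) = (\<Sum>m\<le>s. Xfac \<gamma> \<tau> ^ m * Q m \<tau>)"
    using assms unfolding qm_data_def slash_def by blast
  thus ?thesis using jfac_nz[OF G_SL2R[OF assms(2)] assms(3)] by (simp add: power_int_minus field_simps)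
qed

lemma xcoeff_qm_data:
  assumes "qm_data \<Gamma> k s f Q" shows "xcoeff \<Gamma> f (Q 1)"
  unfolding xcoeff_def
proof (intro exI[of _ "{k}"] exI[of _ s] exI[of _ "\<lambda>w m. if w = k then Q m else (\<lambda>_. 0)"] conjI ballI)
  show "\<forall>w m. w \<notin> {k} \<or> s < m \<longrightarrow> (if w = k then Q m else (\<lambda>_. 0)) = (\<lambda>_. 0)"
    using assms by (simp add: qm_data_def)
qed (use qm_data_expand[OF assms] in auto)

end

locale fuchsian_E2 = fuchsian +
  fixes E :: "complex \<Rightarrow> complex"
  assumes E2: "is_E2 \<Gamma> E"
begin

lemma E_trans: "\<gamma> \<in> \<Gamma> \<Longrightarrow> \<tau> \<in> uhp \<Longrightarrow> slash 2 \<gamma> E \<tau> = E \<tau> + kappa * Xfac \<gamma> \<tau>"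
  using E2 by (simp add: is_E2_def kappa_def)

lemma E_hol: "E holomorphic_on uhp"
  and E_cusp: "\<sigma> \<in> SL2R \<Longrightarrow> at_cusp \<sigma> \<Longrightarrow> bounded_at_i_infinity (slash 2 \<sigma> E)"
proof -
  have "E \<in> quasimodular \<Gamma> 2" using E2 by (simp add: is_E2_def)
  then obtain s Q where d: "qm_data \<Gamma> 2 s E Q" using quasimodular_iff[OF G_sub] by blast
  show "E holomorphic_on uhp" using d by (simp add: qm_data_def)
  assume "\<sigma> \<in> SL2R" "at_cusp \<sigma>"
  hence "bounded_at_i_infinity (slash (2 - 2 * int 0) \<sigma> (Q 0))" using d unfolding qm_data_def by blast
  thus "bounded_at_i_infinity (slash 2 \<sigma> E)" using qm_data_Q0[OF d] by simp
qed

text \<open>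
Since \<open>a\<close> is invariant, \<open>(a E\<^sup>n)|\<gamma> = a (E + \<kappa> X)\<^sup>n\<close>.
\<close>

lemma qm_data_modular_times_power:
  assumes a: "a \<in> modular \<Gamma> k"
  shows "qm_data \<Gamma> (k + 2 * int n) n (\<lambda>\<tau>. a \<tau> * E \<tau> ^ n)
           (\<lambda>m \<tau>. of_nat (n choose m) * kappa ^ m * (a \<tau> * E \<tau> ^ (n - m)))"
  unfolding qm_data_def
proof (intro conjI allI ballI impI)
  have da: "qm_data \<Gamma> k 0 a (\<lambda>m. if m = 0 then a else (\<lambda>_. 0))" using a unfolding modular_iff .
  hence ah: "a holomorphic_on uhp" and a0: "\<And>\<tau>. \<tau> \<notin> uhp \<Longrightarrow> a \<tau> = 0" by (auto simp: qm_data_def)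
  show "(\<lambda>\<tau>. a \<tau> * E \<tau> ^ n) holomorphic_on uhp" by (intro holomorphic_intros ah E_hol)
  show "(\<lambda>\<tau>. of_nat (n choose m) * kappa ^ m * (a \<tau> * E \<tau> ^ (n - m))) holomorphic_on uhp" for m
    by (intro holomorphic_intros ah E_hol)
  show "a \<tau> * E \<tau> ^ n = 0" if "\<tau> \<notin> uhp" for \<tau> using a0 that by simp
  show "of_nat (n choose m) * kappa ^ m * (a \<tau> * E \<tau> ^ (n - m)) = 0" if "\<tau> \<notin> uhp" for m \<tau> using a0 that by simp
  show "(\<lambda>\<tau>. of_nat (n choose m) * kappa ^ m * (a \<tau> * E \<tau> ^ (n - m))) = (\<lambda>_. 0)" if "n < m" for m
    using that by (simp add: binomial_eq_0)
  fix \<gamma> \<tau> assume g: "\<gamma> \<in> \<Gamma>" and t: "\<tau> \<in> uhp"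
  have "slash (k + int n * 2) \<gamma> (\<lambda>\<tau>. a \<tau> * E \<tau> ^ n) \<tau> = slash k \<gamma> a \<tau> * slash 2 \<gamma> E \<tau> ^ n"
    using G_SL2R[OF g] t by (simp add: slash_mult slash_power)
  also have "\<dots> = a \<tau> * (kappa * Xfac \<gamma> \<tau> + E \<tau>) ^ n"
    using a g t by (simp add: modular_def E_trans add.commute)
  also have "\<dots> = (\<Sum>m\<le>n. Xfac \<gamma> \<tau> ^ m * (of_nat (n choose m) * kappa ^ m * (a \<tau> * E \<tau> ^ (n - m))))"
    unfolding binomial_ring by (simp add: sum_distrib_left power_mult_distrib mult_ac)
  finally show "slash (k + 2 * int n) \<gamma> (\<lambda>\<tau>. a \<tau> * E \<tau> ^ n) \<tau> =
      (\<Sum>m\<le>n. Xfac \<gamma> \<tau> ^ m * (of_nat (n choose m) * kappa ^ m * (a \<tau> * E \<tau> ^ (n - m))))"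
    by (simp add: mult.commute)
next
  fix \<sigma> m assume s: "\<sigma> \<in> SL2R" "at_cusp \<sigma>"
  show "bounded_at_i_infinity (slash (k + 2 * int n - 2 * int m) \<sigma> (\<lambda>\<tau>. of_nat (n choose m) * kappa ^ m * (a \<tau> * E \<tau> ^ (n - m))))"
  proof (cases "m \<le> n")
    case False thus ?thesis by (simp add: binomial_eq_0)
  next
    case True
    have da: "qm_data \<Gamma> k 0 a (\<lambda>m. if m = 0 then a else (\<lambda>_. 0))" using a unfolding modular_iff .
    have "bounded_at_i_infinity (slash (k - 2 * int 0) \<sigma> (if (0::nat) = 0 then a else (\<lambda>_. 0)))"
      using da s unfolding qm_data_def by blast
    hence ba: "bounded_at_i_infinity (slash k \<sigma> a)" by simp
    have eq: "k + 2 * int n - 2 * int m = k + int (n - m) * 2" using True by simp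
    have "bounded_at_i_infinity (\<lambda>\<tau>. of_nat (n choose m) * kappa ^ m * (slash k \<sigma> a \<tau> * slash 2 \<sigma> E \<tau> ^ (n - m)))"
      using ba E_cusp[OF s]
      by (intro bounded_at_i_infinity_mult[of "\<lambda>_. of_nat (n choose m) * kappa ^ m"] bounded_at_i_infinity_mult[of "slash k \<sigma> a"]
          bounded_at_i_infinity_power bounded_at_i_infinity_const) auto
    thus ?thesis
    proof (rule bounded_at_i_infinity_cong[rotated])
      fix \<tau> assume t: "\<tau> \<in> uhp"
      show "of_nat (n choose m) * kappa ^ m * (slash k \<sigma> a \<tau> * slash 2 \<sigma> E \<tau> ^ (n - m)) =
          slash (k + 2 * int n - 2 * int m) \<sigma> (\<lambda>\<tau>. of_nat (n choose m) * kappa ^ m * (a \<tau> * E \<tau> ^ (n - m))) \<tau>"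
        unfolding eq slash_scale slash_mult[OF s(1) t] slash_power[OF s(1) t] ..
    qed
  qed
qed

text \<open>
Induction on the depth: \<open>Q\<^sub>n\<close> is modular for the depth \<open>n\<close>, and \<open>\<kappa>\<^sup>-\<^sup>n Q\<^sub>n E\<^sup>n\<close> has the same top coefficient as \<open>f\<close>.
\<close>

lemma quasimodular_polynomial_in_E:
  assumes "qm_data \<Gamma> k s f Q"
  shows "\<exists>a. (\<forall>i\<le>s. a i \<in> modular \<Gamma> (k - 2 * int i)) \<and> f = (\<lambda>\<tau>. \<Sum>i\<le>s. a i \<tau> * E \<tau> ^ i)"
  using assms
proof (induction s arbitrary: f Q)
  case 0
  have "qm_data \<Gamma> k 0 f (\<lambda>m. if m = 0 then f else (\<lambda>_. 0))"
  proof -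
    have "Q = (\<lambda>m. if m = 0 then f else (\<lambda>_. 0))"
      using 0 qm_data_Q0[OF 0] by (auto simp: qm_data_def fun_eq_iff)
    thus ?thesis using 0 by simp
  qed
  hence "f \<in> modular \<Gamma> k" unfolding modular_iff .
  thus ?case by (intro exI[of _ "\<lambda>_. f"]) auto
next
  case (Suc s)
  define n where "n = Suc s"
  have d: "qm_data \<Gamma> k n f Q" using Suc.prems by (simp add: n_def)
  have "qm_data \<Gamma> (k - 2 * int n) 0 (Q n) (\<lambda>m. if m = 0 then Q n else (\<lambda>_. 0))"
    using d top_coefficient_modular[OF d] unfolding qm_data_def by auto
  hence Qn: "Q n \<in> modular \<Gamma> (k - 2 * int n)" unfolding modular_iff .
  define g where "g = (\<lambda>\<tau>. - inverse (kappa ^ n) * Q n \<tau>)"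
  have g: "g \<in> modular \<Gamma> (k - 2 * int n)" unfolding g_def by (rule modular_scale[OF Qn])
  define R where "R m \<tau> = Q m \<tau> + of_nat (n choose m) * kappa ^ m * (g \<tau> * E \<tau> ^ (n - m))" for m \<tau>
  have dR: "qm_data \<Gamma> k n (\<lambda>\<tau>. f \<tau> + g \<tau> * E \<tau> ^ n) R"
    using qm_data_add[OF d qm_data_modular_times_power[OF g, of n, simplified]] unfolding R_def .
  have "R n = (\<lambda>_. 0)" by (auto simp: R_def g_def kappa_nz)
  moreover have "R m = (\<lambda>_. 0)" if "m > n" for m using dR that by (simp add: qm_data_def)
  ultimately have R0: "R m = (\<lambda>_. 0)" if "m > s" for m using that by (cases "m = n") (auto simp: n_def)
  have "(\<Sum>m\<le>n. Xfac \<gamma> \<tau> ^ m * R m \<tau>) = (\<Sum>m\<le>s. Xfac \<gamma> \<tau> ^ m * R m \<tau>)" for \<gamma> \<tau>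
    by (rule sum_atMost_extend[symmetric]) (auto simp: n_def R0)
  hence "qm_data \<Gamma> k s (\<lambda>\<tau>. f \<tau> + g \<tau> * E \<tau> ^ n) R"
    using dR R0 unfolding qm_data_def by simp
  then obtain a where a: "\<And>i. i \<le> s \<Longrightarrow> a i \<in> modular \<Gamma> (k - 2 * int i)"
      "(\<lambda>\<tau>. f \<tau> + g \<tau> * E \<tau> ^ n) = (\<lambda>\<tau>. \<Sum>i\<le>s. a i \<tau> * E \<tau> ^ i)"
    using Suc.IH by blast
  define a' where "a' i = (if i \<le> s then a i else (\<lambda>\<tau>. - 1 * g \<tau>))" for i
  have "a' i \<in> modular \<Gamma> (k - 2 * int i)" if "i \<le> Suc s" for i
  proof (cases "i \<le> s")
    case True thus ?thesis using a(1) by (simp add: a'_def)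
  next
    case False
    hence "i = n" using that by (simp add: n_def)
    moreover have "a' n = (\<lambda>\<tau>. - 1 * g \<tau>)" by (simp add: a'_def n_def)
    ultimately show ?thesis using modular_scale[OF g, of "-1"] by simp
  qed
  moreover have "f \<tau> = (\<Sum>i\<le>Suc s. a' i \<tau> * E \<tau> ^ i)" for \<tau>
  proof -
    have "f \<tau> + g \<tau> * E \<tau> ^ n = (\<Sum>i\<le>s. a' i \<tau> * E \<tau> ^ i)"
      using fun_cong[OF a(2), of \<tau>] by (simp add: a'_def)
    thus ?thesis by (simp add: a'_def n_def algebra_simps)
  qed
  ultimately show ?case by blast
qed

text \<open>
All the modular coefficients of the polynomial in \<open>E\<close> have negative weight as well.
\<close>

lemma quasimodular_negative: "f \<in> quasimodular \<Gamma> k \<Longrightarrow> k < 0 \<Longrightarrow> f = (\<lambda>_. 0)"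
proof -
  assume f: "f \<in> quasimodular \<Gamma> k" and k: "k < 0"
  then obtain s Q where "qm_data \<Gamma> k s f Q" using quasimodular_iff[OF G_sub] by blast
  then obtain a where a: "\<And>i. i \<le> s \<Longrightarrow> a i \<in> modular \<Gamma> (k - 2 * int i)" "f = (\<lambda>\<tau>. \<Sum>i\<le>s. a i \<tau> * E \<tau> ^ i)"
    using quasimodular_polynomial_in_E by blast
  have "a i = (\<lambda>_. 0)" if "i \<le> s" for i using modular_negative[OF a(1)[OF that]] k by simp
  thus ?thesis using a(2) by simp
qed

lemma quasimodular_in_ring: "f \<in> quasimodular \<Gamma> k \<Longrightarrow> f \<in> quasimodular_ring \<Gamma>"
  unfolding quasimodular_ring_def using quasimodular_negative[of f k] weight_sum_zero
  by (cases "k < 0") (auto intro: weight_sum_single)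

lemma modular_ring_outside: "f \<in> modular_ring \<Gamma> \<Longrightarrow> \<tau> \<notin> uhp \<Longrightarrow> f \<tau> = 0"
  unfolding modular_ring_def weight_sum_def modular_def quasimodular_def by auto

lemma quasimodular_ring_sum:
  "(\<And>i. i \<in> I \<Longrightarrow> f i \<in> quasimodular_ring \<Gamma>) \<Longrightarrow> (\<lambda>\<tau>. \<Sum>i\<in>I. f i \<tau>) \<in> quasimodular_ring \<Gamma>"
  unfolding quasimodular_ring_def
  by (rule weight_sum_sum) (auto intro: quasimodular_zero[OF G_sub] quasimodular_add[OF G_sub])

lemma quasimodular_ring_scale:
  assumes "f \<in> quasimodular_ring \<Gamma>" shows "(\<lambda>\<tau>. c * f \<tau>) \<in> quasimodular_ring \<Gamma>"
proof -
  obtain S g where *: "finite S" "S \<subseteq> {0..}" "\<And>k. k \<in> S \<Longrightarrow> g k \<in> quasimodular \<Gamma> k" "f = (\<lambda>\<tau>. \<Sum>k\<in>S. g k \<tau>)"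
    using assms unfolding quasimodular_ring_def weight_sum_def by blast
  have "(\<lambda>\<tau>. \<Sum>k\<in>S. c * g k \<tau>) \<in> quasimodular_ring \<Gamma>"
    using * by (intro quasimodular_ring_sum quasimodular_in_ring quasimodular_scale[OF G_sub]) auto
  thus ?thesis unfolding *(4) by (simp add: sum_distrib_left)
qed

text \<open>
\<open>f \<mapsto> Q\<^sub>1(f)\<close> acts on polynomials in \<open>E\<close> as \<open>\<kappa> \<partial>/\<partial>E\<close>. Together with uniqueness of \<open>Q\<^sub>1\<close> this replaces the
transcendence of \<open>E\<close> over the modular forms: the derivative does not depend on the polynomial chosen for \<open>f\<close>.
\<close>

lemma xcoeff_polynomial:
  assumes "\<And>i. i \<le> n \<Longrightarrow> a i \<in> modular_ring \<Gamma>"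
  shows "xcoeff \<Gamma> (\<lambda>\<tau>. \<Sum>i\<le>n. a i \<tau> * E \<tau> ^ i) (\<lambda>\<tau>. kappa * (\<Sum>i\<le>n. of_nat i * a i \<tau> * E \<tau> ^ (i - 1)))"
  unfolding sum_distrib_left
proof (rule xcoeff_sum)
  fix i :: nat assume "i \<in> {..n}"
  then obtain S g where *: "finite S" "\<And>k. k \<in> S \<Longrightarrow> g k \<in> modular \<Gamma> k" "a i = (\<lambda>\<tau>. \<Sum>k\<in>S. g k \<tau>)"
    using assms[of i] unfolding modular_ring_def weight_sum_def by blast
  have "xcoeff \<Gamma> (\<lambda>\<tau>. g k \<tau> * E \<tau> ^ i) (\<lambda>\<tau>. of_nat (i choose 1) * kappa ^ 1 * (g k \<tau> * E \<tau> ^ (i - 1)))"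
    if k: "k \<in> S" for k
    using xcoeff_qm_data[OF qm_data_modular_times_power[OF *(2)[OF k], of i]] .
  hence "xcoeff \<Gamma> (\<lambda>\<tau>. \<Sum>k\<in>S. g k \<tau> * E \<tau> ^ i) (\<lambda>\<tau>. \<Sum>k\<in>S. of_nat (i choose 1) * kappa ^ 1 * (g k \<tau> * E \<tau> ^ (i - 1)))"
    by (rule xcoeff_sum)
  thus "xcoeff \<Gamma> (\<lambda>\<tau>. a i \<tau> * E \<tau> ^ i) (\<lambda>\<tau>. kappa * (of_nat i * a i \<tau> * E \<tau> ^ (i - 1)))"
    unfolding *(3) by (simp add: sum_distrib_left sum_distrib_right mult_ac)
qed

definition E_polynomial :: "(complex \<Rightarrow> complex) \<Rightarrow> bool" where
  "E_polynomial f \<longleftrightarrow> (\<exists>n a. (\<forall>i\<le>n. a i \<in> modular_ring \<Gamma>) \<and> f = (\<lambda>\<tau>. \<Sum>i\<le>(n::nat). a i \<tau> * E \<tau> ^ i))"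

lemma E_polynomial_add:
  assumes "E_polynomial f" "E_polynomial g" shows "E_polynomial (\<lambda>\<tau>. f \<tau> + g \<tau>)"
proof -
  obtain n a where f: "\<And>i. i \<le> n \<Longrightarrow> a i \<in> modular_ring \<Gamma>" "f = (\<lambda>\<tau>. \<Sum>i\<le>(n::nat). a i \<tau> * E \<tau> ^ i)"
    using assms(1) unfolding E_polynomial_def by blast
  obtain m b where g: "\<And>i. i \<le> m \<Longrightarrow> b i \<in> modular_ring \<Gamma>" "g = (\<lambda>\<tau>. \<Sum>i\<le>(m::nat). b i \<tau> * E \<tau> ^ i)"
    using assms(2) unfolding E_polynomial_def by blast
  define a' where "a' i = (if i \<le> n then a i else (\<lambda>_. 0))" for i
  define b' where "b' i = (if i \<le> m then b i else (\<lambda>_. 0))" for i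
  have z: "(\<lambda>_. 0) \<in> modular_ring \<Gamma>" unfolding modular_ring_def by (rule weight_sum_zero)
  have ab: "a' i \<in> modular_ring \<Gamma>" "b' i \<in> modular_ring \<Gamma>" for i using f(1) g(1) z by (auto simp: a'_def b'_def)
  have "(\<lambda>\<tau>. a' i \<tau> + b' i \<tau>) \<in> modular_ring \<Gamma>" for i
    using ab[of i] unfolding modular_ring_def
    by (intro weight_sum_add) (auto intro: modular_zero modular_add)
  moreover have "f \<tau> = (\<Sum>i\<le>max n m. a' i \<tau> * E \<tau> ^ i)" for \<tau>
  proof -
    have "f \<tau> = (\<Sum>i\<le>n. a' i \<tau> * E \<tau> ^ i)" by (simp add: f(2) a'_def)
    also have "\<dots> = (\<Sum>i\<le>max n m. a' i \<tau> * E \<tau> ^ i)" by (rule sum_atMost_extend) (auto simp: a'_def)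
    finally show ?thesis .
  qed
  moreover have "g \<tau> = (\<Sum>i\<le>max n m. b' i \<tau> * E \<tau> ^ i)" for \<tau>
  proof -
    have "g \<tau> = (\<Sum>i\<le>m. b' i \<tau> * E \<tau> ^ i)" by (simp add: g(2) b'_def)
    also have "\<dots> = (\<Sum>i\<le>max n m. b' i \<tau> * E \<tau> ^ i)" by (rule sum_atMost_extend) (auto simp: b'_def)
    finally show ?thesis .
  qed
  ultimately show ?thesis unfolding E_polynomial_def
    by (intro exI[of _ "max n m"] exI[of _ "\<lambda>i \<tau>. a' i \<tau> + b' i \<tau>"]) (simp add: sum.distrib algebra_simps fun_eq_iff)
qed

lemma quasimodular_ring_polynomial:
  assumes "f \<in> quasimodular_ring \<Gamma>" shows "E_polynomial f"
proof -
  obtain S g where *: "finite S" "\<And>k. k \<in> S \<Longrightarrow> g k \<in> quasimodular \<Gamma> k" "f = (\<lambda>\<tau>. \<Sum>k\<in>S. g k \<tau>)"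
    using assms unfolding quasimodular_ring_def weight_sum_def by blast
  have hom: "E_polynomial (g k)" if k: "k \<in> S" for k
  proof -
    obtain s Q where "qm_data \<Gamma> k s (g k) Q" using *(2)[OF k] quasimodular_iff[OF G_sub] by blast
    then obtain a where "\<forall>i\<le>s. a i \<in> modular \<Gamma> (k - 2 * int i)" "g k = (\<lambda>\<tau>. \<Sum>i\<le>s. a i \<tau> * E \<tau> ^ i)"
      using quasimodular_polynomial_in_E by blast
    thus ?thesis unfolding E_polynomial_def using modular_in_ring
      by (intro exI[of _ s] exI[of _ a]) auto
  qed
  have z: "E_polynomial (\<lambda>_. 0)" unfolding E_polynomial_def
    by (intro exI[of _ 0] exI[of _ "\<lambda>_ _. 0"]) (auto simp: modular_ring_def weight_sum_zero)
  have "E_polynomial (\<lambda>\<tau>. \<Sum>k\<in>T. g k \<tau>)" if "finite T" "T \<subseteq> S" for T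
    using that by (induction T rule: finite_induct) (auto intro: E_polynomial_add z hom)
  thus ?thesis unfolding *(3) using *(1) by blast
qed

lemma deriv_E2_value:
  assumes "f \<in> quasimodular_ring \<Gamma>"
  shows deriv_E2_xcoeff: "xcoeff \<Gamma> f (\<lambda>\<tau>. kappa * deriv_E2 \<Gamma> E f \<tau>)"
    and deriv_E2_outside: "\<tau> \<notin> uhp \<Longrightarrow> deriv_E2 \<Gamma> E f \<tau> = 0"
proof -
  define P where "P g \<longleftrightarrow> (\<exists>(n::nat) a. (\<forall>i\<le>n. a i \<in> modular_ring \<Gamma>) \<and>
     f = (\<lambda>\<tau>. \<Sum>i\<le>n. a i \<tau> * E \<tau> ^ i) \<and>
     g = (\<lambda>\<tau>. \<Sum>i\<le>n. of_nat i * a i \<tau> * E \<tau> ^ (i - 1)))" for g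
  have P: "xcoeff \<Gamma> f (\<lambda>\<tau>. kappa * g \<tau>) \<and> (\<forall>\<tau>. \<tau> \<notin> uhp \<longrightarrow> g \<tau> = 0)" if Pg: "P g" for g
  proof -
    obtain n a where *: "\<And>i. i \<le> n \<Longrightarrow> a i \<in> modular_ring \<Gamma>" "f = (\<lambda>\<tau>. \<Sum>i\<le>(n::nat). a i \<tau> * E \<tau> ^ i)"
      "g = (\<lambda>\<tau>. \<Sum>i\<le>n. of_nat i * a i \<tau> * E \<tau> ^ (i - 1))" using Pg unfolding P_def by blast
    have "g \<tau> = 0" if "\<tau> \<notin> uhp" for \<tau>
      unfolding *(3) using modular_ring_outside[OF *(1) that] by (intro sum.neutral) simp
    thus ?thesis unfolding *(2,3) using xcoeff_polynomial[of n a] *(1) by blast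
  qed
  obtain n a where "\<forall>i\<le>n. a i \<in> modular_ring \<Gamma>" "f = (\<lambda>\<tau>. \<Sum>i\<le>(n::nat). a i \<tau> * E \<tau> ^ i)"
    using quasimodular_ring_polynomial[OF assms] unfolding E_polynomial_def by blast
  hence ex: "P (\<lambda>\<tau>. \<Sum>i\<le>n. of_nat i * a i \<tau> * E \<tau> ^ (i - 1))" unfolding P_def by blast
  have uniq: "g = g'" if Pgg: "P g" "P g'" for g g'
  proof
    fix \<tau> show "g \<tau> = g' \<tau>"
    proof (cases "\<tau> \<in> uhp")
      case True
      have "kappa * g \<tau> = kappa * g' \<tau>" using P Pgg by (intro xcoeff_unique[OF _ _ True]) auto
      thus ?thesis using kappa_nz by simp
    qed (use P[OF Pgg(1)] P[OF Pgg(2)] in auto)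
  qed
  have "P (THE g. P g)" by (rule theI[of P, OF ex uniq[OF _ ex]])
  moreover have "deriv_E2 \<Gamma> E f = (THE g. P g)" unfolding deriv_E2_def P_def ..
  ultimately have "P (deriv_E2 \<Gamma> E f)" by simp
  from P[OF this] show "xcoeff \<Gamma> f (\<lambda>\<tau>. kappa * deriv_E2 \<Gamma> E f \<tau>)" "\<tau> \<notin> uhp \<Longrightarrow> deriv_E2 \<Gamma> E f \<tau> = 0"
    by auto
qed

end


section \<open>Graded components\<close>

lemma vector_space_complex: "vector_space ((*) :: complex \<Rightarrow> complex \<Rightarrow> complex)"
  by (unfold_locales) (auto simp: algebra_simps)

context quasi_voa
begin

sublocale vs: vector_space "vscale V" by (rule vector_space_V)

abbreviation sc (infixr "\<odot>" 75) where "sc \<equiv> vscale V"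

lemma vfunctional_iff:
  "vfunctional V \<phi> \<longleftrightarrow> (\<forall>x y. \<phi> (x + y) = \<phi> x + \<phi> y) \<and> (\<forall>c x. \<phi> (c \<odot> x) = c * \<phi> x)"
  using vector_space_V vector_space_complex by (simp add: Vector_Spaces.linear_iff)

lemma vlinear_iff:
  "vlinear_op V A \<longleftrightarrow> (\<forall>x y. A (x + y) = A x + A y) \<and> (\<forall>c x. A (c \<odot> x) = c \<odot> A x)"
  using vector_space_V by (simp add: Vector_Spaces.linear_iff)

lemma vfunctional_sum: "vfunctional V \<phi> \<Longrightarrow> \<phi> (\<Sum>i\<in>I. f i) = (\<Sum>i\<in>I. \<phi> (f i))"
  and vfunctional_add: "vfunctional V \<phi> \<Longrightarrow> \<phi> (x + y) = \<phi> x + \<phi> y"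
  and vfunctional_scale: "vfunctional V \<phi> \<Longrightarrow> \<phi> (c \<odot> x) = c * \<phi> x"
  and vfunctional_zero: "vfunctional V \<phi> \<Longrightarrow> \<phi> 0 = 0"
proof -
  assume p: "vfunctional V \<phi>"
  show a: "\<phi> (x + y) = \<phi> x + \<phi> y" for x y using p by (simp add: vfunctional_iff)
  show "\<phi> (c \<odot> x) = c * \<phi> x" using p by (simp add: vfunctional_iff)
  show z: "\<phi> 0 = 0" using a[of 0 0] by simp
  show "\<phi> (\<Sum>i\<in>I. f i) = (\<Sum>i\<in>I. \<phi> (f i))"
    by (induction I rule: infinite_finite_induct) (auto simp: a z)
qed

lemma vlinear_sum: "vlinear_op V A \<Longrightarrow> A (\<Sum>i\<in>I. f i) = (\<Sum>i\<in>I. A (f i))"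
  and vlinear_add: "vlinear_op V A \<Longrightarrow> A (x + y) = A x + A y"
  and vlinear_scale: "vlinear_op V A \<Longrightarrow> A (c \<odot> x) = c \<odot> A x"
  and vlinear_zero: "vlinear_op V A \<Longrightarrow> A 0 = 0"
proof -
  assume p: "vlinear_op V A"
  show a: "A (x + y) = A x + A y" for x y using p by (simp add: vlinear_iff)
  show "A (c \<odot> x) = c \<odot> A x" using p by (simp add: vlinear_iff)
  show z: "A 0 = 0" using a[of 0 0] by simp
  show "A (\<Sum>i\<in>I. f i) = (\<Sum>i\<in>I. A (f i))"
    by (induction I rule: infinite_finite_induct) (auto simp: a z)
qed

lemma vlinear_pow: "vlinear_op V A \<Longrightarrow> vlinear_op V (A ^^ n)"
  by (induction n) (auto simp: vlinear_iff)

lemma vfunctional_comp: "vfunctional V \<phi> \<Longrightarrow> vlinear_op V A \<Longrightarrow> vfunctional V (\<lambda>v. \<phi> (A v))"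
  by (auto simp: vfunctional_iff vlinear_iff)

lemma vcomp_decomp: "homogeneous_decomp V v (vcomp V v)"
  unfolding vcomp_def by (rule theI'[OF grade_direct_sum])

lemma vcomp_finite: "finite {n. vcomp V v n \<noteq> 0}"
  and vcomp_grade: "vcomp V v n \<in> vgrade V n"
  and vcomp_sum: "Sum_any (vcomp V v) = v"
  using vcomp_decomp[of v] by (auto simp: homogeneous_decomp_def)

lemma vcomp_eqI:
  assumes "finite {n. x n \<noteq> 0}" "\<And>n. x n \<in> vgrade V n" "v = Sum_any x"
  shows "vcomp V v = x"
proof -
  have "homogeneous_decomp V v x" using assms by (simp add: homogeneous_decomp_def)
  thus ?thesis using vcomp_decomp[of v] grade_direct_sum[of v] by blast
qed

lemma vcomp_add: "vcomp V (u + v) n = vcomp V u n + vcomp V v n"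
proof -
  have "vcomp V (u + v) = (\<lambda>n. vcomp V u n + vcomp V v n)"
  proof (rule vcomp_eqI)
    show "finite {n. vcomp V u n + vcomp V v n \<noteq> 0}"
      by (rule finite_subset[OF _ finite_UnI[OF vcomp_finite[of u] vcomp_finite[of v]]]) auto
    show "vcomp V u n + vcomp V v n \<in> vgrade V n" for n
      by (intro vs.subspace_add grade_subspace vcomp_grade)
    show "u + v = Sum_any (\<lambda>n. vcomp V u n + vcomp V v n)"
      by (simp add: Sum_any.distrib vcomp_finite vcomp_sum)
  qed
  thus ?thesis by simp
qed

lemma Sum_any_scale:
  assumes "finite {n. x n \<noteq> 0}" shows "Sum_any (\<lambda>n. c \<odot> x n) = c \<odot> Sum_any x"
proof -
  have "Sum_any (\<lambda>n. c \<odot> x n) = (\<Sum>n\<in>{n. x n \<noteq> 0}. c \<odot> x n)"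
    by (rule Sum_any.expand_superset) (use assms in auto)
  thus ?thesis by (simp add: Sum_any.expand_set vs.scale_sum_right)
qed

lemma vcomp_scale: "vcomp V (c \<odot> v) n = c \<odot> vcomp V v n"
proof -
  have "vcomp V (c \<odot> v) = (\<lambda>n. c \<odot> vcomp V v n)"
  proof (rule vcomp_eqI)
    show "finite {n. c \<odot> vcomp V v n \<noteq> 0}"
      by (rule finite_subset[OF _ vcomp_finite[of v]]) auto
    show "c \<odot> vcomp V v n \<in> vgrade V n" for n
      by (intro vs.subspace_scale grade_subspace vcomp_grade)
    show "c \<odot> v = Sum_any (\<lambda>n. c \<odot> vcomp V v n)"
      by (simp add: Sum_any_scale vcomp_finite vcomp_sum)
  qed
  thus ?thesis by simp
qed

lemma vcomp_zero: "vcomp V 0 n = 0"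
  using vcomp_scale[of 0 0 n] by simp

lemma vcomp_sum_dist: "vcomp V (\<Sum>i\<in>I. f i) n = (\<Sum>i\<in>I. vcomp V (f i) n)"
  by (induction I rule: infinite_finite_induct) (auto simp: vcomp_add vcomp_zero)

lemma vcomp_homogeneous:
  assumes "v \<in> vgrade V n" shows "vcomp V v m = (if m = n then v else 0)"
proof -
  have "vcomp V v = (\<lambda>m. if m = n then v else 0)"
  proof (rule vcomp_eqI)
    show "finite {m. (if m = n then v else 0) \<noteq> 0}" by (rule finite_subset[of _ "{n}"]) auto
    show "(if m = n then v else 0) \<in> vgrade V m" for m
      using assms vs.subspace_0[OF grade_subspace] by auto
  qed (simp add: Sum_any.delta)
  thus ?thesis by simp
qed

lemma vcomp_ext: "(\<And>n. vcomp V u n = vcomp V v n) \<Longrightarrow> u = v"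
  using vcomp_sum[of u] vcomp_sum[of v] by (metis ext)

lemma vcomp_Sum_any:
  assumes fin: "finite {n. x n \<noteq> 0}" and gr: "\<And>n. x n \<in> vgrade V n"
  shows "vcomp V (Sum_any x) n = x n"
  using vcomp_eqI[OF assms refl] by simp

text \<open>
A degree below which all graded pieces vanish; it makes every sum over degrees a sum over the finite range from
\<open>lowdeg\<close> to the filtration level.
\<close>

definition lowdeg :: int where "lowdeg = (SOME N. \<forall>n<N. vgrade V n = {0})"

lemma lowdeg: "n < lowdeg \<Longrightarrow> vcomp V v n = 0"
proof -
  have "\<forall>n<lowdeg. vgrade V n = {0}" unfolding lowdeg_def using grade_bounded_below by (rule someI_ex)
  moreover assume "n < lowdeg"
  ultimately show ?thesis using vcomp_grade[of v n] by auto
qed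

lemma vfilt_iff: "v \<in> vfilt V N \<longleftrightarrow> (\<forall>n>N. vcomp V v n = 0)"
proof
  have "vfilt V N \<subseteq> {v. \<forall>n>N. vcomp V v n = 0}"
    unfolding vfilt_def
  proof (rule vs.span_minimal)
    show "(\<Union>n\<in>{..N}. vgrade V n) \<subseteq> {v. \<forall>n>N. vcomp V v n = 0}" by (auto simp: vcomp_homogeneous)
    show "vs.subspace {v. \<forall>n>N. vcomp V v n = 0}"
      by (rule vs.subspaceI) (auto simp: vcomp_zero vcomp_add vcomp_scale)
  qed
  thus "v \<in> vfilt V N \<Longrightarrow> \<forall>n>N. vcomp V v n = 0" by blast
next
  assume 0: "\<forall>n>N. vcomp V v n = 0"
  have "vcomp V v n \<in> vfilt V N" for n
  proof (cases "n \<le> N")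
    case True
    thus ?thesis unfolding vfilt_def by (intro vs.span_base) (auto intro: vcomp_grade)
  next
    case False
    thus ?thesis using 0 unfolding vfilt_def by (simp add: vs.span_zero)
  qed
  hence "Sum_any (vcomp V v) \<in> vfilt V N"
    unfolding Sum_any.expand_set vfilt_def by (intro vs.span_sum) auto
  thus "v \<in> vfilt V N" by (simp add: vcomp_sum)
qed

lemma vfilt_zero: "0 \<in> vfilt V N"
  and vfilt_add: "u \<in> vfilt V N \<Longrightarrow> v \<in> vfilt V N \<Longrightarrow> u + v \<in> vfilt V N"
  and vfilt_scale: "v \<in> vfilt V N \<Longrightarrow> c \<odot> v \<in> vfilt V N"
  and vfilt_mono: "v \<in> vfilt V N \<Longrightarrow> N \<le> M \<Longrightarrow> v \<in> vfilt V M"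
  by (auto simp: vfilt_iff vcomp_zero vcomp_add vcomp_scale)

lemma vfilt_sum: "(\<And>i. i \<in> I \<Longrightarrow> f i \<in> vfilt V N) \<Longrightarrow> (\<Sum>i\<in>I. f i) \<in> vfilt V N"
  by (induction I rule: infinite_finite_induct) (auto simp: vfilt_zero vfilt_add)

lemma vfilt_exhaust: "\<exists>N. v \<in> vfilt V N"
proof -
  define N where "N = Max (insert 0 {n. vcomp V v n \<noteq> 0})"
  have "vcomp V v n = 0" if "n > N" for n
  proof (rule ccontr)
    assume "vcomp V v n \<noteq> 0"
    hence "n \<le> N" unfolding N_def using vcomp_finite[of v] by (intro Max_ge) auto
    thus False using that by simp
  qed
  thus ?thesis by (auto simp: vfilt_iff)
qed

lemma vcomp_finite_sum:
  assumes "v \<in> vfilt V N" shows "v = (\<Sum>n\<in>{lowdeg..N}. vcomp V v n)"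
proof -
  have "Sum_any (vcomp V v) = (\<Sum>n\<in>{lowdeg..N}. vcomp V v n)"
    by (rule Sum_any.expand_superset) (use assms lowdeg in \<open>auto simp: vfilt_iff not_less[symmetric]\<close>)
  thus ?thesis by (simp add: vcomp_sum)
qed

abbreviation L1 where "L1 \<equiv> vL V 1"

lemma L1_linear: "vlinear_op V L1" and L0_linear: "vlinear_op V (vL V 0)"
  by (auto intro: L_linear)

lemma vcomp_L0: "vcomp V (vL V 0 v) n = of_int n \<odot> vcomp V v n"
proof -
  obtain N where N: "v \<in> vfilt V N" using vfilt_exhaust by blast
  have "vL V 0 v = (\<Sum>m\<in>{lowdeg..N}. vL V 0 (vcomp V v m))"
    by (subst vcomp_finite_sum[OF N]) (rule vlinear_sum[OF L0_linear])
  also have "\<dots> = (\<Sum>m\<in>{lowdeg..N}. of_int m \<odot> vcomp V v m)"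
    by (simp add: L_0[OF vcomp_grade])
  finally have "vcomp V (vL V 0 v) n = (\<Sum>m\<in>{lowdeg..N}. of_int m \<odot> (if n = m then vcomp V v m else 0))"
    by (simp add: vcomp_sum_dist vcomp_scale vcomp_homogeneous[OF vcomp_grade])
  also have "\<dots> = (\<Sum>m\<in>{lowdeg..N}. if n = m then of_int m \<odot> vcomp V v m else 0)"
    by (intro sum.cong) auto
  also have "\<dots> = (if n \<in> {lowdeg..N} then of_int n \<odot> vcomp V v n else 0)"
    by (simp add: sum.delta)
  also have "\<dots> = of_int n \<odot> vcomp V v n"
    using N lowdeg[of n v] by (auto simp: vfilt_iff)
  finally show ?thesis .
qed

text \<open>
From \<open>[L(1),L(0)] = L(1)\<close>, \<open>L(1) v\<close> is an eigenvector of \<open>L(0)\<close> with eigenvalue \<open>n - 1\<close>, and \<open>L(0)\<close> determines the degree.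
\<close>

lemma L1_grade:
  assumes "v \<in> vgrade V n" shows "L1 v \<in> vgrade V (n - 1)"
proof -
  have "L1 (vL V 0 v) - vL V 0 (L1 v) = L1 v" using L_bracket[of 1 0 v] by simp
  hence "vL V 0 (L1 v) = of_int n \<odot> L1 v - L1 v"
    using L_0[OF assms] vlinear_scale[OF L1_linear] by (simp add: algebra_simps)
  also have "\<dots> = of_int (n - 1) \<odot> L1 v"
    using vs.scale_left_diff_distrib[of "of_int n" 1 "L1 v"] by simp
  finally have e: "vL V 0 (L1 v) = of_int (n - 1) \<odot> L1 v" .
  have "vcomp V (L1 v) m = 0" if "m \<noteq> n - 1" for m
  proof -
    have "of_int m \<odot> vcomp V (L1 v) m = of_int (n - 1) \<odot> vcomp V (L1 v) m"
      using arg_cong[OF e, of "\<lambda>u. vcomp V u m"] by (simp only: vcomp_L0 vcomp_scale)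
    thus ?thesis using that by (metis of_int_eq_iff vs.scale_right_imp_eq)
  qed
  hence "Sum_any (vcomp V (L1 v)) = (\<Sum>m\<in>{n-1}. vcomp V (L1 v) m)"
    by (intro Sum_any.expand_superset) auto
  hence "L1 v = vcomp V (L1 v) (n - 1)" by (simp add: vcomp_sum)
  thus ?thesis using vcomp_grade[of "L1 v" "n - 1"] by simp
qed

lemma vcomp_L1: "vcomp V (L1 v) n = L1 (vcomp V v (n + 1))"
proof -
  obtain N where N: "v \<in> vfilt V N" using vfilt_exhaust by blast
  have "L1 v = (\<Sum>m\<in>{lowdeg..N}. L1 (vcomp V v m))"
    by (subst vcomp_finite_sum[OF N]) (rule vlinear_sum[OF L1_linear])
  hence "vcomp V (L1 v) n = (\<Sum>m\<in>{lowdeg..N}. if n = m - 1 then L1 (vcomp V v m) else 0)"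
    by (simp add: vcomp_sum_dist vcomp_homogeneous[OF L1_grade[OF vcomp_grade]])
  also have "\<dots> = (\<Sum>m\<in>{lowdeg..N}. if n + 1 = m then L1 (vcomp V v m) else 0)"
    by (intro sum.cong) auto
  also have "\<dots> = (if n + 1 \<in> {lowdeg..N} then L1 (vcomp V v (n + 1)) else 0)" by (simp add: sum.delta)
  also have "\<dots> = L1 (vcomp V v (n + 1))"
    using N lowdeg[of "n + 1" v] by (auto simp: vfilt_iff vlinear_zero[OF L1_linear])
  finally show ?thesis .
qed

lemma vcomp_L1_pow: "vcomp V ((L1 ^^ m) v) n = (L1 ^^ m) (vcomp V v (n + int m))"
proof (induction m arbitrary: n)
  case (Suc m)
  show ?case by (simp add: vcomp_L1 Suc algebra_simps)
qed simp

lemma L1_pow_linear: "vlinear_op V (L1 ^^ m)" by (rule vlinear_pow[OF L1_linear])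

lemma L1_pow_vfilt: "v \<in> vfilt V N \<Longrightarrow> (L1 ^^ m) v \<in> vfilt V N"
  by (auto simp: vfilt_iff vcomp_L1_pow vlinear_zero[OF L1_pow_linear])

text \<open>
Uniform on \<open>F\<^sub>N V\<close>, so that \<open>e\<^bsup>tL(1)\<^esup>\<close> is a polynomial in \<open>t\<close> of fixed degree on functions with values in \<open>F\<^sub>N V\<close>.
\<close>

definition nil_bound :: "int \<Rightarrow> nat" where "nil_bound N = nat (N - lowdeg) + 1"

lemma L1_nilpotent:
  assumes "v \<in> vfilt V N" "m \<ge> nil_bound N" shows "(L1 ^^ m) v = 0"
proof (rule vcomp_ext)
  fix n
  show "vcomp V ((L1 ^^ m) v) n = vcomp V 0 n"
  proof (cases "n < lowdeg")
    case True thus ?thesis by (simp only: lowdeg)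
  next
    case False
    hence "n + int m > N" using assms(2) by (simp add: nil_bound_def)
    thus ?thesis using assms(1) by (simp add: vcomp_L1_pow vfilt_iff vlinear_zero[OF L1_pow_linear] vcomp_zero)
  qed
qed

section \<open>The exponentials of L(1) and L(0)\<close>

abbreviation exp_L1 where "exp_L1 t \<equiv> exp_op V t L1"

text \<open>
The operator \<open>z\<^bsup>2L(0)\<^esup>\<close>.
\<close>

abbreviation grade_scale where "grade_scale z \<equiv> L0_power V 2 z"

lemma exp_L1_expand:
  assumes "v \<in> vfilt V N" "M \<ge> nil_bound N" shows "exp_L1 t v = (\<Sum>m\<le>M. (t ^ m / fact m) \<odot> (L1 ^^ m) v)"
  unfolding exp_op_def
proof (rule Sum_any.expand_superset)
  show "{m. (t ^ m / fact m) \<odot> (L1 ^^ m) v \<noteq> 0} \<subseteq> {..M}"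
    using L1_nilpotent[OF assms(1)] assms(2) by (auto simp: not_less[symmetric])
qed simp

lemma exp_L1_linear: "vlinear_op V (exp_L1 t)"
  unfolding vlinear_iff
proof (intro conjI allI)
  fix x y c
  obtain N N' where "x \<in> vfilt V N" "y \<in> vfilt V N'" using vfilt_exhaust by metis
  hence x: "x \<in> vfilt V (max N N')" and y: "y \<in> vfilt V (max N N')" by (auto intro: vfilt_mono)
  show "exp_L1 t (x + y) = exp_L1 t x + exp_L1 t y"
    unfolding exp_L1_expand[OF x order_refl] exp_L1_expand[OF y order_refl] exp_L1_expand[OF vfilt_add[OF x y] order_refl]
    by (simp add: vlinear_add[OF L1_pow_linear] vs.scale_right_distrib sum.distrib)
  show "exp_L1 t (c \<odot> x) = c \<odot> exp_L1 t x"
    unfolding exp_L1_expand[OF x order_refl] exp_L1_expand[OF vfilt_scale[OF x] order_refl]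
    by (simp add: vlinear_scale[OF L1_pow_linear] vs.scale_sum_right mult.commute)
qed

lemma exp_L1_vfilt: "v \<in> vfilt V N \<Longrightarrow> exp_L1 t v \<in> vfilt V N"
  unfolding exp_L1_expand[OF _ order_refl] by (intro vfilt_sum vfilt_scale L1_pow_vfilt)

lemma exp_L1_0: "exp_L1 0 v = v"
proof -
  obtain N where v: "v \<in> vfilt V N" using vfilt_exhaust by blast
  have "exp_L1 0 v = (\<Sum>m\<le>nil_bound N. if m = 0 then v else 0)"
    unfolding exp_L1_expand[OF v order_refl] by (intro sum.cong) auto
  thus ?thesis by simp
qed

lemma exp_L1_add: "exp_L1 s (exp_L1 t v) = exp_L1 (s + t) v"
proof -
  obtain N where v: "v \<in> vfilt V N" using vfilt_exhaust by blast
  define M where "M = nil_bound N"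
  define w where "w r = (L1 ^^ r) v" for r
  define a where "a m = s ^ m / fact m" for m
  define b where "b m = t ^ m / fact m" for m
  have w0: "w r = 0" if "r > M" for r unfolding w_def using L1_nilpotent[OF v] that by (simp add: M_def)
  have e: "exp_L1 t v = (\<Sum>m\<le>M. b m \<odot> w m)"
    using exp_L1_expand[OF v order_refl] unfolding M_def w_def b_def .
  have "exp_L1 s (exp_L1 t v) = (\<Sum>l\<le>M. a l \<odot> (L1 ^^ l) (exp_L1 t v))"
    using exp_L1_expand[OF exp_L1_vfilt[OF v] order_refl] unfolding M_def a_def .
  also have "\<dots> = (\<Sum>l\<le>M. a l \<odot> (L1 ^^ l) (\<Sum>m\<le>M. b m \<odot> w m))"
    unfolding e ..
  also have "\<dots> = (\<Sum>l\<le>M. \<Sum>m\<le>M. (a l * b m) \<odot> w (l + m))"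
    by (simp add: vlinear_sum[OF L1_pow_linear] vlinear_scale[OF L1_pow_linear] vs.scale_sum_right w_def funpow_add)
  also have "\<dots> = (\<Sum>(l,m)\<in>{..M} \<times> {..M}. (a l * b m) \<odot> w (l + m))"
    by (rule sum.cartesian_product)
  also have "\<dots> = (\<Sum>(l,m)\<in>{(l,m). l + m \<le> M}. (a l * b m) \<odot> w (l + m))"
  proof (rule sum.mono_neutral_right)
    show "\<forall>i\<in>{..M} \<times> {..M} - {(l, m). l + m \<le> M}. (case i of (l, m) \<Rightarrow> (a l * b m) \<odot> w (l + m)) = 0"
    proof
      fix i assume "i \<in> {..M} \<times> {..M} - {(l, m). l + m \<le> M}"
      hence "fst i + snd i > M" by auto
      from w0[OF this] show "(case i of (l, m) \<Rightarrow> (a l * b m) \<odot> w (l + m)) = 0" by (simp add: split_def)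
    qed
  qed auto
  also have "\<dots> = (\<Sum>r\<le>M. \<Sum>l\<le>r. (a l * b (r - l)) \<odot> w (l + (r - l)))"
    by (rule sum.triangle_reindex_eq)
  also have "\<dots> = (\<Sum>r\<le>M. (\<Sum>l\<le>r. a l * b (r - l)) \<odot> w r)"
    by (simp add: vs.scale_sum_left)
  also have "\<dots> = (\<Sum>r\<le>M. ((s + t) ^ r / fact r) \<odot> w r)"
  proof (rule sum.cong[OF refl])
    fix r
    have "(s + t) ^ r / fact r = (\<Sum>l\<le>r. of_nat (r choose l) * s ^ l * t ^ (r - l) / fact r)"
      by (simp add: binomial_ring sum_divide_distrib)
    also have "\<dots> = (\<Sum>l\<le>r. a l * b (r - l))"
      by (intro sum.cong) (auto simp: a_def b_def binomial_fact field_simps)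
    finally show "(\<Sum>l\<le>r. a l * b (r - l)) \<odot> w r = ((s + t) ^ r / fact r) \<odot> w r" by simp
  qed
  also have "\<dots> = exp_L1 (s + t) v" unfolding exp_L1_expand[OF v order_refl] M_def w_def ..
  finally show ?thesis .
qed

lemma vcomp_L0_power: "vcomp V (L0_power V e z v) n = z powi (e * n) \<odot> vcomp V v n"
  unfolding L0_power_def
proof (rule vcomp_Sum_any)
  show "finite {n. z powi (e * n) \<odot> vcomp V v n \<noteq> 0}"
    by (rule finite_subset[OF _ vcomp_finite[of v]]) auto
  show "z powi (e * n) \<odot> vcomp V v n \<in> vgrade V n" for n
    by (intro vs.subspace_scale grade_subspace vcomp_grade)
qed

lemma grade_scale_linear: "vlinear_op V (grade_scale z)"
  unfolding vlinear_iff
  by (intro conjI allI; rule vcomp_ext)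
    (simp_all add: vcomp_L0_power vcomp_add vcomp_scale vs.scale_right_distrib mult.commute)

lemma grade_scale_vfilt: "v \<in> vfilt V N \<Longrightarrow> grade_scale z v \<in> vfilt V N"
  by (simp add: vfilt_iff vcomp_L0_power)

lemma grade_scale_mult: "grade_scale z (grade_scale w v) = grade_scale (z * w) v"
  by (rule vcomp_ext) (simp add: vcomp_L0_power power_int_mult_distrib)

lemma grade_scale_1: "grade_scale 1 v = v" by (rule vcomp_ext) (simp add: vcomp_L0_power)

lemma L0_power_neg: "L0_power V (-2) z v = grade_scale (inverse z) v"
  by (rule vcomp_ext) (simp add: vcomp_L0_power power_int_inverse power_int_minus)

lemma grade_scale_L1_pow:
  assumes "z \<noteq> 0" shows "grade_scale z ((L1 ^^ m) v) = inverse (z ^ 2) ^ m \<odot> (L1 ^^ m) (grade_scale z v)"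
proof (rule vcomp_ext)
  fix n
  have "z powi (2 * n) = inverse (z ^ 2) ^ m * z powi (2 * (n + int m))"
  proof -
    have e: "2 * (n + int m) = 2 * n + int (2 * m)" by simp
    have "z powi (2 * (n + int m)) = z powi (2 * n) * z ^ (2 * m)"
      unfolding e power_int_add[OF disjI1[OF assms]] power_int_of_nat ..
    moreover have "inverse (z ^ 2) ^ m * (z ^ 2) ^ m = 1" using assms by (simp flip: power_mult_distrib)
    ultimately show ?thesis unfolding power_mult by (metis mult.left_commute mult.right_neutral)
  qed
  thus "vcomp V (grade_scale z ((L1 ^^ m) v)) n = vcomp V (inverse (z ^ 2) ^ m \<odot> (L1 ^^ m) (grade_scale z v)) n"
    by (simp add: vcomp_L0_power vcomp_L1_pow vcomp_scale vlinear_scale[OF L1_pow_linear])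
qed

text \<open>
\<open>L(1)\<^sup>m\<close> lowers the degree by \<open>m\<close>, so moving \<open>z\<^bsup>2L(0)\<^esup>\<close> past it costs the factor \<open>z\<^bsup>-2m\<^esup>\<close>.
\<close>

lemma grade_scale_exp_L1:
  assumes "z \<noteq> 0" shows "grade_scale z (exp_L1 t v) = exp_L1 (t / z ^ 2) (grade_scale z v)"
proof -
  obtain N where v: "v \<in> vfilt V N" using vfilt_exhaust by blast
  show ?thesis
    unfolding exp_L1_expand[OF v order_refl] exp_L1_expand[OF grade_scale_vfilt[OF v] order_refl]
    by (simp add: vlinear_sum[OF grade_scale_linear] vlinear_scale[OF grade_scale_linear] grade_scale_L1_pow[OF assms] power_divide power_inverse field_simps)
qed

text \<open>
\<open>K = e\<^bsup>-cj L(1)\<^esup> j\<^bsup>-2L(0)\<^esup>\<close>, so \<open>K\<^sup>-\<^sup>1 = j\<^bsup>2L(0)\<^esup> e\<^bsup>cj L(1)\<^esup> = e\<^bsup>(c/j) L(1)\<^esup> j\<^bsup>2L(0)\<^esup>\<close>, and \<open>c/j = X\<close>.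
\<close>

lemma inv_Kop:
  assumes "A \<in> SL2R" "\<tau> \<in> uhp"
  shows "inv (Kop V A \<tau>) = (\<lambda>v. exp_L1 (Xfac A \<tau>) (grade_scale (jfac A \<tau>) v))"
proof -
  define j where "j = jfac A \<tau>"
  define c where "c = complex_of_real (A$2$1)"
  have j: "j \<noteq> 0" unfolding j_def by (rule jfac_nz[OF assms])
  have K: "Kop V A \<tau> v = exp_L1 (- c * j) (grade_scale (inverse j) v)" for v
    by (simp add: Kop_def L0_power_neg j_def c_def)
  have X: "Xfac A \<tau> = c / j" by (simp add: Xfac_def j_def c_def)
  show ?thesis unfolding X j_def[symmetric]
  proof (rule inv_equality)
    fix v
    have "exp_L1 (c / j) (grade_scale j (Kop V A \<tau> v)) = exp_L1 (c / j + - c * j / j ^ 2) (grade_scale (j * inverse j) v)"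
      unfolding K grade_scale_exp_L1[OF j] exp_L1_add grade_scale_mult ..
    also have "c / j + - c * j / j ^ 2 = 0" using j by (simp add: field_simps power2_eq_square)
    finally show "exp_L1 (c / j) (grade_scale j (Kop V A \<tau> v)) = v" using j by (simp add: exp_L1_0 grade_scale_1)
    have "Kop V A \<tau> (exp_L1 (c / j) (grade_scale j v)) = exp_L1 (- c * j + c / j / inverse j ^ 2) (grade_scale (inverse j * j) v)"
      unfolding K using j by (simp add: grade_scale_exp_L1 exp_L1_add grade_scale_mult)
    also have "- c * j + c / j / inverse j ^ 2 = 0" using j by (simp add: field_simps power2_eq_square)
    finally show "Kop V A \<tau> (exp_L1 (c / j) (grade_scale j v)) = v" using j by (simp add: exp_L1_0 grade_scale_1)
  qed
qed

lemma Kop_inv_cancel: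
  assumes "A \<in> SL2R" "\<tau> \<in> uhp"
  shows "Kop V A \<tau> (exp_L1 (Xfac A \<tau>) (grade_scale (jfac A \<tau>) v)) = v"
proof -
  define j where "j = jfac A \<tau>"
  define c where "c = complex_of_real (A$2$1)"
  have j: "j \<noteq> 0" unfolding j_def by (rule jfac_nz[OF assms])
  have "Kop V A \<tau> (exp_L1 (c / j) (grade_scale j v)) = exp_L1 (- c * j + c / j / inverse j ^ 2) (grade_scale (inverse j * j) v)"
    unfolding Kop_def L0_power_neg j_def[symmetric] c_def[symmetric] using j by (simp add: grade_scale_exp_L1 exp_L1_add grade_scale_mult)
  also have "- c * j + c / j / inverse j ^ 2 = 0" using j by (simp add: field_simps power2_eq_square)
  finally show ?thesis using j by (simp add: exp_L1_0 grade_scale_1 Xfac_def j_def c_def)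
qed

section \<open>Homogeneous coordinates\<close>

text \<open>
Coordinates on the finite-dimensional space \<open>F\<^sub>N V\<close> given by a homogeneous basis: an index \<open>(n, b)\<close> stands for the basis
vector \<open>b\<close> of degree \<open>n\<close>. The coordinate functional is defined on all of \<open>V\<close> and sees only the component of degree \<open>n\<close>.
\<close>

definition coordinate_system :: "int \<Rightarrow> (int \<times> 'v) set \<Rightarrow> (int \<times> 'v \<Rightarrow> 'v \<Rightarrow> complex) \<Rightarrow> bool" where
  "coordinate_system N I \<phi> \<longleftrightarrow> finite I \<and>
     (\<forall>i\<in>I. vfunctional V (\<phi> i) \<and> (\<forall>v. \<phi> i v = \<phi> i (vcomp V v (fst i))) \<and> snd i \<in> vfilt V N) \<and>
     (\<forall>v\<in>vfilt V N. v = (\<Sum>i\<in>I. \<phi> i v \<odot> snd i))"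

lemma coordinate_systemD:
  assumes "coordinate_system N I \<phi>"
  shows "finite I" "\<And>i. i \<in> I \<Longrightarrow> vfunctional V (\<phi> i)"
    "\<And>i v. i \<in> I \<Longrightarrow> \<phi> i v = \<phi> i (vcomp V v (fst i))" "\<And>i. i \<in> I \<Longrightarrow> snd i \<in> vfilt V N"
    "\<And>v. v \<in> vfilt V N \<Longrightarrow> v = (\<Sum>i\<in>I. \<phi> i v \<odot> snd i)"
  using assms unfolding coordinate_system_def by blast+

lemma coordinate_system_exists: "\<exists>I \<phi>. coordinate_system N I \<phi>"
proof -
  have "\<exists>B. finite B \<and> B \<subseteq> vgrade V n \<and> vs.independent B \<and> vgrade V n \<subseteq> vs.span B" for n
  proof -
    obtain B where B: "B \<subseteq> vgrade V n" "vs.independent B" "vgrade V n \<subseteq> vs.span B"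
      by (rule vs.maximal_independent_subset)
    obtain B0 where "finite B0" "vgrade V n \<subseteq> vs.span B0" using grade_finite_dim by blast
    hence "finite B" using vs.independent_span_bound[of B0 B] B by blast
    thus ?thesis using B by blast
  qed
  then obtain B where B: "\<And>n. finite (B n)" "\<And>n. B n \<subseteq> vgrade V n" "\<And>n. vs.independent (B n)" "\<And>n. vgrade V n \<subseteq> vs.span (B n)"
    by metis
  define I where "I = (SIGMA n:{lowdeg..N}. B n)"
  define \<phi> where "\<phi> i v = vs.representation (B (fst i)) (vcomp V v (fst i)) (snd i)" for i v
  have sp: "vcomp V v n \<in> vs.span (B n)" for v n using B(4) vcomp_grade by blast
  have "coordinate_system N I \<phi>" unfolding coordinate_system_def
  proof (intro conjI ballI allI)
    show "finite I" unfolding I_def using B(1) by auto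
    fix i
    show "vfunctional V (\<phi> i)"
      by (simp add: vfunctional_iff \<phi>_def vcomp_add vcomp_scale vs.representation_add vs.representation_scale B(3) sp)
    show "\<phi> i v = \<phi> i (vcomp V v (fst i))" for v
      by (simp add: \<phi>_def vcomp_homogeneous[OF vcomp_grade])
    assume i: "i \<in> I"
    show "snd i \<in> vfilt V N"
    proof -
      have "snd i \<in> vgrade V (fst i)" "fst i \<le> N" using i B(2)[of "fst i"] by (auto simp: I_def)
      thus ?thesis by (auto simp: vfilt_iff vcomp_homogeneous)
    qed
  next
    fix v assume v: "v \<in> vfilt V N"
    have "v = (\<Sum>n\<in>{lowdeg..N}. vcomp V v n)" by (rule vcomp_finite_sum[OF v])
    also have "\<dots> = (\<Sum>n\<in>{lowdeg..N}. \<Sum>b\<in>B n. vs.representation (B n) (vcomp V v n) b \<odot> b)"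
      by (intro sum.cong refl vs.sum_representation_eq[symmetric] B sp) auto
    also have "\<dots> = (\<Sum>i\<in>I. \<phi> i v \<odot> snd i)"
      unfolding I_def using B(1) by (subst sum.Sigma) (auto simp: \<phi>_def split_def)
    finally show "v = (\<Sum>i\<in>I. \<phi> i v \<odot> snd i)" .
  qed
  thus ?thesis by blast
qed

text \<open>
The scalar theory applies to homogeneous functionals, because they satisfy \<open>\<phi>(j\<^bsup>2L(0)\<^esup> u) = j\<^bsup>2d\<^esup> \<phi>(u)\<close>. Identities
in \<open>V\<close> can be tested on them because each \<open>F\<^sub>N V\<close> has a homogeneous basis.
\<close>

lemma homogeneous_separate:
  assumes "\<And>\<phi> d. vfunctional V \<phi> \<Longrightarrow> (\<And>w. \<phi> w = \<phi> (vcomp V w d)) \<Longrightarrow> \<phi> u = \<phi> v" shows "u = v"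
proof -
  obtain N N' where "u \<in> vfilt V N" "v \<in> vfilt V N'" using vfilt_exhaust by metis
  hence uv: "u \<in> vfilt V (max N N')" "v \<in> vfilt V (max N N')" by (auto intro: vfilt_mono)
  obtain I \<phi> where cs: "coordinate_system (max N N') I \<phi>" using coordinate_system_exists by blast
  note 1 = coordinate_systemD(2)[OF cs]
    and 2 = coordinate_systemD(5)[OF cs]
    and 3 = coordinate_systemD(3)[OF cs]
  have "u = (\<Sum>i\<in>I. \<phi> i u \<odot> snd i)" by (rule 2[OF uv(1)])
  also have "\<dots> = (\<Sum>i\<in>I. \<phi> i v \<odot> snd i)"
  proof (rule sum.cong[OF refl])
    fix i assume i: "i \<in> I"
    have "\<phi> i u = \<phi> i v" by (rule assms[OF 1[OF i] 3[OF i]])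
    thus "\<phi> i u \<odot> snd i = \<phi> i v \<odot> snd i" by simp
  qed
  also have "\<dots> = v" by (rule 2[OF uv(2), symmetric])
  finally show ?thesis .
qed

lemma vfunctional_separate: "(\<And>\<phi>. vfunctional V \<phi> \<Longrightarrow> \<phi> u = \<phi> v) \<Longrightarrow> u = v"
  using homogeneous_separate by blast

end


section \<open>Vector-valued quasi-modular forms\<close>

lemma sum_rectangle_diagonals:
  fixes F :: "nat \<Rightarrow> nat \<Rightarrow> 'b::comm_monoid_add"
  assumes "\<And>l m. l > M \<or> m > s \<Longrightarrow> F l m = 0"
  shows "(\<Sum>l\<le>M. \<Sum>m\<le>s. F l m) = (\<Sum>r\<le>M + s. \<Sum>l\<le>r. F l (r - l))"
proof -
  have "(\<Sum>l\<le>M. \<Sum>m\<le>s. F l m) = (\<Sum>(l,m)\<in>{..M} \<times> {..s}. F l m)"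
    by (rule sum.cartesian_product)
  also have "\<dots> = (\<Sum>(l,m)\<in>{(l,m). l + m \<le> M + s}. F l m)"
  proof (rule sum.mono_neutral_left)
    show "finite {(l, m). l + m \<le> M + s}"
      by (rule finite_subset[of _ "{..M+s} \<times> {..M+s}"]) auto
    show "\<forall>i\<in>{(l, m). l + m \<le> M + s} - {..M} \<times> {..s}. (case i of (l, m) \<Rightarrow> F l m) = 0"
    proof
      fix i assume "i \<in> {(l, m). l + m \<le> M + s} - {..M} \<times> {..s}"
      hence "fst i > M \<or> snd i > s" by (cases i) auto
      from assms[OF this] show "(case i of (l, m) \<Rightarrow> F l m) = 0" by (simp add: split_def)
    qed
  qed auto
  also have "\<dots> = (\<Sum>r\<le>M + s. \<Sum>l\<le>r. F l (r - l))"
    by (rule sum.triangle_reindex_eq)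
  finally show ?thesis .
qed

context quasi_voa
begin

text \<open>
The linear map \<open>j\<^sup>-\<^sup>k K\<^sup>-\<^sup>1\<close> on \<open>V\<close>, so that \<open>f \<parallel>\<^sub>k A (\<tau>)\<close> is its value at \<open>f(A\<tau>)\<close>.
\<close>

definition weight_act :: "int \<Rightarrow> real^2^2 \<Rightarrow> complex \<Rightarrow> 'v \<Rightarrow> 'v" where
  "weight_act k A \<tau> u = jfac A \<tau> powi (- k) \<odot> exp_L1 (Xfac A \<tau>) (grade_scale (jfac A \<tau>) u)"

lemma vslash_weight_act: "A \<in> SL2R \<Longrightarrow> \<tau> \<in> uhp \<Longrightarrow> vslash V k A f \<tau> = weight_act k A \<tau> (f (moebius A \<tau>))"
  by (simp add: vslash_def inv_Kop weight_act_def)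

lemma weight_act_linear: "vlinear_op V (weight_act k A \<tau>)"
  unfolding vlinear_iff weight_act_def
  by (simp add: vlinear_add[OF exp_L1_linear] vlinear_add[OF grade_scale_linear] vlinear_scale[OF exp_L1_linear]
      vlinear_scale[OF grade_scale_linear] vs.scale_right_distrib mult.commute)

lemma weight_act_vfilt: "u \<in> vfilt V N \<Longrightarrow> weight_act k A \<tau> u \<in> vfilt V N"
  unfolding weight_act_def by (intro vfilt_scale exp_L1_vfilt grade_scale_vfilt)

lemma weight_act_shift: "jfac A \<tau> \<noteq> 0 \<Longrightarrow> jfac A \<tau> powi l \<odot> weight_act k A \<tau> u = weight_act (k - l) A \<tau> u"
  by (simp add: weight_act_def power_int_diff power_int_minus field_simps)

text \<open>
The cocycles of \<open>j\<close> and \<open>X\<close> and the commutation rule for the two exponentials fit together to a right action.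
\<close>

lemma weight_act_mult:
  assumes "A \<in> SL2R" "B \<in> SL2R" "\<tau> \<in> uhp"
  shows "weight_act k (A ** B) \<tau> u = weight_act k B \<tau> (weight_act k A (moebius B \<tau>) u)"
proof -
  have j: "jfac B \<tau> \<noteq> 0" by (rule jfac_nz[OF assms(2,3)])
  show ?thesis
    unfolding weight_act_def Xfac_mult[OF assms] jfac_mult[OF assms(2,3)]
    by (simp add: vlinear_scale[OF exp_L1_linear] vlinear_scale[OF grade_scale_linear] grade_scale_exp_L1[OF j] exp_L1_add grade_scale_mult
        power_int_mult_distrib mult.commute)
qed

lemma vslash_mult:
  assumes "A \<in> SL2R" "B \<in> SL2R" "\<tau> \<in> uhp"
  shows "vslash V k (A ** B) f \<tau> = weight_act k B \<tau> (vslash V k A f (moebius B \<tau>))"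
  using assms by (simp add: vslash_weight_act SL2R_mult moebius_uhp weight_act_mult moebius_mult)

text \<open>
As in \<open>qm_data\<close>; one \<open>N\<close> bounds the degrees of \<open>f\<close> and of all its coefficients.
\<close>

definition vq_data :: "(real^2^2) set \<Rightarrow> int \<Rightarrow> int \<Rightarrow> nat \<Rightarrow> (complex \<Rightarrow> 'v) \<Rightarrow> (nat \<Rightarrow> complex \<Rightarrow> 'v) \<Rightarrow> bool" where
  "vq_data \<Gamma> k N s f Q \<longleftrightarrow> (\<forall>\<tau>. \<tau> \<notin> uhp \<longrightarrow> f \<tau> = 0) \<and> vholomorphic V N f \<and>
     (\<forall>m. vholomorphic V N (Q m)) \<and> (\<forall>m \<tau>. \<tau> \<notin> uhp \<longrightarrow> Q m \<tau> = 0) \<and> (\<forall>m>s. Q m = (\<lambda>_. 0)) \<and>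
     (\<forall>\<gamma>\<in>\<Gamma>. \<forall>\<tau>\<in>uhp. vslash V k \<gamma> f \<tau> = (\<Sum>m\<le>s. Xfac \<gamma> \<tau> ^ m \<odot> Q m \<tau>)) \<and>
     (\<forall>\<sigma>\<in>SL2R. moebius_ext \<sigma> None \<in> cusps \<Gamma> \<longrightarrow>
        (\<forall>m. vbounded_at_i_infinity V (vslash V (k - 2 * int m) \<sigma> (Q m))))"

lemma vholomorphic_zero: "vholomorphic V N (\<lambda>_. 0)"
  by (simp add: vholomorphic_def vfilt_zero vfunctional_zero)

lemma vslash_zero: "A \<in> SL2R \<Longrightarrow> \<tau> \<in> uhp \<Longrightarrow> vslash V k A (\<lambda>_. 0) \<tau> = 0"
  by (simp add: vslash_weight_act vlinear_zero[OF weight_act_linear])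

lemma vbounded_cong:
  assumes "\<And>\<tau>. \<tau> \<in> uhp \<Longrightarrow> f \<tau> = g \<tau>" "vbounded_at_i_infinity V f"
  shows "vbounded_at_i_infinity V g"
  unfolding vbounded_at_i_infinity_def
proof (intro allI impI)
  fix \<phi> assume "vfunctional V \<phi>"
  hence "bounded_at_i_infinity (\<lambda>\<tau>. \<phi> (f \<tau>))" using assms(2) by (simp add: vbounded_at_i_infinity_def)
  thus "bounded_at_i_infinity (\<lambda>\<tau>. \<phi> (g \<tau>))"
    by (rule bounded_at_i_infinity_cong[rotated]) (simp add: assms(1))
qed

lemma vbounded_zero: "vbounded_at_i_infinity V (\<lambda>_. 0)"
  by (simp add: vbounded_at_i_infinity_def vfunctional_zero)

lemma vbounded_vslash_zero: "A \<in> SL2R \<Longrightarrow> vbounded_at_i_infinity V (vslash V k A (\<lambda>_. 0))"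
  by (rule vbounded_cong[OF _ vbounded_zero]) (simp add: vslash_zero)

lemma vquasimodular_iff:
  assumes G: "\<Gamma> \<subseteq> SL2R"
  shows "f \<in> vquasimodular V \<Gamma> k \<longleftrightarrow> (\<exists>N s Q. vq_data \<Gamma> k N s f Q)"
proof
  assume "f \<in> vquasimodular V \<Gamma> k"
  then obtain N s Q where *: "\<forall>\<tau>. \<tau> \<notin> uhp \<longrightarrow> f \<tau> = 0" "vholomorphic V N f" "\<forall>m\<le>s. vholomorphic V N (Q m)"
    "\<forall>\<gamma>\<in>\<Gamma>. \<forall>\<tau>\<in>uhp. vslash V k \<gamma> f \<tau> = (\<Sum>m\<le>s. Xfac \<gamma> \<tau> ^ m \<odot> Q m \<tau>)"
    "\<forall>\<sigma>\<in>SL2R. moebius_ext \<sigma> None \<in> cusps \<Gamma> \<longrightarrow>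
           (\<forall>m\<le>s. vbounded_at_i_infinity V (vslash V (k - 2 * int m) \<sigma> (Q m)))"
    unfolding vquasimodular_def by blast
  define Q' where "Q' m \<tau> = (if m \<le> s \<and> \<tau> \<in> uhp then Q m \<tau> else 0)" for m \<tau>
  have big: "Q' m = (\<lambda>_. 0)" if "\<not> m \<le> s" for m using that by (auto simp: Q'_def)
  have "vholomorphic V N (Q' m)" for m
  proof (cases "m \<le> s")
    case True
    have "vholomorphic V N (Q m)" using *(3) True by blast
    thus ?thesis unfolding vholomorphic_def
      by (auto simp: Q'_def True intro: holomorphic_transform)
  next
    case False
    thus ?thesis using big vholomorphic_zero by simp
  qed
  moreover have "vbounded_at_i_infinity V (vslash V (k - 2 * int m) \<sigma> (Q' m))"
    if s: "\<sigma> \<in> SL2R" "moebius_ext \<sigma> None \<in> cusps \<Gamma>" for \<sigma> m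
  proof (cases "m \<le> s")
    case True
    have eq: "vslash V (k - 2 * int m) \<sigma> (Q m) \<tau> = vslash V (k - 2 * int m) \<sigma> (Q' m) \<tau>" if "\<tau> \<in> uhp" for \<tau>
      using moebius_uhp[OF s(1) that] True by (simp add: vslash_def Q'_def)
    have "vbounded_at_i_infinity V (vslash V (k - 2 * int m) \<sigma> (Q m))" using *(5) s True by blast
    thus ?thesis by (rule vbounded_cong[rotated]) (rule eq)
  next
    case False
    thus ?thesis using big vbounded_vslash_zero[OF s(1)] by simp
  qed
  ultimately have "vq_data \<Gamma> k N s f Q'"
    unfolding vq_data_def using *(1,2,4) by (auto simp: Q'_def fun_eq_iff)
  thus "\<exists>N s Q. vq_data \<Gamma> k N s f Q" by blast
next
  assume "\<exists>N s Q. vq_data \<Gamma> k N s f Q"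
  then obtain N s Q where "vq_data \<Gamma> k N s f Q" by blast
  thus "f \<in> vquasimodular V \<Gamma> k" unfolding vq_data_def vquasimodular_def mem_Collect_eq
    by (intro conjI exI[of _ N] exI[of _ s] exI[of _ Q]) simp_all
qed

lemma vq_data_vfilt:
  assumes "vq_data \<Gamma> k N s f Q" shows "f \<tau> \<in> vfilt V N" "Q m \<tau> \<in> vfilt V N"
  using assms vfilt_zero[of N] unfolding vq_data_def vholomorphic_def by (metis, metis)

lemma vholomorphic_mono: "vholomorphic V N f \<Longrightarrow> N \<le> N' \<Longrightarrow> vholomorphic V N' f"
  unfolding vholomorphic_def using vfilt_mono by blast

lemma vq_data_mono:
  assumes "vq_data \<Gamma> k N s f Q" "s \<le> s'" "N \<le> N'" shows "vq_data \<Gamma> k N' s' f Q"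
proof -
  have "(\<Sum>m\<le>s. Xfac \<gamma> \<tau> ^ m \<odot> Q m \<tau>) = (\<Sum>m\<le>s'. Xfac \<gamma> \<tau> ^ m \<odot> Q m \<tau>)" for \<gamma> \<tau>
    by (rule sum_atMost_extend) (use assms in \<open>auto simp: vq_data_def\<close>)
  moreover have "vholomorphic V N' f" "vholomorphic V N' (Q m)" for m
    using assms by (auto simp: vq_data_def intro: vholomorphic_mono)
  ultimately show ?thesis using assms unfolding vq_data_def by auto
qed

lemma vq_data_zero:
  assumes "\<Gamma> \<subseteq> SL2R" shows "vq_data \<Gamma> k N s (\<lambda>_. 0) (\<lambda>_ _. 0)"
  unfolding vq_data_def using assms
  by (auto simp: vholomorphic_zero vslash_zero vbounded_vslash_zero subset_iff)

text \<open>
Removing \<open>e\<^bsup>X L(1)\<^esup>\<close> from \<open>j\<^sup>-\<^sup>k K\<^sup>-\<^sup>1\<close> leaves \<open>j\<^bsup>2L(0)-k\<^esup>\<close>, which multiplies the part of degree \<open>d + l\<close> by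
\<open>j\<^bsup>2d+2l-k\<^esup>\<close>; \<open>L(1)\<^sup>l\<close> maps this part to degree \<open>d\<close>, where \<open>\<phi>\<close> lives. For \<open>l = 0\<close> this is the weight \<open>k - 2d\<close> of the
coordinate \<open>\<phi>(f)\<close>.
\<close>

lemma coordinate_weight_act:
  assumes "A \<in> SL2R" "\<tau> \<in> uhp" and \<phi>: "vfunctional V \<phi>" and hom: "\<And>w. \<phi> w = \<phi> (vcomp V w d)"
  shows "\<phi> ((L1 ^^ l) (exp_L1 (- Xfac A \<tau>) (weight_act k A \<tau> u))) = jfac A \<tau> powi (- (k - 2 * d - 2 * int l)) * \<phi> ((L1 ^^ l) u)"
proof -
  define j where "j = jfac A \<tau>"
  have j: "j \<noteq> 0" unfolding j_def by (rule jfac_nz[OF assms(1,2)])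
  have PT: "exp_L1 (- Xfac A \<tau>) (weight_act k A \<tau> u) = j powi (- k) \<odot> grade_scale j u"
    by (simp add: weight_act_def vlinear_scale[OF exp_L1_linear] exp_L1_add exp_L1_0 j_def)
  have phiD: "\<phi> (grade_scale j w) = j powi (2 * d) * \<phi> w" for w
    using hom[of "grade_scale j w"] hom[of w] by (simp add: vcomp_L0_power vfunctional_scale[OF \<phi>])
  have "inverse (j ^ 2) ^ l * \<phi> ((L1 ^^ l) (grade_scale j u)) = j powi (2 * d) * \<phi> ((L1 ^^ l) u)"
    using arg_cong[OF grade_scale_L1_pow[OF j, of l u], of \<phi>] by (simp only: phiD vfunctional_scale[OF \<phi>])
  hence "(j ^ 2) ^ l * (inverse (j ^ 2) ^ l * \<phi> ((L1 ^^ l) (grade_scale j u))) = (j ^ 2) ^ l * (j powi (2 * d) * \<phi> ((L1 ^^ l) u))"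
    by (rule arg_cong)
  moreover have "(j ^ 2) ^ l * inverse (j ^ 2) ^ l = 1" using j by (simp flip: power_mult_distrib)
  ultimately have "\<phi> ((L1 ^^ l) (grade_scale j u)) = (j ^ 2) ^ l * (j powi (2 * d) * \<phi> ((L1 ^^ l) u))"
    by (simp only: mult.assoc[symmetric] mult_1)
  moreover have "j powi (- (k - 2 * d - 2 * int l)) = j powi (- k) * ((j ^ 2) ^ l * j powi (2 * d))"
  proof -
    have e: "- (k - 2 * d - 2 * int l) = - k + (int (2 * l) + 2 * d)" by simp
    show ?thesis unfolding e power_int_add[OF disjI1[OF j]] power_int_of_nat power_mult ..
  qed
  ultimately show ?thesis
    by (simp add: PT vlinear_scale[OF L1_pow_linear] vfunctional_scale[OF \<phi>] flip: j_def)
qed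

end

locale voa_forms = fuchsian_E2 \<Gamma> E + quasi_voa V
  for \<Gamma> :: "(real^2^2) set" and E :: "complex \<Rightarrow> complex" and V :: "('v::ab_group_add) qvoa_data"
begin

lemma weight_act_one: "weight_act k (mat 1) \<tau> u = u"
  by (simp add: weight_act_def exp_L1_0 grade_scale_1)

lemma vq_data_Q0:
  assumes "vq_data \<Gamma> k N s f Q" shows "Q 0 = f"
proof
  fix \<tau> show "Q 0 \<tau> = f \<tau>"
  proof (cases "\<tau> \<in> uhp")
    case True
    have "vslash V k (mat 1) f \<tau> = (\<Sum>m\<le>s. Xfac (mat 1) \<tau> ^ m \<odot> Q m \<tau>)"
      using assms G_one True unfolding vq_data_def by blast
    also have "\<dots> = (\<Sum>m\<le>s. if m = 0 then Q 0 \<tau> else 0)" by (intro sum.cong) auto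
    also have "\<dots> = Q 0 \<tau>" by simp
    finally show ?thesis using True by (simp add: vslash_weight_act weight_act_one)
  qed (use assms in \<open>auto simp: vq_data_def\<close>)
qed

text \<open>
The \<open>r\<close>-th coefficient of \<open>e\<^bsup>-X L(1)\<^esup> \<Sum>\<^sub>m X\<^sup>m Q\<^sub>m\<close> as a polynomial in \<open>X\<close>, evaluated by \<open>\<phi>\<close>.
\<close>

abbreviation untwisted :: "('v \<Rightarrow> complex) \<Rightarrow> (nat \<Rightarrow> complex \<Rightarrow> 'v) \<Rightarrow> nat \<Rightarrow> complex \<Rightarrow> complex" where
  "untwisted \<phi> Q r \<tau> \<equiv> \<Sum>l\<le>r. (-1) ^ l / fact l * \<phi> ((L1 ^^ l) (Q (r - l) \<tau>))"

text \<open>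
Apply \<open>\<phi> e\<^bsup>-X L(1)\<^esup>\<close> to \<open>f \<parallel>\<^sub>k \<gamma> = \<Sum>\<^sub>m X\<^sup>m Q\<^sub>m\<close>: the left side becomes \<open>\<phi>(f)|\<^bsub>k-2d\<^esub> \<gamma>\<close>. At a cusp \<open>X\<close> is bounded, so
the bounds for \<open>Q\<^sub>m\<close> give bounds for the new coefficients.
\<close>

lemma coordinate_quasimodular:
  assumes d: "vq_data \<Gamma> k N s f Q" and \<phi>: "vfunctional V \<phi>" and hom: "\<And>w. \<phi> w = \<phi> (vcomp V w d)"
  shows "qm_data \<Gamma> (k - 2 * d) (nil_bound N + s) (\<lambda>\<tau>. \<phi> (f \<tau>))
      (\<lambda>r \<tau>. untwisted \<phi> Q r \<tau>)"
  unfolding qm_data_def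
proof (intro conjI allI ballI impI)
  define M where "M = nil_bound N"
  note fil = vq_data_vfilt[OF d]
  have phiL: "vfunctional V (\<lambda>v. \<phi> ((L1 ^^ l) v))" for l by (rule vfunctional_comp[OF \<phi> L1_pow_linear])
  have zero: "\<phi> ((L1 ^^ l) (Q m \<tau>)) = 0" if "l > M \<or> m > s" for l m \<tau>
  proof (cases "m > s")
    case True
    hence "Q m \<tau> = 0" using d by (simp add: vq_data_def)
    thus ?thesis by (simp add: vlinear_zero[OF L1_pow_linear] vfunctional_zero[OF \<phi>])
  next
    case False
    hence "(L1 ^^ l) (Q m \<tau>) = 0" using that by (intro L1_nilpotent[OF fil(2)]) (simp add: M_def)
    thus ?thesis by (simp add: vfunctional_zero[OF \<phi>])
  qed
  show "(\<lambda>\<tau>. \<phi> (f \<tau>)) holomorphic_on uhp" using d \<phi> by (simp add: vq_data_def vholomorphic_def)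
  have "(\<lambda>\<tau>. \<phi> ((L1 ^^ l) (Q m \<tau>))) holomorphic_on uhp" for l m
    using d phiL[of l] unfolding vq_data_def vholomorphic_def by blast
  thus "(\<lambda>\<tau>. untwisted \<phi> Q r \<tau>) holomorphic_on uhp" for r
    by (intro holomorphic_on_sum holomorphic_on_mult holomorphic_on_const)
  show "\<phi> (f \<tau>) = 0" if "\<tau> \<notin> uhp" for \<tau> using d that by (simp add: vq_data_def vfunctional_zero[OF \<phi>])
  show "untwisted \<phi> Q r \<tau> = 0" if "\<tau> \<notin> uhp" for r \<tau>
    using d that by (simp add: vq_data_def vfunctional_zero[OF \<phi>] vlinear_zero[OF L1_pow_linear])
  show "(\<lambda>\<tau>. untwisted \<phi> Q r \<tau>) = (\<lambda>_. 0)" if r: "nil_bound N + s < r" for r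
  proof
    fix \<tau>
    show "untwisted \<phi> Q r \<tau> = 0"
    proof (rule sum.neutral, rule ballI)
      fix l assume "l \<in> {..r}"
      hence "l > M \<or> r - l > s" using r by (auto simp: M_def)
      from zero[OF this] show "(-1) ^ l / fact l * \<phi> ((L1 ^^ l) (Q (r - l) \<tau>)) = 0" by simp
    qed
  qed
  fix \<gamma> \<tau> assume g: "\<gamma> \<in> \<Gamma>" and t: "\<tau> \<in> uhp"
  define X where "X = Xfac \<gamma> \<tau>"
  have gS: "\<gamma> \<in> SL2R" using G_SL2R g .
  have vsl: "vslash V k \<gamma> f \<tau> = (\<Sum>m\<le>s. X ^ m \<odot> Q m \<tau>)" using d g t unfolding vq_data_def X_def by blast
  have fil2: "(\<Sum>m\<le>s. X ^ m \<odot> Q m \<tau>) \<in> vfilt V N" by (intro vfilt_sum vfilt_scale fil)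
  have "slash (k - 2 * d) \<gamma> (\<lambda>\<tau>. \<phi> (f \<tau>)) \<tau> = \<phi> (exp_L1 (- X) (vslash V k \<gamma> f \<tau>))"
    using coordinate_weight_act[OF gS t \<phi> hom, of 0 k "f (moebius \<gamma> \<tau>)"] by (simp add: slash_def vslash_weight_act gS t X_def)
  also have "\<dots> = \<phi> (\<Sum>l\<le>M. ((- X) ^ l / fact l) \<odot> (L1 ^^ l) (\<Sum>m\<le>s. X ^ m \<odot> Q m \<tau>))"
    unfolding vsl exp_L1_expand[OF fil2 order_refl] M_def ..
  also have "\<dots> = (\<Sum>l\<le>M. \<Sum>m\<le>s. X ^ (l + m) * ((-1) ^ l / fact l * \<phi> ((L1 ^^ l) (Q m \<tau>))))"
    by (simp add: vfunctional_sum[OF \<phi>] vfunctional_scale[OF \<phi>] vlinear_sum[OF L1_pow_linear]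
        vlinear_scale[OF L1_pow_linear] sum_distrib_left power_minus[of X] power_add mult_ac)
  also have "\<dots> = (\<Sum>r\<le>M + s. \<Sum>l\<le>r. X ^ (l + (r - l)) * ((-1) ^ l / fact l * \<phi> ((L1 ^^ l) (Q (r - l) \<tau>))))"
    by (rule sum_rectangle_diagonals) (simp add: zero)
  also have "\<dots> = (\<Sum>r\<le>M + s. X ^ r * untwisted \<phi> Q r \<tau>)"
    by (simp add: sum_distrib_left)
  finally show "slash (k - 2 * d) \<gamma> (\<lambda>\<tau>. \<phi> (f \<tau>)) \<tau> =
      (\<Sum>r\<le>nil_bound N + s. Xfac \<gamma> \<tau> ^ r * untwisted \<phi> Q r \<tau>)"
    by (simp add: X_def M_def)
next
  fix \<sigma> r assume s: "\<sigma> \<in> SL2R" "at_cusp \<sigma>"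
  define w where "w m = vslash V (k - 2 * int m) \<sigma> (Q m)" for m
  have "bounded_at_i_infinity (\<lambda>\<tau>. (-1) ^ l / fact l *
      (\<Sum>i\<le>nil_bound N. (-1) ^ i / fact i * Xfac \<sigma> \<tau> ^ i * \<phi> ((L1 ^^ (l + i)) (w (r - l) \<tau>))))" for l
  proof (intro bounded_at_i_infinity_mult[of "\<lambda>_. (-1) ^ l / fact l"] bounded_at_i_infinity_sum bounded_at_i_infinity_const
      bounded_at_i_infinity_mult[of "\<lambda>\<tau>. _ * Xfac \<sigma> \<tau> ^ _"] bounded_at_i_infinity_mult[of "\<lambda>_. (-1) ^ _ / fact _"]
      bounded_at_i_infinity_power Xfac_bounded)
    fix i
    have "vbounded_at_i_infinity V (w (r - l))" unfolding w_def using d s unfolding vq_data_def by blast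
    thus "bounded_at_i_infinity (\<lambda>\<tau>. \<phi> ((L1 ^^ (l + i)) (w (r - l) \<tau>)))"
      using vfunctional_comp[OF \<phi> L1_pow_linear[of "l + i"]] unfolding vbounded_at_i_infinity_def by blast
  qed
  hence "bounded_at_i_infinity (\<lambda>\<tau>. \<Sum>l\<le>r. (-1) ^ l / fact l *
      (\<Sum>i\<le>nil_bound N. (-1) ^ i / fact i * Xfac \<sigma> \<tau> ^ i * \<phi> ((L1 ^^ (l + i)) (w (r - l) \<tau>))))"
    by (rule bounded_at_i_infinity_sum)
  thus "bounded_at_i_infinity (slash (k - 2 * d - 2 * int r) \<sigma>
      (\<lambda>\<tau>. untwisted \<phi> Q r \<tau>))"
  proof (rule bounded_at_i_infinity_cong[rotated])
    fix \<tau> assume t: "\<tau> \<in> uhp"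
    define J where "J = jfac \<sigma> \<tau>"
    define X where "X = Xfac \<sigma> \<tau>"
    have "(\<Sum>i\<le>nil_bound N. (-1) ^ i / fact i * X ^ i * \<phi> ((L1 ^^ (l + i)) (w (r - l) \<tau>))) =
        J powi (- (k - 2 * d - 2 * int r)) * \<phi> ((L1 ^^ l) (Q (r - l) (moebius \<sigma> \<tau>)))" if "l \<le> r" for l
    proof -
      have wT: "w (r - l) \<tau> = weight_act (k - 2 * int (r - l)) \<sigma> \<tau> (Q (r - l) (moebius \<sigma> \<tau>))"
        unfolding w_def by (rule vslash_weight_act[OF s(1) t])
      have wf: "w (r - l) \<tau> \<in> vfilt V N" unfolding wT by (intro weight_act_vfilt vq_data_vfilt[OF d])
      have "\<phi> ((L1 ^^ l) (exp_L1 (- X) (w (r - l) \<tau>))) =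
          (\<Sum>i\<le>nil_bound N. (-1) ^ i / fact i * X ^ i * \<phi> ((L1 ^^ (l + i)) (w (r - l) \<tau>)))"
        unfolding exp_L1_expand[OF wf order_refl]
        by (simp add: vfunctional_sum[OF \<phi>] vfunctional_scale[OF \<phi>] vlinear_sum[OF L1_pow_linear]
            vlinear_scale[OF L1_pow_linear] power_minus[of X] funpow_add)
      moreover have "k - 2 * int (r - l) - 2 * d - 2 * int l = k - 2 * d - 2 * int r" using that by simp
      ultimately show ?thesis
        using coordinate_weight_act[OF s(1) t \<phi> hom, of l "k - 2 * int (r - l)" "Q (r - l) (moebius \<sigma> \<tau>)"]
        by (simp only: wT X_def J_def)
    qed
    thus "(\<Sum>l\<le>r. (-1) ^ l / fact l * (\<Sum>i\<le>nil_bound N. (-1) ^ i / fact i * Xfac \<sigma> \<tau> ^ i * \<phi> ((L1 ^^ (l + i)) (w (r - l) \<tau>)))) =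
      slash (k - 2 * d - 2 * int r) \<sigma> (\<lambda>\<tau>. untwisted \<phi> Q r \<tau>) \<tau>"
      by (simp add: slash_def sum_distrib_left X_def J_def mult_ac)
  qed
qed

end


section \<open>The operator Lambda\<close>

context fuchsian_E2
begin

lemma deriv_E2_lincomb:
  assumes "\<And>i. i \<in> I \<Longrightarrow> f i \<in> quasimodular_ring \<Gamma>"
  shows "deriv_E2 \<Gamma> E (\<lambda>\<tau>. \<Sum>i\<in>I. c i * f i \<tau>) \<tau> = (\<Sum>i\<in>I. c i * deriv_E2 \<Gamma> E (f i) \<tau>)"
proof -
  have ring: "(\<lambda>\<tau>. \<Sum>i\<in>I. c i * f i \<tau>) \<in> quasimodular_ring \<Gamma>"
    using assms by (intro quasimodular_ring_sum quasimodular_ring_scale)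
  show ?thesis
  proof (cases "\<tau> \<in> uhp")
    case True
    have "xcoeff \<Gamma> (\<lambda>\<tau>. \<Sum>i\<in>I. c i * f i \<tau>) (\<lambda>\<tau>. \<Sum>i\<in>I. c i * (kappa * deriv_E2 \<Gamma> E (f i) \<tau>))"
      by (intro xcoeff_sum xcoeff_scale deriv_E2_xcoeff assms)
    from xcoeff_unique[OF deriv_E2_xcoeff[OF ring] this True]
    have "kappa * deriv_E2 \<Gamma> E (\<lambda>\<tau>. \<Sum>i\<in>I. c i * f i \<tau>) \<tau> = kappa * (\<Sum>i\<in>I. c i * deriv_E2 \<Gamma> E (f i) \<tau>)"
      by (simp add: sum_distrib_left mult_ac)
    thus ?thesis using kappa_nz by simp
  next
    case False
    thus ?thesis using deriv_E2_outside[OF ring] deriv_E2_outside[OF assms] by simp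
  qed
qed

end

context voa_forms
begin

abbreviation Lam :: "(complex \<Rightarrow> 'v) \<Rightarrow> complex \<Rightarrow> 'v" where
  "Lam \<equiv> Lambda_op V \<Gamma> E"

text \<open>
Functions into some \<open>F\<^sub>N V\<close> all of whose coordinates lie in \<open>Q(\<Gamma>)\<close>, i.e. the image of \<open>Q(\<Gamma>) \<otimes> V\<close>, on which \<open>\<Lambda>\<close> is
meaningful.
\<close>

definition ring_valued :: "(complex \<Rightarrow> 'v) \<Rightarrow> bool" where
  "ring_valued F \<longleftrightarrow> (\<exists>N. \<forall>\<tau>. F \<tau> \<in> vfilt V N) \<and>
     (\<forall>\<phi>. vfunctional V \<phi> \<longrightarrow> (\<lambda>\<tau>. \<phi> (F \<tau>)) \<in> quasimodular_ring \<Gamma>)"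

text \<open>
The formula on the right holds for every \<open>G\<close> that arises from a representation \<open>F = \<Sum> f\<^sub>i v\<^sub>i\<close>, and determines \<open>G\<close>
since functionals separate points. So \<open>\<Lambda>\<close> does not depend on the representation; homogeneous coordinates provide one.
\<close>

lemma Lambda_functional:
  assumes F: "ring_valued F" and \<phi>: "vfunctional V \<phi>"
  shows "\<phi> (Lam F \<tau>) = kappa * deriv_E2 \<Gamma> E (\<lambda>\<tau>. \<phi> (F \<tau>)) \<tau> + \<phi> (L1 (F \<tau>))"
proof -
  define R where "R G \<longleftrightarrow> (\<exists>(n::nat) f v. (\<forall>i<n. f i \<in> quasimodular_ring \<Gamma>) \<and>
     F = (\<lambda>\<tau>. \<Sum>i<n. vscale V (f i \<tau>) (v i)) \<and>
     G = (\<lambda>\<tau>. \<Sum>i<n. vscale V (12 / (2 * of_real pi * \<i>) * deriv_E2 \<Gamma> E (f i) \<tau>) (v i)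
                    + vscale V (f i \<tau>) (L1 (v i))))" for G
  have RG: "\<phi> (G \<tau>) = kappa * deriv_E2 \<Gamma> E (\<lambda>\<tau>. \<phi> (F \<tau>)) \<tau> + \<phi> (L1 (F \<tau>))"
    if RG: "R G" and \<phi>: "vfunctional V \<phi>" for G \<phi> \<tau>
  proof -
    obtain n :: nat and f v where f: "\<forall>i<n. f i \<in> quasimodular_ring \<Gamma>" and Fe: "F = (\<lambda>\<tau>. \<Sum>i<n. f i \<tau> \<odot> v i)"
      and Ge: "G = (\<lambda>\<tau>. \<Sum>i<n. (kappa * deriv_E2 \<Gamma> E (f i) \<tau>) \<odot> v i + f i \<tau> \<odot> L1 (v i))"
      using RG unfolding R_def kappa_def by blast
    have "deriv_E2 \<Gamma> E (\<lambda>\<tau>. \<phi> (F \<tau>)) \<tau> = deriv_E2 \<Gamma> E (\<lambda>\<tau>. \<Sum>i<n. \<phi> (v i) * f i \<tau>) \<tau>"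
      by (simp add: Fe vfunctional_sum[OF \<phi>] vfunctional_scale[OF \<phi>] mult.commute)
    also have "\<dots> = (\<Sum>i<n. \<phi> (v i) * deriv_E2 \<Gamma> E (f i) \<tau>)" by (rule deriv_E2_lincomb) (use f in auto)
    finally show ?thesis
      by (simp add: Ge Fe vfunctional_sum[OF \<phi>] vfunctional_add[OF \<phi>] vfunctional_scale[OF \<phi>]
          vlinear_sum[OF L1_linear] vlinear_scale[OF L1_linear] sum.distrib sum_distrib_left mult_ac)
  qed
  obtain N where N: "\<And>\<tau>. F \<tau> \<in> vfilt V N" using F unfolding ring_valued_def by blast
  obtain I \<psi> where cs: "coordinate_system N I \<psi>" using coordinate_system_exists by blast
  note fin = coordinate_systemD(1)[OF cs]
    and lin = coordinate_systemD(2)[OF cs]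
    and co = coordinate_systemD(5)[OF cs]
  obtain h where h: "bij_betw h {..<card I} I" using ex_bij_betw_nat_finite[OF fin] by (auto simp: atLeast0LessThan)
  have hI: "h i \<in> I" if "i < card I" for i using h that by (auto simp: bij_betw_def)
  have Fe: "F = (\<lambda>\<tau>. \<Sum>i<card I. \<psi> (h i) (F \<tau>) \<odot> snd (h i))"
  proof
    fix \<tau>
    have "F \<tau> = (\<Sum>i\<in>I. \<psi> i (F \<tau>) \<odot> snd i)" by (rule co[OF N])
    also have "\<dots> = (\<Sum>i<card I. \<psi> (h i) (F \<tau>) \<odot> snd (h i))" by (rule sum.reindex_bij_betw[OF h, symmetric])
    finally show "F \<tau> = (\<Sum>i<card I. \<psi> (h i) (F \<tau>) \<odot> snd (h i))" .
  qed
  have "\<forall>i<card I. (\<lambda>\<tau>. \<psi> (h i) (F \<tau>)) \<in> quasimodular_ring \<Gamma>"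
    using F lin hI unfolding ring_valued_def by blast
  hence ex: "R (\<lambda>\<tau>. \<Sum>i<card I. vscale V (12 / (2 * of_real pi * \<i>) * deriv_E2 \<Gamma> E (\<lambda>\<tau>. \<psi> (h i) (F \<tau>)) \<tau>) (snd (h i))
                    + vscale V (\<psi> (h i) (F \<tau>)) (L1 (snd (h i))))"
    unfolding R_def by (intro exI[of _ "card I"] exI[of _ "\<lambda>i \<tau>. \<psi> (h i) (F \<tau>)"] exI[of _ "\<lambda>i. snd (h i)"] conjI Fe refl)
  have uniq: "G = G'" if "R G" "R G'" for G G'
  proof
    fix \<tau> show "G \<tau> = G' \<tau>" by (rule vfunctional_separate) (simp only: RG[OF that(1)] RG[OF that(2)])
  qed
  have "R (THE G. R G)" by (rule theI[of R, OF ex uniq[OF _ ex]])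
  moreover have "Lam F = (THE G. R G)" unfolding Lambda_op_def R_def ..
  ultimately show ?thesis using RG \<phi> by simp
qed

lemma vq_data_ring_valued:
  assumes d: "vq_data \<Gamma> k N s f Q" shows "ring_valued f"
  unfolding ring_valued_def
proof (intro conjI exI[of _ N] allI impI vq_data_vfilt[OF d])
  fix \<phi> assume \<phi>: "vfunctional V \<phi>"
  obtain I \<psi> where cs: "coordinate_system N I \<psi>" using coordinate_system_exists by blast
  note lin = coordinate_systemD(2)[OF cs]
    and hom = coordinate_systemD(3)[OF cs]
    and co = coordinate_systemD(5)[OF cs]
  have "\<phi> (f \<tau>) = (\<Sum>i\<in>I. \<phi> (snd i) * \<psi> i (f \<tau>))" for \<tau>
    by (subst co[OF vq_data_vfilt(1)[OF d]]) (simp add: vfunctional_sum[OF \<phi>] vfunctional_scale[OF \<phi>] mult.commute)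
  moreover have "(\<lambda>\<tau>. \<psi> i (f \<tau>)) \<in> quasimodular_ring \<Gamma>" if "i \<in> I" for i
    using coordinate_quasimodular[OF d lin[OF that] hom[OF that]] quasimodular_iff[OF G_sub]
    by (intro quasimodular_in_ring[of _ "k - 2 * fst i"]) blast
  ultimately show "(\<lambda>\<tau>. \<phi> (f \<tau>)) \<in> quasimodular_ring \<Gamma>"
    by (simp add: quasimodular_ring_sum quasimodular_ring_scale)
qed

lemma ring_valued_sum:
  assumes "finite S" "\<And>k. k \<in> S \<Longrightarrow> ring_valued (f k)" shows "ring_valued (\<lambda>\<tau>. \<Sum>k\<in>S. f k \<tau>)"
proof -
  have "\<forall>k\<in>S. \<exists>N. \<forall>\<tau>. f k \<tau> \<in> vfilt V N" using assms(2) unfolding ring_valued_def by blast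
  then obtain N where N: "\<And>k \<tau>. k \<in> S \<Longrightarrow> f k \<tau> \<in> vfilt V (N k)" by metis
  have "f k \<tau> \<in> vfilt V (Max (insert 0 (N ` S)))" if "k \<in> S" for k \<tau>
    using N[OF that] by (rule vfilt_mono) (use assms(1) that in auto)
  hence "(\<Sum>k\<in>S. f k \<tau>) \<in> vfilt V (Max (insert 0 (N ` S)))" for \<tau> by (rule vfilt_sum)
  moreover have "(\<lambda>\<tau>. \<phi> (\<Sum>k\<in>S. f k \<tau>)) \<in> quasimodular_ring \<Gamma>" if \<phi>: "vfunctional V \<phi>" for \<phi>
    unfolding vfunctional_sum[OF \<phi>] using assms(2) \<phi> unfolding ring_valued_def by (intro quasimodular_ring_sum) blast
  ultimately show ?thesis unfolding ring_valued_def by blast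
qed

lemma Lambda_sum:
  assumes "finite S" and rv: "\<And>k. k \<in> S \<Longrightarrow> ring_valued (f k)"
  shows "Lam (\<lambda>\<tau>. \<Sum>k\<in>S. f k \<tau>) = (\<lambda>\<tau>. \<Sum>k\<in>S. Lam (f k) \<tau>)"
proof
  fix \<tau>
  show "Lam (\<lambda>\<tau>. \<Sum>k\<in>S. f k \<tau>) \<tau> = (\<Sum>k\<in>S. Lam (f k) \<tau>)"
  proof (rule vfunctional_separate)
    fix \<phi> assume \<phi>: "vfunctional V \<phi>"
    have ring: "(\<lambda>\<tau>. \<phi> (f k \<tau>)) \<in> quasimodular_ring \<Gamma>" if "k \<in> S" for k
      using rv[OF that] \<phi> unfolding ring_valued_def by blast
    have "deriv_E2 \<Gamma> E (\<lambda>\<tau>. \<Sum>k\<in>S. \<phi> (f k \<tau>)) \<tau> = (\<Sum>k\<in>S. deriv_E2 \<Gamma> E (\<lambda>\<tau>. \<phi> (f k \<tau>)) \<tau>)"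
      using deriv_E2_lincomb[of S "\<lambda>k \<tau>. \<phi> (f k \<tau>)" "\<lambda>_. 1", OF ring] by simp
    moreover have "\<phi> (\<Sum>k\<in>S. Lam (f k) \<tau>) =
        (\<Sum>k\<in>S. kappa * deriv_E2 \<Gamma> E (\<lambda>\<tau>. \<phi> (f k \<tau>)) \<tau> + \<phi> (L1 (f k \<tau>)))"
      using Lambda_functional[OF rv \<phi>] by (simp add: vfunctional_sum[OF \<phi>])
    ultimately show "\<phi> (Lam (\<lambda>\<tau>. \<Sum>k\<in>S. f k \<tau>) \<tau>) = \<phi> (\<Sum>k\<in>S. Lam (f k) \<tau>)"
      by (simp add: Lambda_functional[OF ring_valued_sum[OF assms] \<phi>] vfunctional_sum[OF \<phi>]
          vlinear_sum[OF L1_linear] sum.distrib sum_distrib_left)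
  qed
qed

text \<open>
For a homogeneous functional \<open>\<phi>\<close>, \<open>\<kappa> \<partial>\<phi>(f)/\<partial>E\<close> is the first coefficient of \<open>\<phi>(f)\<close>, which is
\<open>\<phi>(Q\<^sub>1) - \<phi>(L(1) f)\<close>; the term \<open>L(1)\<close> of \<open>\<Lambda>\<close> compensates the twist.
\<close>

lemma Lambda_eq_Q1:
  assumes d: "vq_data \<Gamma> k N s f Q" shows "Lam f = Q 1"
proof
  fix \<tau> show "Lam f \<tau> = Q 1 \<tau>"
  proof (rule homogeneous_separate)
    fix \<phi> e assume \<phi>: "vfunctional V \<phi>" and hom: "\<And>w. \<phi> w = \<phi> (vcomp V w e)"
    have L: "\<phi> (Lam f \<tau>) = kappa * deriv_E2 \<Gamma> E (\<lambda>\<tau>. \<phi> (f \<tau>)) \<tau> + \<phi> (L1 (f \<tau>))"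
      by (rule Lambda_functional[OF vq_data_ring_valued[OF d] \<phi>])
    have ring: "(\<lambda>\<tau>. \<phi> (f \<tau>)) \<in> quasimodular_ring \<Gamma>"
      using vq_data_ring_valued[OF d] \<phi> unfolding ring_valued_def by blast
    show "\<phi> (Lam f \<tau>) = \<phi> (Q 1 \<tau>)"
    proof (cases "\<tau> \<in> uhp")
      case True
      have "kappa * deriv_E2 \<Gamma> E (\<lambda>\<tau>. \<phi> (f \<tau>)) \<tau> = (\<Sum>l\<le>1. (-1) ^ l / fact l * \<phi> ((L1 ^^ l) (Q (1 - l) \<tau>)))"
        by (rule xcoeff_unique[OF deriv_E2_xcoeff[OF ring] xcoeff_qm_data[OF coordinate_quasimodular[OF d \<phi> hom]] True])
      also have "\<dots> = \<phi> (Q 1 \<tau>) - \<phi> (L1 (f \<tau>))" using vq_data_Q0[OF d] by simp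
      finally show ?thesis using L by simp
    next
      case False
      hence "f \<tau> = 0" "Q 1 \<tau> = 0" using d by (auto simp: vq_data_def)
      thus ?thesis using L deriv_E2_outside[OF ring False]
        by (simp add: vlinear_zero[OF L1_linear] vfunctional_zero[OF \<phi>])
    qed
  qed
qed

text \<open>
Compare the coefficients of \<open>X(\<gamma>,\<delta>\<tau>)\<^sup>1\<close> in \<open>f \<parallel> \<gamma>\<delta> = (f \<parallel> \<gamma>) \<parallel> \<delta>\<close>. On the left the substitution
\<open>X(\<gamma>\<delta>,\<tau>) = X(\<delta>,\<tau>) + j(\<delta>,\<tau>)\<^sup>-\<^sup>2 X(\<gamma>,\<delta>\<tau>)\<close> differentiates \<open>\<Sum>\<^sub>m X\<^sup>m Q\<^sub>m\<close> with respect to \<open>X\<close>; on the right stands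
\<open>Q\<^sub>1 \<parallel>\<^sub>k \<delta>\<close>, and the factor \<open>j\<^sup>-\<^sup>2\<close> changes its weight to \<open>k - 2\<close>.
\<close>

lemma vq_data_shift:
  assumes d: "vq_data \<Gamma> k N s f Q"
  shows "vq_data \<Gamma> (k - 2) N s (Q 1) (\<lambda>m \<tau>. of_nat (m + 1) \<odot> Q (m + 1) \<tau>)"
  unfolding vq_data_def
proof (intro conjI allI ballI impI)
  show "Q 1 \<tau> = 0" if "\<tau> \<notin> uhp" for \<tau> using d that by (simp add: vq_data_def)
  show "vholomorphic V N (Q 1)" using d by (simp add: vq_data_def)
  show "vholomorphic V N (\<lambda>\<tau>. of_nat (m + 1) \<odot> Q (m + 1) \<tau>)" for m
  proof -
    have "vholomorphic V N (Q (m + 1))" using d unfolding vq_data_def by blast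
    thus ?thesis unfolding vholomorphic_def
      by (auto simp: vfunctional_scale simp del: of_nat_add of_nat_Suc intro!: vfilt_scale holomorphic_on_mult)
  qed
  show "of_nat (m + 1) \<odot> Q (m + 1) \<tau> = 0" if "\<tau> \<notin> uhp" for m \<tau> using d that by (simp add: vq_data_def)
  show "(\<lambda>\<tau>. of_nat (m + 1) \<odot> Q (m + 1) \<tau>) = (\<lambda>_. 0)" if "s < m" for m using d that by (simp add: vq_data_def)
next
  fix \<delta> \<tau> assume g: "\<delta> \<in> \<Gamma>" and t: "\<tau> \<in> uhp"
  define J where "J = jfac \<delta> \<tau>"
  define x where "x = Xfac \<delta> \<tau>"
  have dS: "\<delta> \<in> SL2R" by (rule G_SL2R[OF g])
  have J: "J \<noteq> 0" unfolding J_def by (rule jfac_nz[OF dS t])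
  have t': "moebius \<delta> \<tau> \<in> uhp" by (rule moebius_uhp[OF dS t])
  \<comment> \<open>one step of depth to spare, so that the coefficient of \<open>X\<^sup>1\<close> exists even for \<open>s = 0\<close>\<close>
  have d': "vq_data \<Gamma> k N (Suc s) f Q" by (rule vq_data_mono[OF d]) auto
  show "vslash V (k - 2) \<delta> (Q 1) \<tau> = (\<Sum>m\<le>s. Xfac \<delta> \<tau> ^ m \<odot> of_nat (m + 1) \<odot> Q (m + 1) \<tau>)"
  proof (rule vfunctional_separate)
    fix \<phi> assume \<phi>: "vfunctional V \<phi>"
    have "(J ^ 2) ^ 1 * \<phi> (weight_act k \<delta> \<tau> (Q 1 (moebius \<delta> \<tau>))) =
        (\<Sum>r\<le>Suc s. of_nat (r choose 1) * x ^ (r - 1) * \<phi> (Q r \<tau>))"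
    proof (rule X_shift_coeffs[OF t', where e = "\<lambda>m. \<phi> (weight_act k \<delta> \<tau> (Q m (moebius \<delta> \<tau>)))"])
      fix \<gamma> assume c: "\<gamma> \<in> \<Gamma>"
      have "(\<Sum>r\<le>Suc s. (x + Xfac \<gamma> (moebius \<delta> \<tau>) / J ^ 2) ^ r * \<phi> (Q r \<tau>)) =
          \<phi> (\<Sum>r\<le>Suc s. Xfac (\<gamma> ** \<delta>) \<tau> ^ r \<odot> Q r \<tau>)"
        by (simp add: Xfac_mult G_SL2R c g t J_def x_def vfunctional_sum[OF \<phi>] vfunctional_scale[OF \<phi>] vfunctional_add[OF \<phi>])
      also have "(\<Sum>r\<le>Suc s. Xfac (\<gamma> ** \<delta>) \<tau> ^ r \<odot> Q r \<tau>) = vslash V k (\<gamma> ** \<delta>) f \<tau>"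
        using d' G_mult[OF c g] t unfolding vq_data_def by simp
      also have "\<dots> = weight_act k \<delta> \<tau> (vslash V k \<gamma> f (moebius \<delta> \<tau>))" by (rule vslash_mult[OF G_SL2R[OF c] dS t])
      also have "vslash V k \<gamma> f (moebius \<delta> \<tau>) = (\<Sum>m\<le>Suc s. Xfac \<gamma> (moebius \<delta> \<tau>) ^ m \<odot> Q m (moebius \<delta> \<tau>))"
        using d' c t' unfolding vq_data_def by blast
      finally show "(\<Sum>r\<le>Suc s. (x + Xfac \<gamma> (moebius \<delta> \<tau>) / J ^ 2) ^ r * \<phi> (Q r \<tau>)) =
          (\<Sum>m\<le>Suc s. Xfac \<gamma> (moebius \<delta> \<tau>) ^ m * \<phi> (weight_act k \<delta> \<tau> (Q m (moebius \<delta> \<tau>))))"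
        by (simp add: vlinear_sum[OF weight_act_linear] vlinear_add[OF weight_act_linear] vlinear_scale[OF weight_act_linear]
            vfunctional_sum[OF \<phi>] vfunctional_scale[OF \<phi>] vfunctional_add[OF \<phi>] del: sum.atMost_Suc)
    qed (use J in auto)
    also have "\<dots> = (\<Sum>m\<le>s. of_nat (Suc m) * x ^ m * \<phi> (Q (Suc m) \<tau>))"
      by (simp add: sum.atMost_Suc_shift del: sum.atMost_Suc)
    also have "(J ^ 2) ^ 1 * \<phi> (weight_act k \<delta> \<tau> (Q 1 (moebius \<delta> \<tau>))) = \<phi> (vslash V (k - 2) \<delta> (Q 1) \<tau>)"
      using weight_act_shift[OF J[unfolded J_def], of 2 k "Q 1 (moebius \<delta> \<tau>)"] vfunctional_scale[OF \<phi>]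
      by (simp add: vslash_weight_act[OF dS t] J_def flip: vfunctional_scale[OF \<phi>])
    finally show "\<phi> (vslash V (k - 2) \<delta> (Q 1) \<tau>) = \<phi> (\<Sum>m\<le>s. Xfac \<delta> \<tau> ^ m \<odot> of_nat (m + 1) \<odot> Q (m + 1) \<tau>)"
      by (simp add: vfunctional_sum[OF \<phi>] vfunctional_scale[OF \<phi>] x_def mult_ac del: of_nat_Suc vs.scale_scale)
  qed
next
  fix \<sigma> m assume s: "\<sigma> \<in> SL2R" "at_cusp \<sigma>"
  have b: "vbounded_at_i_infinity V (vslash V (k - 2 * int (m + 1)) \<sigma> (Q (m + 1)))"
    using d s unfolding vq_data_def by blast
  have e: "k - 2 - 2 * int m = k - 2 * int (m + 1)" by simp
  have "vbounded_at_i_infinity V (\<lambda>\<tau>. of_nat (m + 1) \<odot> vslash V (k - 2 * int (m + 1)) \<sigma> (Q (m + 1)) \<tau>)"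
    unfolding vbounded_at_i_infinity_def
  proof (intro allI impI)
    fix \<phi> assume \<phi>: "vfunctional V \<phi>"
    hence "bounded_at_i_infinity (\<lambda>\<tau>. \<phi> (vslash V (k - 2 * int (m + 1)) \<sigma> (Q (m + 1)) \<tau>))"
      using b unfolding vbounded_at_i_infinity_def by blast
    thus "bounded_at_i_infinity (\<lambda>\<tau>. \<phi> (of_nat (m + 1) \<odot> vslash V (k - 2 * int (m + 1)) \<sigma> (Q (m + 1)) \<tau>))"
      unfolding vfunctional_scale[OF \<phi>] by (rule bounded_at_i_infinity_mult[OF bounded_at_i_infinity_const])
  qed
  thus "vbounded_at_i_infinity V (vslash V (k - 2 - 2 * int m) \<sigma> (\<lambda>\<tau>. of_nat (m + 1) \<odot> Q (m + 1) \<tau>))"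
    unfolding e by (rule vbounded_cong[rotated]) (simp only: vslash_weight_act[OF s(1)] vlinear_scale[OF weight_act_linear])
qed

lemma Lambda_power:
  assumes "vq_data \<Gamma> k N s f Q" shows "(Lam ^^ m) f = (\<lambda>\<tau>. fact m \<odot> Q m \<tau>)"
  using assms
proof (induction m arbitrary: k f Q)
  case 0
  thus ?case using vq_data_Q0[OF 0] by simp
next
  case (Suc m)
  have "(Lam ^^ Suc m) f = (Lam ^^ m) (Q 1)"
    by (simp only: funpow_Suc_right comp_apply Lambda_eq_Q1[OF Suc.prems])
  also have "\<dots> = (\<lambda>\<tau>. fact m \<odot> of_nat (m + 1) \<odot> Q (m + 1) \<tau>)" by (rule Suc.IH[OF vq_data_shift[OF Suc.prems]])
  finally show ?case by (simp add: mult.commute)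
qed

lemma vquasimodular_Lambda:
  assumes "f \<in> vquasimodular V \<Gamma> k" shows "Lam f \<in> vquasimodular V \<Gamma> (k - 2)"
proof -
  obtain N s Q where d: "vq_data \<Gamma> k N s f Q" using assms vquasimodular_iff[OF G_sub] by blast
  show ?thesis unfolding vquasimodular_iff[OF G_sub] Lambda_eq_Q1[OF d] using vq_data_shift[OF d] by blast
qed

lemma vquasimodular_ring_valued: "f \<in> vquasimodular V \<Gamma> k \<Longrightarrow> ring_valued f"
  using vq_data_ring_valued unfolding vquasimodular_iff[OF G_sub] by blast

lemma exponential_formula:
  assumes "f \<in> vquasimodular V \<Gamma> k"
  shows "\<exists>n. (Lam ^^ n) f = (\<lambda>_. 0)"
    and "\<gamma> \<in> \<Gamma> \<Longrightarrow> \<tau> \<in> uhp \<Longrightarrow> vslash V k \<gamma> f \<tau> =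
          Sum_any (\<lambda>m::nat. (Xfac \<gamma> \<tau> ^ m / fact m) \<odot> ((Lam ^^ m) f \<tau>))"
proof -
  obtain N s Q where d: "vq_data \<Gamma> k N s f Q" using assms vquasimodular_iff[OF G_sub] by blast
  have Q0: "Q m = (\<lambda>_. 0)" if "m > s" for m using d that by (simp add: vq_data_def)
  show "\<exists>n. (Lam ^^ n) f = (\<lambda>_. 0)"
    unfolding Lambda_power[OF d] by (rule exI[of _ "Suc s"]) (simp add: Q0)
  assume g: "\<gamma> \<in> \<Gamma>" "\<tau> \<in> uhp"
  have "Sum_any (\<lambda>m::nat. (Xfac \<gamma> \<tau> ^ m / fact m) \<odot> ((Lam ^^ m) f \<tau>)) =
      Sum_any (\<lambda>m. Xfac \<gamma> \<tau> ^ m \<odot> Q m \<tau>)"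
    unfolding Lambda_power[OF d] by simp
  also have "\<dots> = (\<Sum>m\<le>s. Xfac \<gamma> \<tau> ^ m \<odot> Q m \<tau>)"
    by (rule Sum_any.expand_superset) (use Q0 in \<open>auto simp: not_less[symmetric]\<close>)
  also have "\<dots> = vslash V k \<gamma> f \<tau>" using d g unfolding vq_data_def by simp
  finally show "vslash V k \<gamma> f \<tau> = Sum_any (\<lambda>m::nat. (Xfac \<gamma> \<tau> ^ m / fact m) \<odot> ((Lam ^^ m) f \<tau>))" ..
qed

text \<open>
\<open>K\<close> does not depend on the weight. So \<open>K\<^sup>-\<^sup>1\<close> applied to \<open>\<Sum>\<^sub>k g\<^sub>k(\<gamma>\<tau>) = 0\<close> gives \<open>\<Sum>\<^sub>k j\<^sup>k \<Sum>\<^sub>m X\<^sup>m Q\<^sub>m(g\<^sub>k)(\<tau>) = 0\<close>, and the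
functions \<open>j\<^sup>k X\<^sup>m\<close> are independent.
\<close>

lemma vquasimodular_weights_independent:
  assumes "finite S" and g: "\<And>k. k \<in> S \<Longrightarrow> g k \<in> vquasimodular V \<Gamma> k"
    and zero: "(\<lambda>\<tau>. \<Sum>k\<in>S. g k \<tau>) = (\<lambda>_. 0)" and "k \<in> S"
  shows "g k = (\<lambda>_. 0)"
proof -
  have "\<forall>k\<in>S. \<exists>N s Q. vq_data \<Gamma> k N s (g k) Q" using g vquasimodular_iff[OF G_sub] by blast
  then obtain N s Q where d: "\<And>k. k \<in> S \<Longrightarrow> vq_data \<Gamma> k (N k) (s k) (g k) (Q k)" by metis
  define s' where "s' = Max (insert 0 (s ` S))"
  have d': "vq_data \<Gamma> k (N k) s' (g k) (Q k)" if "k \<in> S" for k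
    by (rule vq_data_mono[OF d[OF that]]) (use assms(1) that in \<open>auto simp: s'_def\<close>)
  have "g k \<tau> = 0" if t: "\<tau> \<in> uhp" for \<tau>
  proof (rule vfunctional_separate)
    fix \<phi> assume \<phi>: "vfunctional V \<phi>"
    have "\<phi> (Q k 0 \<tau>) = 0"
    proof (rule weight_depth_independent[OF t assms(1), where q = "\<lambda>w m. \<phi> (Q w m \<tau>)" and s = s' and w = k and m = 0])
      fix \<gamma> assume c: "\<gamma> \<in> \<Gamma>"
      have j: "jfac \<gamma> \<tau> \<noteq> 0" by (rule jfac_nz[OF G_SL2R[OF c] t])
      have "jfac \<gamma> \<tau> powi w \<odot> (\<Sum>m\<le>s'. Xfac \<gamma> \<tau> ^ m \<odot> Q w m \<tau>) = weight_act 0 \<gamma> \<tau> (g w (moebius \<gamma> \<tau>))" if w: "w \<in> S" for w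
      proof -
        have "(\<Sum>m\<le>s'. Xfac \<gamma> \<tau> ^ m \<odot> Q w m \<tau>) = vslash V w \<gamma> (g w) \<tau>"
          using d'[OF w] c t unfolding vq_data_def by simp
        thus ?thesis using weight_act_shift[OF j, of w w] by (simp add: vslash_weight_act G_SL2R c t)
      qed
      hence "(\<Sum>w\<in>S. jfac \<gamma> \<tau> powi w \<odot> (\<Sum>m\<le>s'. Xfac \<gamma> \<tau> ^ m \<odot> Q w m \<tau>)) = weight_act 0 \<gamma> \<tau> (\<Sum>w\<in>S. g w (moebius \<gamma> \<tau>))"
        by (simp add: vlinear_sum[OF weight_act_linear])
      also have "\<dots> = 0" using fun_cong[OF zero, of "moebius \<gamma> \<tau>"] by (simp add: vlinear_zero[OF weight_act_linear])
      finally have "\<phi> (\<Sum>w\<in>S. jfac \<gamma> \<tau> powi w \<odot> (\<Sum>m\<le>s'. Xfac \<gamma> \<tau> ^ m \<odot> Q w m \<tau>)) = 0"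
        by (simp only: vfunctional_zero[OF \<phi>])
      thus "(\<Sum>w\<in>S. jfac \<gamma> \<tau> powi w * (\<Sum>m\<le>s'. Xfac \<gamma> \<tau> ^ m * \<phi> (Q w m \<tau>))) = 0"
        by (simp only: vfunctional_sum[OF \<phi>] vfunctional_scale[OF \<phi>])
    qed (use assms in auto)
    thus "\<phi> (g k \<tau>) = \<phi> 0" using vq_data_Q0[OF d[OF \<open>k \<in> S\<close>]] by (simp add: vfunctional_zero[OF \<phi>])
  qed
  moreover have "g k \<tau> = 0" if "\<tau> \<notin> uhp" for \<tau> using d[OF \<open>k \<in> S\<close>] that by (simp add: vq_data_def)
  ultimately show ?thesis by blast
qed

end


section \<open>Expansions at the cusps\<close>

definition qpar :: "real \<Rightarrow> complex \<Rightarrow> complex" where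
  "qpar w \<tau> = exp (2 * of_real pi * \<i> * \<tau> / of_real w)"

lemma norm_qpar: "norm (qpar w \<tau>) = exp (- 2 * pi * Im \<tau> / w)"
proof -
  have "Re (2 * of_real pi * \<i> * \<tau> / of_real w) = - 2 * pi * Im \<tau> / w"
    by (simp add: Re_divide_of_real)
  thus ?thesis by (simp add: qpar_def)
qed

text \<open>
A periodic function is a function \<open>G\<close> of \<open>q\<close> on the punctured unit disc; boundedness removes the singularity at \<open>q = 0\<close>,
and the Taylor series is the expansion.
\<close>

lemma periodic_q_expansion:
  fixes h :: "complex \<Rightarrow> complex"
  assumes w: "w > 0" and hol: "h holomorphic_on uhp"
    and per: "\<And>\<tau>. \<tau> \<in> uhp \<Longrightarrow> h (\<tau> + of_real w) = h \<tau>" and bd: "bounded_at_i_infinity h"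
  shows "\<exists>c. \<forall>\<tau>\<in>uhp. (\<lambda>n. c n * qpar w \<tau> ^ n) sums h \<tau>"
proof -
  define \<kappa> where "\<kappa> = of_real w / (2 * of_real pi * \<i>)"
  have \<kappa>: "2 * of_real pi * \<i> * (\<kappa> * z) / of_real w = z" for z
    using w by (simp add: \<kappa>_def)
  have Im\<kappa>: "Im (\<kappa> * z) = - w / (2 * pi) * Re z" and Re\<kappa>: "Re (\<kappa> * z) = w / (2 * pi) * Im z" for z
  proof -
    have "\<kappa> = of_real (- w / (2 * pi)) * \<i>" by (simp add: \<kappa>_def field_simps)
    thus "Im (\<kappa> * z) = - w / (2 * pi) * Re z" "Re (\<kappa> * z) = w / (2 * pi) * Im z" by simp_all
  qed
  have pern: "h (\<tau> + of_real (real n * w)) = h \<tau>" if "\<tau> \<in> uhp" for \<tau> n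
  proof (induction n)
    case (Suc n)
    have "\<tau> + of_real (real n * w) \<in> uhp" using that by (simp add: uhp_def)
    from per[OF this] show ?case using Suc by (simp add: algebra_simps)
  qed simp
  have peri: "h (\<tau> + of_real (of_int n * w)) = h \<tau>" if t: "\<tau> \<in> uhp" for \<tau> and n :: int
  proof (cases "n \<ge> 0")
    case True
    thus ?thesis using pern[OF t, of "nat n"] by simp
  next
    case False
    have "\<tau> + of_real (of_int n * w) \<in> uhp" using t by (simp add: uhp_def)
    from pern[OF this, of "nat (- n)"] show ?thesis using False by simp
  qed
  have same: "h \<tau> = h \<tau>'" if tt: "\<tau> \<in> uhp" "\<tau>' \<in> uhp" "qpar w \<tau> = qpar w \<tau>'" for \<tau> \<tau>'
  proof -
    obtain n :: int where n: "2 * of_real pi * \<i> * \<tau> / of_real w = 2 * of_real pi * \<i> * \<tau>' / of_real w + (of_int (2 * n) * pi) * \<i>"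
      using tt(3) unfolding qpar_def exp_eq by blast
    have "2 * of_real pi * \<i> * (\<tau> - (\<tau>' + of_real (of_int n * w))) = 0"
      using n w by (simp add: field_simps)
    hence "\<tau> = \<tau>' + of_real (of_int n * w)" by simp
    thus ?thesis using peri[OF tt(2), of n] by simp
  qed
  define G where "G z = h (\<kappa> * Ln z)" for z
  have lift: "\<kappa> * u \<in> uhp" if "norm (exp u) < 1" for u
  proof -
    have "Re u < 0" using that by simp
    hence "- w / (2 * pi) * Re u > 0" using w by (simp add: zero_less_mult_iff mult_less_0_iff divide_less_0_iff)
    thus ?thesis unfolding uhp_def using Im\<kappa>[of u] by simp
  qed
  have qlift: "qpar w (\<kappa> * u) = exp u" for u unfolding qpar_def \<kappa> ..
  have G_exp: "G (exp u) = h (\<kappa> * u)" if "norm (exp u) < 1" for u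
    unfolding G_def using that by (intro same lift) (simp_all add: qlift)
  have Gq: "G (qpar w \<tau>) = h \<tau>" if t: "\<tau> \<in> uhp" for \<tau>
  proof -
    define u where "u = 2 * of_real pi * \<i> * \<tau> / of_real w"
    have "Re u < 0" using t w by (simp add: u_def Re_divide_of_real uhp_def)
    hence "norm (exp u) < 1" by simp
    moreover have "\<kappa> * u = \<tau>" using w by (simp add: u_def \<kappa>_def)
    ultimately show ?thesis using G_exp[of u] by (simp add: qpar_def u_def)
  qed
  \<comment> \<open>two branches of the logarithm cover the punctured disc, and \<open>h\<close> does not see which one is used\<close>
  have Ghol: "G holomorphic_on ball 0 1 - {0}"
  proof -
    define A where "A = ball (0::complex) 1 - \<real>\<^sub>\<le>\<^sub>0"
    define B where "B = ball (0::complex) 1 - \<real>\<^sub>\<ge>\<^sub>0"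
    have oA: "open A" unfolding A_def by (intro open_Diff open_ball closed_nonpos_Reals_complex)
    have oB: "open B" unfolding B_def by (intro open_Diff open_ball closed_nonneg_Reals_complex)
    have "(h \<circ> (\<lambda>z. \<kappa> * Ln z)) holomorphic_on A"
    proof (rule holomorphic_on_compose_gen[OF _ hol])
      show "(\<lambda>z. \<kappa> * Ln z) holomorphic_on A" by (intro holomorphic_intros) (auto simp: A_def)
      show "(\<lambda>z. \<kappa> * Ln z) ` A \<subseteq> uhp"
      proof (intro image_subsetI lift)
        fix z assume "z \<in> A"
        hence z: "z \<noteq> 0" "norm z < 1" by (auto simp: A_def)
        show "norm (exp (Ln z)) < 1" unfolding exp_Ln[OF z(1)] by (rule z(2))
      qed
    qed
    hence 1: "G holomorphic_on A" by (rule holomorphic_transform) (simp add: G_def)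
    have "(h \<circ> (\<lambda>z. \<kappa> * (Ln (- z) + \<i> * of_real pi))) holomorphic_on B"
    proof (rule holomorphic_on_compose_gen[OF _ hol])
      show "(\<lambda>z. \<kappa> * (Ln (- z) + \<i> * of_real pi)) holomorphic_on B"
        by (intro holomorphic_intros) (auto simp: B_def)
      show "(\<lambda>z. \<kappa> * (Ln (- z) + \<i> * of_real pi)) ` B \<subseteq> uhp"
      proof (intro image_subsetI lift)
        fix z assume "z \<in> B"
        hence z: "z \<noteq> 0" "norm z < 1" by (auto simp: B_def)
        have e: "exp (Ln (- z) + \<i> * of_real pi) = z" using z(1) by (simp add: exp_add)
        show "norm (exp (Ln (- z) + \<i> * of_real pi)) < 1" unfolding e by (rule z(2))
      qed
    qed
    hence 2: "G holomorphic_on B"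
    proof (rule holomorphic_transform)
      fix z assume z: "z \<in> B"
      hence z0: "z \<noteq> 0" "norm z < 1" by (auto simp: B_def)
      have "exp (Ln (- z) + \<i> * of_real pi) = z" using z0 by (simp add: exp_add)
      thus "(h \<circ> (\<lambda>z. \<kappa> * (Ln (- z) + \<i> * of_real pi))) z = G z"
        using G_exp[of "Ln (- z) + \<i> * of_real pi"] z0(2) by (simp only: comp_apply)
    qed
    have "A \<union> B = ball 0 1 - {0}"
      by (auto simp: A_def B_def complex_nonpos_Reals_iff complex_nonneg_Reals_iff complex_eq_iff)
    thus ?thesis using holomorphic_on_Un[OF 1 2 oA oB] by simp
  qed
  obtain y B where y: "y > 0" "\<And>\<tau>. - w \<le> Re \<tau> \<and> Re \<tau> \<le> w \<and> y \<le> Im \<tau> \<Longrightarrow> cmod (h \<tau>) \<le> B"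
    using bd unfolding bounded_at_i_infinity_def by meson
  define \<delta> where "\<delta> = exp (- 2 * pi * y / w)"
  have "cmod (G z) \<le> B" if z: "z \<noteq> 0" "norm z < \<delta>" for z
  proof -
    have "\<bar>Im (Ln z)\<bar> \<le> pi" using mpi_less_Im_Ln[OF z(1)] Im_Ln_le_pi[OF z(1)] by simp
    hence "\<bar>Re (\<kappa> * Ln z)\<bar> \<le> w / (2 * pi) * pi"
      unfolding Re\<kappa> abs_mult using w by (intro mult_mono) auto
    also have "\<dots> \<le> w" using w by simp
    finally have re: "\<bar>Re (\<kappa> * Ln z)\<bar> \<le> w" .
    have "ln (norm z) < ln \<delta>" using z by (subst ln_less_cancel_iff) (auto simp: \<delta>_def)
    hence "ln (norm z) \<le> - 2 * pi * y / w" by (simp add: \<delta>_def)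
    hence "w / (2 * pi) * ln (norm z) \<le> w / (2 * pi) * (- 2 * pi * y / w)" using w by (intro mult_left_mono) auto
    hence "y \<le> Im (\<kappa> * Ln z)" unfolding Im\<kappa> using w z(1) by (simp add: Re_Ln)
    thus ?thesis unfolding G_def using re by (intro y(2)) auto
  qed
  moreover have "\<delta> > 0" by (simp add: \<delta>_def)
  ultimately have "\<exists>B. eventually (\<lambda>z. norm (G z) \<le> B) (at 0)"
    by (intro exI[of _ B]) (auto simp: eventually_at)
  moreover have "0 \<in> interior (ball (0::complex) 1)" by simp
  ultimately obtain H where H: "H holomorphic_on ball 0 1" "\<And>z. z \<in> ball 0 1 - {0} \<Longrightarrow> H z = G z"
    using holomorphic_on_extend_bounded[OF Ghol] by blast
  show ?thesis
  proof (intro exI[of _ "\<lambda>n. (deriv ^^ n) H 0 / fact n"] ballI)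
    fix \<tau> assume t: "\<tau> \<in> uhp"
    have "- 2 * pi * Im \<tau> / w < 0" using t w by (simp add: uhp_def)
    hence q: "qpar w \<tau> \<in> ball 0 1" by (simp add: norm_qpar)
    have "H (qpar w \<tau>) = h \<tau>" using H(2)[of "qpar w \<tau>"] q Gq[OF t] by (simp add: qpar_def)
    thus "(\<lambda>n. (deriv ^^ n) H 0 / fact n * qpar w \<tau> ^ n) sums h \<tau>"
      using holomorphic_power_series[OF H(1) q] by simp
  qed
qed

text \<open>
Convergence at \<open>\<tau> = \<i>\<close> makes the series absolutely convergent, hence bounded, on the smaller disc \<open>Im \<tau> \<ge> 2\<close>.
\<close>

lemma q_expansion_bounded:
  assumes w: "w > 0" and sums: "\<And>\<tau>. \<tau> \<in> uhp \<Longrightarrow> (\<lambda>n. c n * qpar w \<tau> ^ n) sums g \<tau>"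
  shows "bounded_at_i_infinity g"
proof -
  define q where "q = norm (qpar w (2 * \<i>))"
  have "summable (\<lambda>n. c n * qpar w \<i> ^ n)" using sums[of \<i>] by (auto simp: uhp_def sums_iff)
  moreover have "norm (complex_of_real q) < norm (qpar w \<i>)"
    using w by (simp add: q_def norm_qpar divide_strict_right_mono)
  ultimately have s: "summable (\<lambda>n. norm (c n * of_real q ^ n))" by (rule powser_insidea)
  have "cmod (g \<tau>) \<le> suminf (\<lambda>n. norm (c n * of_real q ^ n))" if t: "2 \<le> Im \<tau>" for \<tau>
  proof -
    have "\<tau> \<in> uhp" using t by (simp add: uhp_def)
    hence g: "g \<tau> = suminf (\<lambda>n. c n * qpar w \<tau> ^ n)" using sums sums_unique by blast
    have "norm (qpar w \<tau>) \<le> q" using w t by (simp add: q_def norm_qpar divide_right_mono)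
    hence le: "norm (c n * qpar w \<tau> ^ n) \<le> norm (c n * of_real q ^ n)" for n
      by (simp add: norm_mult norm_power mult_left_mono power_mono q_def)
    have s2: "summable (\<lambda>n. norm (c n * qpar w \<tau> ^ n))"
      by (rule summable_comparison_test[OF _ s]) (use le in auto)
    have "norm (suminf (\<lambda>n. c n * qpar w \<tau> ^ n)) \<le> suminf (\<lambda>n. norm (c n * qpar w \<tau> ^ n))" by (rule summable_norm[OF s2])
    also have "\<dots> \<le> suminf (\<lambda>n. norm (c n * of_real q ^ n))" by (rule suminf_le[OF le s2 s])
    finally show ?thesis unfolding g .
  qed
  thus ?thesis unfolding bounded_at_i_infinity_def
    by (intro allI exI[of _ 2] conjI exI[of _ "suminf (\<lambda>n. norm (c n * of_real q ^ n))"]) auto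
qed

context quasi_voa
begin

lemma vslash_holomorphic:
  assumes f: "vholomorphic V N f" and A: "A \<in> SL2R" and \<phi>: "vfunctional V \<phi>"
  shows "(\<lambda>\<tau>. \<phi> (vslash V k A f \<tau>)) holomorphic_on uhp"
proof -
  obtain I \<psi> where cs: "coordinate_system N I \<psi>" using coordinate_system_exists by blast
  note lin = coordinate_systemD(2)[OF cs]
    and bN = coordinate_systemD(4)[OF cs]
    and co = coordinate_systemD(5)[OF cs]
  have 1: "(\<lambda>\<tau>. \<psi> i (f (moebius A \<tau>))) holomorphic_on uhp" if "i \<in> I" for i
  proof -
    have "(\<lambda>\<tau>. \<psi> i (f \<tau>)) holomorphic_on uhp" using f lin[OF that] by (simp add: vholomorphic_def)
    hence "((\<lambda>\<tau>. \<psi> i (f \<tau>)) \<circ> moebius A) holomorphic_on uhp"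
      by (rule holomorphic_on_compose_gen[OF moebius_holomorphic[OF A]]) (auto intro: moebius_uhp A)
    thus ?thesis by (simp add: o_def)
  qed
  have 2: "(\<lambda>\<tau>. \<phi> (weight_act k A \<tau> b)) holomorphic_on uhp" if b: "b \<in> vfilt V N" for b
  proof -
    have "\<phi> (weight_act k A \<tau> b) = jfac A \<tau> powi (- k) * (\<Sum>m\<le>nil_bound N. Xfac A \<tau> ^ m / fact m *
        (\<Sum>n\<in>{lowdeg..N}. jfac A \<tau> powi (2 * n) * \<phi> ((L1 ^^ m) (vcomp V b n))))" for \<tau>
    proof -
      have grade_scale: "grade_scale (jfac A \<tau>) b = (\<Sum>n\<in>{lowdeg..N}. jfac A \<tau> powi (2 * n) \<odot> vcomp V b n)"
        using vcomp_finite_sum[OF grade_scale_vfilt[OF b], of "jfac A \<tau>"] by (simp add: vcomp_L0_power)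
      have "\<phi> ((L1 ^^ m) (grade_scale (jfac A \<tau>) b)) = (\<Sum>n\<in>{lowdeg..N}. jfac A \<tau> powi (2 * n) * \<phi> ((L1 ^^ m) (vcomp V b n)))" for m
        unfolding grade_scale by (simp add: vlinear_sum[OF L1_pow_linear] vlinear_scale[OF L1_pow_linear]
            vfunctional_sum[OF \<phi>] vfunctional_scale[OF \<phi>])
      thus ?thesis unfolding weight_act_def exp_L1_expand[OF grade_scale_vfilt[OF b] order_refl]
        by (simp add: vfunctional_sum[OF \<phi>] vfunctional_scale[OF \<phi>])
    qed
    moreover have "(\<lambda>\<tau>. jfac A \<tau> powi (- k) * (\<Sum>m\<le>nil_bound N. Xfac A \<tau> ^ m / fact m *
        (\<Sum>n\<in>{lowdeg..N}. jfac A \<tau> powi (2 * n) * \<phi> ((L1 ^^ m) (vcomp V b n))))) holomorphic_on uhp"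
      by (intro holomorphic_intros jfac_holomorphic Xfac_holomorphic A) (auto simp: jfac_nz[OF A])
    ultimately show ?thesis by simp
  qed
  have "\<phi> (vslash V k A f \<tau>) = (\<Sum>i\<in>I. \<psi> i (f (moebius A \<tau>)) * \<phi> (weight_act k A \<tau> (snd i)))" if t: "\<tau> \<in> uhp" for \<tau>
  proof -
    have "f (moebius A \<tau>) \<in> vfilt V N" using f moebius_uhp[OF A t] unfolding vholomorphic_def by blast
    from co[OF this] have "weight_act k A \<tau> (f (moebius A \<tau>)) = (\<Sum>i\<in>I. \<psi> i (f (moebius A \<tau>)) \<odot> weight_act k A \<tau> (snd i))"
      using vlinear_sum[OF weight_act_linear, of k A \<tau> "\<lambda>i. \<psi> i (f (moebius A \<tau>)) \<odot> snd i" I] by (simp add: vlinear_scale[OF weight_act_linear])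
    thus ?thesis unfolding vslash_weight_act[OF A t] by (simp add: vfunctional_sum[OF \<phi>] vfunctional_scale[OF \<phi>])
  qed
  moreover have "(\<lambda>\<tau>. \<Sum>i\<in>I. \<psi> i (f (moebius A \<tau>)) * \<phi> (weight_act k A \<tau> (snd i))) holomorphic_on uhp"
    by (intro holomorphic_on_sum holomorphic_on_mult 1 2 bN)
  ultimately show ?thesis by (simp cong: holomorphic_cong)
qed

end

context voa_forms
begin

text \<open>
\<open>f \<parallel> \<sigma>\<close> has period \<open>w\<close> because \<open>\<sigma>\<close> conjugates the translation by \<open>w\<close> to an element of \<open>\<Gamma>\<close>; expand its coordinates.
\<close>

lemma invariant_q_expansion:
  assumes f: "vholomorphic V N f" and inv: "\<And>\<gamma> \<tau>. \<gamma> \<in> \<Gamma> \<Longrightarrow> \<tau> \<in> uhp \<Longrightarrow> vslash V k \<gamma> f \<tau> = f \<tau>"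
    and s: "\<sigma> \<in> SL2R" and w: "cusp_width \<Gamma> \<sigma> w" and bd: "vbounded_at_i_infinity V (vslash V k \<sigma> f)"
  shows "has_q_expansion V N w (vslash V k \<sigma> f)"
proof -
  define g where "g = vslash V k \<sigma> f"
  have w0: "w > 0" using w by (simp add: cusp_width_def)
  have "1 * w \<in> range (\<lambda>n::int. of_int n * w)" by (rule range_eqI[of _ _ 1]) simp
  hence wG: "cusp_shift \<sigma> w \<in> \<Gamma>" using w by (auto simp: cusp_width_def cusp_shift_def)
  have fN: "f \<tau> \<in> vfilt V N" if "\<tau> \<in> uhp" for \<tau> using f that by (simp add: vholomorphic_def)
  have gN: "g \<tau> \<in> vfilt V N" if "\<tau> \<in> uhp" for \<tau>
    unfolding g_def vslash_weight_act[OF s that] by (intro weight_act_vfilt fN moebius_uhp s that)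
  have per: "g (\<tau> + of_real w) = g \<tau>" if t: "\<tau> \<in> uhp" for \<tau>
  proof -
    have T: "translation w \<in> SL2R" by simp
    have "g (\<tau> + of_real w) = weight_act k (translation w) \<tau> (g (moebius (translation w) \<tau>))"
      by (simp add: weight_act_def jfac_def Xfac_def moebius_def exp_L1_0 grade_scale_1)
    also have "\<dots> = vslash V k (\<sigma> ** translation w) f \<tau>"
      unfolding g_def by (rule vslash_mult[OF s T t, symmetric])
    also have "\<sigma> ** translation w = cusp_shift \<sigma> w ** \<sigma>" by (simp add: cusp_shift_def SL2R_cancel s)
    also have "vslash V k (cusp_shift \<sigma> w ** \<sigma>) f \<tau> = weight_act k \<sigma> \<tau> (vslash V k (cusp_shift \<sigma> w) f (moebius \<sigma> \<tau>))"
      by (rule vslash_mult[OF cusp_shift_SL2R[OF s] s t])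
    also have "\<dots> = g \<tau>" unfolding inv[OF wG moebius_uhp[OF s t]] g_def vslash_weight_act[OF s t] ..
    finally show ?thesis .
  qed
  obtain I \<psi> where cs: "coordinate_system N I \<psi>" using coordinate_system_exists by blast
  note lin = coordinate_systemD(2)[OF cs]
    and bN = coordinate_systemD(4)[OF cs]
    and co = coordinate_systemD(5)[OF cs]
  have "\<exists>c. \<forall>\<tau>\<in>uhp. (\<lambda>n. c n * qpar w \<tau> ^ n) sums \<psi> i (g \<tau>)" if i: "i \<in> I" for i
  proof (rule periodic_q_expansion[OF w0])
    show "(\<lambda>\<tau>. \<psi> i (g \<tau>)) holomorphic_on uhp" unfolding g_def by (rule vslash_holomorphic[OF f s lin[OF i]])
    show "bounded_at_i_infinity (\<lambda>\<tau>. \<psi> i (g \<tau>))" using bd lin[OF i] by (simp add: vbounded_at_i_infinity_def g_def)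
  qed (simp add: per)
  then obtain c where c: "\<And>i \<tau>. i \<in> I \<Longrightarrow> \<tau> \<in> uhp \<Longrightarrow> (\<lambda>n. c i n * qpar w \<tau> ^ n) sums \<psi> i (g \<tau>)" by metis
  show ?thesis unfolding has_q_expansion_def g_def[symmetric] qpar_def[symmetric]
  proof (intro exI[of _ "\<lambda>n. \<Sum>i\<in>I. c i n \<odot> snd i"] conjI allI ballI impI)
    show "(\<Sum>i\<in>I. c i n \<odot> snd i) \<in> vfilt V N" for n by (intro vfilt_sum vfilt_scale bN)
    fix \<tau> \<phi> assume t: "\<tau> \<in> uhp" and \<phi>: "vfunctional V \<phi>"
    have "(\<lambda>n. \<Sum>i\<in>I. c i n * qpar w \<tau> ^ n * \<phi> (snd i)) sums (\<Sum>i\<in>I. \<psi> i (g \<tau>) * \<phi> (snd i))"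
      by (intro sums_sum sums_mult2 c t)
    also have "(\<lambda>n. \<Sum>i\<in>I. c i n * qpar w \<tau> ^ n * \<phi> (snd i)) = (\<lambda>n. \<phi> (\<Sum>i\<in>I. c i n \<odot> snd i) * qpar w \<tau> ^ n)"
      by (simp add: vfunctional_sum[OF \<phi>] vfunctional_scale[OF \<phi>] sum_distrib_left sum_distrib_right mult_ac)
    also have "(\<Sum>i\<in>I. \<psi> i (g \<tau>) * \<phi> (snd i)) = \<phi> (\<Sum>i\<in>I. \<psi> i (g \<tau>) \<odot> snd i)"
      by (simp add: vfunctional_sum[OF \<phi>] vfunctional_scale[OF \<phi>])
    also have "\<dots> = \<phi> (g \<tau>)" using co[OF gN[OF t]] by simp
    finally show "(\<lambda>n. \<phi> (\<Sum>i\<in>I. c i n \<odot> snd i) * qpar w \<tau> ^ n) sums \<phi> (g \<tau>)" .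
  qed
qed

section \<open>The kernel of Lambda\<close>

lemma vmodular_vq_data:
  assumes "f \<in> vmodular V \<Gamma> k"
  shows "\<exists>N. vq_data \<Gamma> k N 0 f (\<lambda>m. if m = 0 then f else (\<lambda>_. 0))"
proof -
  from assms obtain N where out: "\<forall>\<tau>. \<tau> \<notin> uhp \<longrightarrow> f \<tau> = 0" and hol: "vholomorphic V N f"
    and inv: "\<forall>\<gamma>\<in>\<Gamma>. \<forall>\<tau>\<in>uhp. vslash V k \<gamma> f \<tau> = f \<tau>"
    and qe: "\<forall>\<sigma>\<in>SL2R. \<forall>w. at_cusp \<sigma> \<and> cusp_width \<Gamma> \<sigma> w \<longrightarrow>
           has_q_expansion V N w (vslash V k \<sigma> f)"
    unfolding vmodular_def by blast
  have bd: "vbounded_at_i_infinity V (vslash V k \<sigma> f)" if s: "\<sigma> \<in> SL2R" "at_cusp \<sigma>" for \<sigma>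
    unfolding vbounded_at_i_infinity_def
  proof (intro allI impI)
    fix \<phi> assume \<phi>: "vfunctional V \<phi>"
    obtain w where w: "cusp_width \<Gamma> \<sigma> w" by (rule cusp_width_exists[OF s])
    hence "has_q_expansion V N w (vslash V k \<sigma> f)" using qe s by blast
    then obtain a where a: "\<And>\<tau>. \<tau> \<in> uhp \<Longrightarrow> (\<lambda>n. \<phi> (a n) * qpar w \<tau> ^ n) sums \<phi> (vslash V k \<sigma> f \<tau>)"
      using \<phi> unfolding has_q_expansion_def qpar_def by blast
    have "w > 0" using w by (simp add: cusp_width_def)
    thus "bounded_at_i_infinity (\<lambda>\<tau>. \<phi> (vslash V k \<sigma> f \<tau>))" by (rule q_expansion_bounded[OF _ a])
  qed
  have "vq_data \<Gamma> k N 0 f (\<lambda>m. if m = 0 then f else (\<lambda>_. 0))"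
    unfolding vq_data_def
  proof (intro conjI ballI impI allI)
    fix \<sigma> m assume s: "\<sigma> \<in> SL2R" "at_cusp \<sigma>"
    show "vbounded_at_i_infinity V (vslash V (k - 2 * int m) \<sigma> (if m = 0 then f else (\<lambda>_. 0)))"
      using bd[OF s] vbounded_vslash_zero[OF s(1)] by (cases "m = 0") simp_all
  qed (use out hol inv vholomorphic_zero in auto)
  thus ?thesis by blast
qed

text \<open>
\<open>\<Lambda> f = 0\<close> forces \<open>m! Q\<^sub>m = \<Lambda>\<^sup>m f = 0\<close> for \<open>m > 0\<close>, hence \<open>f \<parallel> \<gamma> = f\<close>. For \<open>\<gamma>\<close> in the stabilizer of an elliptic
point \<open>\<tau>\<close> this reads \<open>j\<^sup>-\<^sup>k K\<^sup>-\<^sup>1 f(\<tau>) = f(\<tau>)\<close>, which is the condition at that point.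
\<close>

lemma vmodular_iff:
  "f \<in> vmodular V \<Gamma> k \<longleftrightarrow> f \<in> vquasimodular V \<Gamma> k \<and> Lam f = (\<lambda>_. 0)"
proof
  assume "f \<in> vmodular V \<Gamma> k"
  then obtain N where d: "vq_data \<Gamma> k N 0 f (\<lambda>m. if m = 0 then f else (\<lambda>_. 0))" using vmodular_vq_data by blast
  thus "f \<in> vquasimodular V \<Gamma> k \<and> Lam f = (\<lambda>_. 0)"
    using vquasimodular_iff[OF G_sub] Lambda_eq_Q1[OF d] by auto
next
  assume *: "f \<in> vquasimodular V \<Gamma> k \<and> Lam f = (\<lambda>_. 0)"
  then obtain N s Q where d: "vq_data \<Gamma> k N s f Q" using vquasimodular_iff[OF G_sub] by blast
  have Q0: "Q m \<tau> = 0" if "m \<noteq> 0" for m \<tau>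
  proof -
    obtain m' where m: "m = Suc m'" using \<open>m \<noteq> 0\<close> by (cases m) auto
    have "(Lam ^^ m) f = (Lam ^^ m') (\<lambda>_. 0)"
      unfolding m funpow_Suc_right comp_apply using * by simp
    also have "\<dots> = (\<lambda>\<tau>. fact m' \<odot> 0)" by (rule Lambda_power[OF vq_data_zero[OF G_sub]])
    finally have "fact m \<odot> Q m \<tau> = 0" unfolding Lambda_power[OF d] by (simp add: fun_eq_iff del: vs.scale_eq_0_iff)
    thus ?thesis by simp
  qed
  have inv: "vslash V k \<gamma> f \<tau> = f \<tau>" if "\<gamma> \<in> \<Gamma>" "\<tau> \<in> uhp" for \<gamma> \<tau>
  proof -
    have "vslash V k \<gamma> f \<tau> = (\<Sum>m\<le>s. Xfac \<gamma> \<tau> ^ m \<odot> Q m \<tau>)" using d that unfolding vq_data_def by blast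
    also have "\<dots> = (\<Sum>m\<le>s. if m = 0 then Q 0 \<tau> else 0)" by (intro sum.cong) (auto simp: Q0)
    also have "\<dots> = f \<tau>" using vq_data_Q0[OF d] by simp
    finally show ?thesis .
  qed
  have hol: "vholomorphic V N f" using d by (simp add: vq_data_def)
  have bd: "vbounded_at_i_infinity V (vslash V k \<sigma> f)" if s: "\<sigma> \<in> SL2R" "at_cusp \<sigma>" for \<sigma>
  proof -
    have "vbounded_at_i_infinity V (vslash V (k - 2 * int 0) \<sigma> (Q 0))" using d s unfolding vq_data_def by blast
    thus ?thesis using vq_data_Q0[OF d] by simp
  qed
  show "f \<in> vmodular V \<Gamma> k"
    unfolding vmodular_def mem_Collect_eq
  proof (intro conjI exI[of _ N] hol ballI allI impI)
    show "f \<tau> = 0" if "\<tau> \<notin> uhp" for \<tau> using d that by (simp add: vq_data_def)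
    show "vslash V k \<gamma> f \<tau> = f \<tau>" if "\<gamma> \<in> \<Gamma>" "\<tau> \<in> uhp" for \<gamma> \<tau> by (rule inv[OF that])
    show "has_q_expansion V N w (vslash V k \<sigma> f)"
      if "\<sigma> \<in> SL2R" "at_cusp \<sigma> \<and> cusp_width \<Gamma> \<sigma> w" for \<sigma> w
      using that by (intro invariant_q_expansion[OF hol inv] bd) auto
    fix \<tau> \<gamma> assume e: "\<tau> \<in> elliptic_points \<Gamma>" and st: "stabilizer_generator \<Gamma> \<tau> \<gamma>"
    have t: "\<tau> \<in> uhp" and g: "\<gamma> \<in> \<Gamma>" and fix_t: "moebius \<gamma> \<tau> = \<tau>"
      using e st by (auto simp: elliptic_points_def stabilizer_generator_def)
    have j: "jfac \<gamma> \<tau> \<noteq> 0" by (rule jfac_nz[OF G_SL2R[OF g] t])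
    have "weight_act k \<gamma> \<tau> (f \<tau>) = f \<tau>" using inv[OF g t] by (simp add: vslash_weight_act[OF G_SL2R[OF g] t] fix_t)
    hence "jfac \<gamma> \<tau> powi k \<odot> f \<tau> = weight_act 0 \<gamma> \<tau> (f \<tau>)" using weight_act_shift[OF j, of k k "f \<tau>"] by simp
    hence "Kop V \<gamma> \<tau> (jfac \<gamma> \<tau> powi k \<odot> f \<tau>) = f \<tau>"
      using Kop_inv_cancel[OF G_SL2R[OF g] t, of "f \<tau>"] by (simp add: weight_act_def)
    moreover have "Kop V \<gamma> \<tau> (c \<odot> v) = c \<odot> Kop V \<gamma> \<tau> v" for c v
      by (simp add: Kop_def L0_power_neg vlinear_scale[OF exp_L1_linear] vlinear_scale[OF grade_scale_linear])
    ultimately show "jfac \<gamma> \<tau> powi k \<odot> Kop V \<gamma> \<tau> (f \<tau>) = f \<tau>" by simp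
  qed
qed

lemma Lambda_vquasimodular_space:
  assumes "F \<in> vquasimodular_space V \<Gamma>" shows "Lam F \<in> vquasimodular_space V \<Gamma>"
proof -
  obtain S f where S: "finite S" "\<And>k. k \<in> S \<Longrightarrow> f k \<in> vquasimodular V \<Gamma> k" "F = (\<lambda>\<tau>. \<Sum>k\<in>S. f k \<tau>)"
    using assms unfolding vquasimodular_space_def weight_sum_def by blast
  have "Lam F = (\<lambda>\<tau>. \<Sum>k\<in>S. Lam (f k) \<tau>)"
    unfolding S(3) by (rule Lambda_sum[OF S(1) vquasimodular_ring_valued[OF S(2)]])
  also have "\<dots> = (\<lambda>\<tau>. \<Sum>l\<in>(\<lambda>k. k - 2) ` S. Lam (f (l + 2)) \<tau>)"
    by (subst sum.reindex) (auto simp: inj_on_def)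
  finally show ?thesis
    unfolding vquasimodular_space_def weight_sum_def using S(1) vquasimodular_Lambda[OF S(2)]
    by (intro CollectI exI[of _ "(\<lambda>k. k - 2) ` S"] exI[of _ "\<lambda>l. Lam (f (l + 2))"]) auto
qed

text \<open>
If \<open>\<Lambda>\<close> kills a sum of forms of different weights, it kills each of them, since the images have the different weights
\<open>k - 2\<close>.
\<close>

lemma kernel_Lambda:
  "weight_sum K (vmodular V \<Gamma>) = {F \<in> weight_sum K (vquasimodular V \<Gamma>). Lam F = (\<lambda>_. 0)}"
proof (intro equalityI subsetI)
  fix F assume "F \<in> weight_sum K (vmodular V \<Gamma>)"
  then obtain S f where S: "finite S" "S \<subseteq> K" "\<And>k. k \<in> S \<Longrightarrow> f k \<in> vmodular V \<Gamma> k" "F = (\<lambda>\<tau>. \<Sum>k\<in>S. f k \<tau>)"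
    unfolding weight_sum_def by blast
  have q: "f k \<in> vquasimodular V \<Gamma> k" "Lam (f k) = (\<lambda>_. 0)" if "k \<in> S" for k
    using S(3)[OF that] unfolding vmodular_iff by auto
  have "Lam F = (\<lambda>\<tau>. \<Sum>k\<in>S. Lam (f k) \<tau>)"
    unfolding S(4) by (rule Lambda_sum[OF S(1) vquasimodular_ring_valued[OF q(1)]])
  also have "\<dots> = (\<lambda>_. 0)" using q(2) by simp
  finally show "F \<in> {F \<in> weight_sum K (vquasimodular V \<Gamma>). Lam F = (\<lambda>_. 0)}"
    using S q(1) unfolding weight_sum_def by blast
next
  fix F assume F: "F \<in> {F \<in> weight_sum K (vquasimodular V \<Gamma>). Lam F = (\<lambda>_. 0)}"
  then obtain S f where S: "finite S" "S \<subseteq> K" "\<And>k. k \<in> S \<Longrightarrow> f k \<in> vquasimodular V \<Gamma> k" "F = (\<lambda>\<tau>. \<Sum>k\<in>S. f k \<tau>)"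
    unfolding weight_sum_def by blast
  have "(\<lambda>\<tau>. \<Sum>l\<in>(\<lambda>k. k - 2) ` S. Lam (f (l + 2)) \<tau>) = (\<lambda>\<tau>. \<Sum>k\<in>S. Lam (f k) \<tau>)"
    by (subst sum.reindex) (auto simp: inj_on_def)
  also have "\<dots> = Lam F"
    unfolding S(4) by (rule Lambda_sum[OF S(1) vquasimodular_ring_valued[OF S(3)], symmetric])
  also have "\<dots> = (\<lambda>_. 0)" using F by blast
  finally have zero: "(\<lambda>\<tau>. \<Sum>l\<in>(\<lambda>k. k - 2) ` S. Lam (f (l + 2)) \<tau>) = (\<lambda>_. 0)" .
  have "Lam (f k) = (\<lambda>_. 0)" if k: "k \<in> S" for k
  proof -
    have "Lam (f (k - 2 + 2)) = (\<lambda>_. 0)"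
    proof (rule vquasimodular_weights_independent[OF _ _ zero])
      fix l assume "l \<in> (\<lambda>k. k - 2) ` S"
      thus "Lam (f (l + 2)) \<in> vquasimodular V \<Gamma> l"
        using vquasimodular_Lambda[OF S(3)] by auto
    qed (use S(1) k in auto)
    thus ?thesis by simp
  qed
  hence "f k \<in> vmodular V \<Gamma> k" if "k \<in> S" for k using S(3)[OF that] that unfolding vmodular_iff by blast
  thus "F \<in> weight_sum K (vmodular V \<Gamma>)" using S(1,2,4) unfolding weight_sum_def by blast
qed

end

theorem theoremD:
  fixes \<Gamma> :: "(real^2^2) set" and V :: "('v::ab_group_add) qvoa_data"
    and E2 :: "complex \<Rightarrow> complex"
  assumes "fuchsian_first_kind \<Gamma>" and "cusps \<Gamma> \<noteq> {}"
    and "quasi_voa V"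
    and "is_E2 \<Gamma> E2"
  shows "(\<forall>F \<in> vquasimodular_space V \<Gamma>. Lambda_op V \<Gamma> E2 F \<in> vquasimodular_space V \<Gamma>) \<and>
    (\<forall>k. \<forall>f \<in> vquasimodular V \<Gamma> k.
       (\<exists>n. (Lambda_op V \<Gamma> E2 ^^ n) f = (\<lambda>_. 0)) \<and>
       (\<forall>\<gamma>\<in>\<Gamma>. \<forall>\<tau>\<in>uhp. vslash V k \<gamma> f \<tau> =
          Sum_any (\<lambda>m::nat. vscale V (Xfac \<gamma> \<tau> ^ m / fact m) ((Lambda_op V \<Gamma> E2 ^^ m) f \<tau>)))) \<and>
    vmodular_space V \<Gamma> =
      {F \<in> vquasimodular_space V \<Gamma>. Lambda_op V \<Gamma> E2 F = (\<lambda>_. 0)} \<and>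
    weight_sum {0..} (vmodular V \<Gamma>) =
      {F \<in> weight_sum {0..} (vquasimodular V \<Gamma>). Lambda_op V \<Gamma> E2 F = (\<lambda>_. 0)}"
proof -
  interpret quasi_voa V by (rule assms(3))
  interpret voa_forms \<Gamma> E2 V
    by unfold_locales (rule assms(1), rule assms(2), rule assms(4))
  show ?thesis
  proof (intro conjI ballI allI)
    fix F assume "F \<in> vquasimodular_space V \<Gamma>"
    thus "Lambda_op V \<Gamma> E2 F \<in> vquasimodular_space V \<Gamma>" by (rule Lambda_vquasimodular_space)
  next
    fix k f assume "f \<in> vquasimodular V \<Gamma> k"
    thus "\<exists>n. (Lambda_op V \<Gamma> E2 ^^ n) f = (\<lambda>_. 0)" by (rule exponential_formula(1))
  next
    fix k f \<gamma> \<tau> assume "f \<in> vquasimodular V \<Gamma> k" "\<gamma> \<in> \<Gamma>" "\<tau> \<in> uhp"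
    thus "vslash V k \<gamma> f \<tau> = Sum_any (\<lambda>m::nat. vscale V (Xfac \<gamma> \<tau> ^ m / fact m) ((Lambda_op V \<Gamma> E2 ^^ m) f \<tau>))"
      by (rule exponential_formula(2))
  qed (simp_all only: vmodular_space_def vquasimodular_space_def kernel_Lambda)
qed

end
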